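(* Let $d\geq 2$, and let $E,Z\subset\mathbb{R}^d$ and $G\subset O(d)$ be non-empty Borel sets such that $\dim_{\mathcal H}G>\frac{(d-1)(d-2)}{2}$. Let $GE=\{g(x): x\in E, g\in G\}$ and $GE+Z=\{y+z: y\in GE, z\in Z\}$. Then: (i) $\dim_{\mathcal F}(GE)\geq \dim_{\mathcal{SF}}E+\dim_{\mathcal H}G-\frac{d^2-d}{2}$, and $\dim_{\mathcal S}(GE+Z)\geq \dim_{\mathcal{SF}}E+\dim_{\mathcal H}G+\dim_{\mathcal H}Z-\frac{d^2-d}{2}$. (ii) If $\dim_{\mathcal{SF}}E+\dim_{\mathcal H}G+\dim_{\mathcal H}Z>\frac{d^2+d}{2}$, then $\mathcal{L}^d(GE+Z)>0$. (iii) For $0<u<d$, if $\dim_{\mathcal{SF}}E+\dim_{\mathcal H}G+\dim_{\mathcal H}Z>\frac{d^2-d}{2}+u$, then $\dim_{\mathcal H}(GE+Z)\geq u$.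
   Context: $O(d)$ is the orthogonal group of $\mathbb{R}^d$ with its usual metric (e.g. from the operator norm), $\mathcal{L}^d$ is Lebesgue measure on $\mathbb{R}^d$, and $\dim_{\mathcal H}$ is Hausdorff dimension. For $A\subset\mathbb{R}^d$, $\mathcal{M}(A)$ is the set of non-zero Radon measures on $\mathbb{R}^d$ with compact support contained in $A$. The Fourier transform is $\widehat{\mu}(\xi)=\int e^{-2\pi i\xi\cdot x}\,d\mu(x)$. The Fourier dimension of $A$ is $\dim_{\mathcal F}A=\sup\{s\leq d:\ \exists \mu\in\mathcal{M}(A),\ \exists C>0 \text{ with } |\widehat{\mu}(x)|\leq C(1+|x|)^{-s/2}\text{ for all }x\in\mathbb{R}^d\}$. The spherical average of $\mu$ is $\sigma(\mu)(r)=\int_{S^{d-1}}|\widehat{\mu}(rv)|^2\,d\sigma(v)$ for $r>0$, where $\sigma$ is surface measure on the unit sphere $S^{d-1}$. The spherical Fourier dimension of $A$ is $\dim_{\mathcal{SF}}A=\sup\{\alpha\leq d:\ \exists\mu\in\mathcal{M}(A),\ \exists C>0\text{ with }\sigma(\mu)(r)\leq Cr^{-\alpha}\text{ for all }r>0\}$. The Sobolev dimension of $\mu\in\mathcal{M}(\mathbb{R}^d)$ is $\dim_{\mathcal S}\mu=\sup\{s\in\mathbb{R}: \int|\widehat{\mu}(x)|^2(1+|x|)^{s-d}\,dx<\infty\}$, and the Sobolev dimension of a set $A$ is $\dim_{\mathcal S}A=\sup\{\dim_{\mathcal S}\mu:\ \mu\in\mathcal{M}(A)\text{ a probability measure}\}$.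 *)

theory Defs
  imports "HOL-Analysis.Analysis"
begin

section \<open>Hausdorff dimension\<close>

text \<open>
  The \<open>s\<close>-th power of the diameter, with the usual conventions for \<open>s = 0\<close>: a non-empty set
  contributes \<open>1\<close> (so that the \<open>0\<close>-dimensional measure counts points) and the empty set
  contributes \<open>0\<close>.  The case distinction is needed because \<open>0 powr 0 = 0\<close>.
\<close>

definition diam_pow :: "real \<Rightarrow> 'a::metric_space set \<Rightarrow> ennreal" where
  "diam_pow s U = (if U = {} then 0 else if s = 0 then 1 else ennreal (diameter U powr s))"

text \<open>
  Boundedness of the covering sets is required explicitly, since \<open>diameter\<close> is unspecified
  on unbounded sets.
\<close>

definition hausdorff_pre_measure :: "real \<Rightarrow> real \<Rightarrow> 'a::metric_space set \<Rightarrow> ennreal" where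
  "hausdorff_pre_measure s \<delta> A =
     Inf {(\<Sum>i. diam_pow s (U i)) | U :: nat \<Rightarrow> 'a set.
            A \<subseteq> (\<Union>i. U i) \<and> (\<forall>i. bounded (U i) \<and> diameter (U i) \<le> \<delta>)}"

definition hausdorff_measure :: "real \<Rightarrow> 'a::metric_space set \<Rightarrow> ennreal" where
  "hausdorff_measure s A = (SUP \<delta>\<in>{0<..}. hausdorff_pre_measure s \<delta> A)"

definition hausdorff_dim :: "'a::metric_space set \<Rightarrow> ereal" where
  "hausdorff_dim A = Inf (ereal ` {s. 0 \<le> s \<and> hausdorff_measure s A = 0})"


section \<open>Compactly supported Radon measures\<close>

definition radon_measure :: "'a::topological_space measure \<Rightarrow> bool" where
  "radon_measure \<mu> \<longleftrightarrow>
     sets \<mu> = sets borel \<and>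
     (\<forall>K. compact K \<longrightarrow> emeasure \<mu> K < \<infinity>) \<and>
     (\<forall>V. open V \<longrightarrow> emeasure \<mu> V = (SUP K\<in>{K. compact K \<and> K \<subseteq> V}. emeasure \<mu> K)) \<and>
     (\<forall>B\<in>sets borel. emeasure \<mu> B = (INF V\<in>{V. open V \<and> B \<subseteq> V}. emeasure \<mu> V))"

definition measure_support :: "'a::topological_space measure \<Rightarrow> 'a set" where
  "measure_support \<mu> = {x. \<forall>U. open U \<longrightarrow> x \<in> U \<longrightarrow> emeasure \<mu> U > 0}"

definition radon_measures_on :: "'a::euclidean_space set \<Rightarrow> 'a measure set" where
  "radon_measures_on A =
     {\<mu>. radon_measure \<mu> \<and> emeasure \<mu> UNIV \<noteq> 0 \<and>
         compact (measure_support \<mu>) \<and> measure_support \<mu> \<subseteq> A}"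


section \<open>Fourier transform and Fourier-analytic dimensions\<close>

definition fourier_transform :: "'a::euclidean_space measure \<Rightarrow> 'a \<Rightarrow> complex" where
  "fourier_transform \<mu> \<xi> = (LINT x|\<mu>. exp (- (2 * of_real pi * \<i> * of_real (\<xi> \<bullet> x))))"

definition fourier_dim :: "'a::euclidean_space set \<Rightarrow> ereal" where
  "fourier_dim A = Sup (ereal ` {s. s \<le> real DIM('a) \<and>
     (\<exists>\<mu>\<in>radon_measures_on A. \<exists>C>0. \<forall>x.
        norm (fourier_transform \<mu> x) \<le> C * (1 + norm x) powr (- s / 2))})"

text \<open>
  Surface measure on the unit sphere, as a Borel measure on the whole space: the surface measure
  of \<open>B\<close> is \<open>d\<close> times the Lebesgue measure of the cone of all \<open>t *\<^sub>R v\<close> with \<open>0 < t \<le> 1\<close>,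
  \<open>v \<in> B\<close>, \<open>norm v = 1\<close>.  Here \<open>sgn x = x /\<^sub>R norm x\<close> is the radial projection.
\<close>

definition sphere_measure :: "'a::euclidean_space measure" where
  "sphere_measure =
     scale_measure (of_nat DIM('a)) (distr (restrict_space lborel (cball 0 1 - {0})) borel sgn)"

definition spherical_average :: "'a::euclidean_space measure \<Rightarrow> real \<Rightarrow> ennreal" where
  "spherical_average \<mu> r =
     (\<integral>\<^sup>+ v. ennreal ((norm (fourier_transform \<mu> (r *\<^sub>R v)))\<^sup>2) \<partial>sphere_measure)"

definition spherical_fourier_dim :: "'a::euclidean_space set \<Rightarrow> ereal" where
  "spherical_fourier_dim A = Sup (ereal ` {\<alpha>. \<alpha> \<le> real DIM('a) \<and>
     (\<exists>\<mu>\<in>radon_measures_on A. \<exists>C>0. \<forall>r>0.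
        spherical_average \<mu> r \<le> ennreal (C * r powr (- \<alpha>)))})"

definition sobolev_dim_measure :: "'a::euclidean_space measure \<Rightarrow> ereal" where
  "sobolev_dim_measure \<mu> = Sup (ereal ` {s.
     (\<integral>\<^sup>+ x. ennreal ((norm (fourier_transform \<mu> x))\<^sup>2 * (1 + norm x) powr (s - real DIM('a)))
        \<partial>lborel) < \<infinity>})"

definition sobolev_dim :: "'a::euclidean_space set \<Rightarrow> ereal" where
  "sobolev_dim A =
     (SUP \<mu>\<in>{\<mu> \<in> radon_measures_on A. emeasure \<mu> UNIV = 1}. sobolev_dim_measure \<mu>)"


section \<open>Set operations\<close>

text \<open>
  Orthogonal maps are represented by their matrices.  The metric of \<open>real^'n^'n\<close> is the Euclidean
  (Frobenius) one; it is bi-Lipschitz equivalent to that of the operator norm, so that Borel sets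
  and Hausdorff dimension are the same for both.
\<close>

definition group_image :: "(real^'n^'n) set \<Rightarrow> (real^'n) set \<Rightarrow> (real^'n) set" where
  "group_image G E = {g *v x | g x. g \<in> G \<and> x \<in> E}"

definition sumset :: "'a::plus set \<Rightarrow> 'a set \<Rightarrow> 'a set" where
  "sumset A B = {y + z | y z. y \<in> A \<and> z \<in> B}"

end

theory Submission
  imports Defs "HOL-Probability.Characteristic_Functions" "HOL-Real_Asymp.Real_Asymp"
begin

text \<open>
  Let \<open>\<mu>\<close> on \<open>E\<close> have spherical averages of order \<open>r powr (- \<alpha>)\<close> and let \<open>\<theta>\<close> be a Frostman measure of
  exponent \<open>t\<close> on \<open>G\<close>.  Replace \<open>\<mu>\<close> by \<open>exp (- pi * norm x ^ 2) \<mu>\<close>, which has the same support, and let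
  \<open>\<nu>\<close> be the image of \<open>\<theta> \<Otimes> \<mu>\<close> under \<open>(g, x) \<mapsto> g x\<close>.  Because of the Gaussian factor, \<open>|\<nu>^(\<xi>)|\<^sup>2\<close> is
  bounded by an average of \<open>|\<mu>^|\<^sup>2\<close> over the unit neighbourhood of the sphere of radius \<open>r = norm \<xi>\<close>
  with respect to the distribution of \<open>g\<^sup>T \<xi>\<close> thickened to scale one.  The elements of \<open>O(d)\<close> that
  nearly fix a direction form a neighbourhood of a coset of \<open>O(d - 1)\<close>, so this distribution charges
  balls of radius one at most \<open>r powr (- (t - (d - 1)(d - 2)/2))\<close>, and polar coordinates give
  \<open>|\<nu>^(\<xi>)|\<^sup>2 \<lesssim> r powr (- (\<alpha> + t - (d\<^sup>2 - d)/2))\<close>.  Adding an independent Frostman measure on \<open>Z\<close>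
  multiplies the transforms; the energy of the resulting measure controls the Sobolev dimension, the
  Hausdorff dimension and the Lebesgue measure of its support.

  Frostman measures on Borel sets are obtained from the Choquet capacitability of the dyadic
  Hausdorff content.  Capacitability also yields that \<open>GE + Z\<close>, a continuous image of a Borel set, is
  Lebesgue measurable; this is needed because the measure of a non-measurable set is \<open>0\<close> by convention.
\<close>

section \<open>Suslin sets and capacitability\<close>

text \<open>The hypothesis on \<open>G\<close> enters as \<beta> = t - (d - 1)(d - 2)/2 >= 0: the
  orbit bound then stays valid at distances beyond norm \<xi>, where only the total mass is known. A
  Gaussian is the sole cut-off because it is positive, self-dual and divisible: half of its exponent
  places a frequency near a sphere, the other half is summed over layers, and every interchange is
  Tonelli or bounded Fubini, without Fourier inversion. At scale 1/R the same function converts ball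
  masses into Fourier integrals and back. In Frostman's lemma the obstacle is that dyadic cells are
  half-open, so the content need not be continuous along decreasing compact sets; capacitability is
  therefore phrased with open neighbourhoods of the compact set, and only null compact sets must
  have neighbourhoods of small content. No supremum is assumed to be attained: real exponents are
  chosen strictly below the dimensions, and a Dirac mass covers exponents that may be taken to be 0.
  Since \<open>fourier_dim\<close> admits exponents up to d only, the Frostman exponent on
  \<open>G\<close> must also be bounded by the dimension (d^2 - d)/2 of O(d).\<close>

definition suslin_scheme :: "(nat \<Rightarrow> (nat \<Rightarrow> nat) \<Rightarrow> 'a::topological_space set) \<Rightarrow> 'a set \<Rightarrow> bool" where
  "suslin_scheme F A \<longleftrightarrow> (\<forall>n s. closed (F n s)) \<and>
     (\<forall>n s t. (\<forall>i<n. s i = t i) \<longrightarrow> F n s = F n t) \<and> A = {x. \<exists>s. \<forall>n. x \<in> F n s}"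

lemma suslin_schemeD:
  assumes "suslin_scheme F A"
  shows "closed (F n s)" "(\<And>i. i < n \<Longrightarrow> s i = t i) \<Longrightarrow> F n s = F n t" "A = {x. \<exists>s. \<forall>n. x \<in> F n s}"
  using assms unfolding suslin_scheme_def by blast+

text \<open>The Suslin operation over closed sets. Finite index sequences are encoded as functions
  of which \<open>F n\<close> sees only the first \<open>n\<close> values; the sets need not
  decrease with \<open>n\<close>.\<close>

definition suslin :: "'a::topological_space set \<Rightarrow> bool" where
  "suslin A \<longleftrightarrow> (\<exists>F. suslin_scheme F A)"

lemma suslin_closed: "closed A \<Longrightarrow> suslin A"
  unfolding suslin_def suslin_scheme_def by (rule exI[of _ "\<lambda>_ _. A"]) auto

text \<open>The first entry of a branch selects the set, and the shifted branch runs through the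
  scheme of that set. Level 0 of the new scheme is \<open>UNIV\<close>, because no entry has been
  read there.\<close>

lemma suslin_UN:
  fixes A :: "nat \<Rightarrow> 'a::topological_space set"
  assumes "\<And>i. suslin (A i)"
  shows "suslin (\<Union>i. A i)"
proof -
  obtain F where F: "\<And>i. suslin_scheme (F i) (A i)"
    using assms unfolding suslin_def by metis
  note cl = suslin_schemeD(1)[OF F] and dep = suslin_schemeD(2)[OF F] and eq = suslin_schemeD(3)[OF F]
  define G where "G n s = (case n of 0 \<Rightarrow> UNIV | Suc n \<Rightarrow> F (s 0) n (\<lambda>j. s (Suc j)))" for n s
  have "(\<Union>i. A i) = {x. \<exists>s. \<forall>n. x \<in> G n s}"
  proof (intro set_eqI iffI)
    fix x assume "x \<in> (\<Union>i. A i)"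
    then obtain i s where s: "\<And>n. x \<in> F i n s" using eq by auto
    have "\<forall>n. x \<in> G n (case_nat i s)" unfolding G_def using s by (auto split: nat.split)
    then show "x \<in> {x. \<exists>s. \<forall>n. x \<in> G n s}" by blast
  next
    fix x assume "x \<in> {x. \<exists>s. \<forall>n. x \<in> G n s}"
    then obtain s where s: "\<And>n. x \<in> G n s" by auto
    have "\<forall>n. x \<in> F (s 0) n (\<lambda>j. s (Suc j))" using s[of "Suc _"] by (auto simp: G_def)
    then show "x \<in> (\<Union>i. A i)" using eq by blast
  qed
  moreover have "closed (G n s)" for n s by (auto simp: G_def cl split: nat.split)
  moreover have "G n s = G n t" if "\<forall>i<n. s i = t i" for n s t
  proof (cases n)
    case (Suc k)
    have "F (s 0) k (\<lambda>j. s (Suc j)) = F (s 0) k (\<lambda>j. t (Suc j))"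
      using that Suc by (intro dep) auto
    then show ?thesis using that Suc by (auto simp: G_def)
  qed (auto simp: G_def)
  ultimately show ?thesis unfolding suslin_def suslin_scheme_def by (intro exI[of _ G]) blast
qed

text \<open>One branch codes countably many branches by \<open>prod_encode\<close>, and a level of
  the new scheme handles one pair (set, level). Pairing is increasing in its second component, so
  all entries that are looked at lie below the number of the new level.\<close>

lemma suslin_INT:
  fixes A :: "nat \<Rightarrow> 'a::topological_space set"
  assumes "\<And>i. suslin (A i)"
  shows "suslin (\<Inter>i. A i)"
proof -
  obtain F where F: "\<And>i. suslin_scheme (F i) (A i)"
    using assms unfolding suslin_def by metis
  note cl = suslin_schemeD(1)[OF F] and dep = suslin_schemeD(2)[OF F] and eq = suslin_schemeD(3)[OF F]
  define G where "G N s = F (fst (prod_decode N)) (snd (prod_decode N))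
    (\<lambda>j. s (prod_encode (fst (prod_decode N), j)))" for N s
  have "(\<Inter>i. A i) = {x. \<exists>s. \<forall>n. x \<in> G n s}"
  proof (intro set_eqI iffI)
    fix x assume "x \<in> (\<Inter>i. A i)"
    then obtain s where s: "\<And>i n. x \<in> F i n (s i)" using eq by simp metis
    have "\<forall>n. x \<in> G n (\<lambda>k. case_prod s (prod_decode k))" unfolding G_def using s by simp
    then show "x \<in> {x. \<exists>s. \<forall>n. x \<in> G n s}" by blast
  next
    fix x assume "x \<in> {x. \<exists>s. \<forall>n. x \<in> G n s}"
    then obtain s where s: "\<And>n. x \<in> G n s" by auto
    have "\<forall>n. x \<in> F i n (\<lambda>j. s (prod_encode (i, j)))" for i
      using s[of "prod_encode (i, _)"] by (auto simp: G_def)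
    then show "x \<in> (\<Inter>i. A i)" using eq by blast
  qed
  moreover have "closed (G n s)" for n s by (auto simp: G_def cl)
  moreover have "G n s = G n t" if "\<forall>i<n. s i = t i" for n s t
  proof -
    obtain i k where n: "n = prod_encode (i, k)" by (metis prod.exhaust prod_decode_inverse)
    have "prod_encode (i, j) < n" if "j < k" for j
    proof -
      have tri: "triangle a < triangle b" if "a < b" for a b
        using that by (induction b) (auto simp: less_Suc_eq)
      show ?thesis using that tri[of "i + j" "i + k"] by (auto simp: n prod_encode_def)
    qed
    then show ?thesis using that by (auto simp: G_def n intro!: dep)
  qed
  ultimately show ?thesis unfolding suslin_def suslin_scheme_def by (intro exI[of _ G]) blast
qed

lemma suslin_open:
  fixes A :: "'a::euclidean_space set"
  assumes "open A" shows "suslin A"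
proof (rule open_Union_compact_subsets[OF assms])
  fix C :: "nat \<Rightarrow> 'a set"
  assume "\<And>n. compact (C n)" and eq: "\<Union> (range C) = A"
  then have "suslin (\<Union>n. C n)" by (intro suslin_UN suslin_closed compact_imp_closed)
  then show ?thesis using eq by simp
qed

text \<open>Suslin sets are not closed under complement, so the induction over the generated
  sigma-algebra carries the complement along; for a union it is treated by
  \<open>suslin_INT\<close>.\<close>

lemma suslin_borel:
  fixes A :: "'a::euclidean_space set"
  assumes "A \<in> sets borel" shows "suslin A"
proof -
  have "A \<in> sigma_sets UNIV {S. open S}" using assms by (simp add: borel_def)
  then have "suslin A \<and> suslin (- A)"
  proof (induction rule: sigma_sets.induct)
    case (Basic a)
    then show ?case by (auto intro: suslin_open suslin_closed)
  next
    case Empty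
    then show ?case by (auto intro: suslin_open)
  next
    case (Compl a)
    then show ?case by (simp add: Compl_eq_Diff_UNIV[symmetric])
  next
    case (Union a)
    then show ?case by (auto simp: Compl_UN intro: suslin_UN suslin_INT)
  qed
  then show ?thesis ..
qed

text \<open>Choquet's argument: bound the coordinates of the Suslin scheme one after the other, losing
  none of the strict inequality; the branches below the bound form a compact set by Koenig's lemma.\<close>

lemma capacitability:
  fixes c :: "'a::euclidean_space set \<Rightarrow> ennreal"
  assumes mono: "\<And>A B. A \<subseteq> B \<Longrightarrow> c A \<le> c B"
    and up: "\<And>A. incseq A \<Longrightarrow> c (\<Union>i::nat. A i) \<le> (SUP i. c (A i))"
    and A: "A \<in> sets borel" and a: "a < c A"
  obtains K where "compact K" "K \<subseteq> A" "\<And>U. open U \<Longrightarrow> K \<subseteq> U \<Longrightarrow> a < c U"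
proof -
  obtain F where F: "suslin_scheme F A"
    using suslin_borel[OF A] unfolding suslin_def by blast
  note cl = suslin_schemeD(1)[OF F] and dep = suslin_schemeD(2)[OF F] and eq = suslin_schemeD(3)[OF F]
  have upE: "\<exists>i. a < c (B i)" if "incseq B" "a < c (\<Union>i::nat. B i)" for B
    using up[OF that(1)] that(2) by (metis less_SUP_iff order.strict_trans2)
  have "A = (\<Union>j::nat. A \<inter> cball 0 (real j))"
    using real_arch_simple by auto
  moreover have "incseq (\<lambda>j::nat. A \<inter> cball 0 (real j))"
    by (auto simp: incseq_def)
  ultimately obtain j :: nat where j: "a < c (A \<inter> cball 0 (real j))"
    using upE[of "\<lambda>j::nat. A \<inter> cball 0 (real j)"] a by auto
  define B where "B = cball (0::'a) (real j)"
  \<comment> \<open>\<open>P m k\<close> asks for a branch whose first \<open>k\<close> entries obey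
    the bound \<open>m\<close>; later entries are free. Bounding entry \<open>k\<close> as well
    gives an increasing union over the bound, so some bound keeps \<open>a < c\<close>.\<close>
  define P where "P m k = {x \<in> B. \<exists>s. (\<forall>i<k. s i \<le> m i) \<and> (\<forall>n. x \<in> F n s)}" for m :: "nat \<Rightarrow> nat" and k
  have P0: "a < c (P m 0)" for m
  proof -
    have "P m 0 = A \<inter> cball 0 (real j)" by (auto simp: P_def eq B_def)
    then show ?thesis using j by simp
  qed
  have step: "\<exists>v. a < c (P (f(k := v)) (Suc k))" if "a < c (P f k)" for f k
  proof -
    have "P f k = (\<Union>v. P (f(k := v)) (Suc k))"
    proof (intro set_eqI iffI)
      fix x assume "x \<in> P f k"
      then obtain s where s: "x \<in> B" "\<forall>i<k. s i \<le> f i" "\<forall>n. x \<in> F n s" by (auto simp: P_def)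
      then have "\<forall>i<Suc k. s i \<le> (f(k := s k)) i" by (auto simp: less_Suc_eq)
      then have "x \<in> P (f(k := s k)) (Suc k)" using s unfolding P_def by blast
      then show "x \<in> (\<Union>v. P (f(k := v)) (Suc k))" by blast
    next
      fix x assume "x \<in> (\<Union>v. P (f(k := v)) (Suc k))"
      then obtain v s where s: "x \<in> B" "\<forall>i<Suc k. s i \<le> (f(k := v)) i" "\<forall>n. x \<in> F n s"
        by (auto simp: P_def)
      have "\<forall>i<k. s i \<le> f i"
      proof safe
        fix i assume "i < k"
        then show "s i \<le> f i" using s(2)[rule_format, of i] by simp
      qed
      then show "x \<in> P f k" using s by (auto simp: P_def)
    qed
    moreover have "incseq (\<lambda>v. P (f(k := v)) (Suc k))"
    proof (rule incseq_SucI, rule subsetI)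
      fix v x assume "x \<in> P (f(k := v)) (Suc k)"
      then obtain s where s: "x \<in> B" "\<forall>i<Suc k. s i \<le> (f(k := v)) i" "\<forall>n. x \<in> F n s"
        by (auto simp: P_def)
      have "\<forall>i<Suc k. s i \<le> (f(k := Suc v)) i"
      proof safe
        fix i assume "i < Suc k"
        then show "s i \<le> (f(k := Suc v)) i" using s(2)[rule_format, of i] by (auto split: if_splits)
      qed
      then show "x \<in> P (f(k := Suc v)) (Suc k)" using s unfolding P_def by blast
    qed
    ultimately show ?thesis using upE[of "\<lambda>v. P (f(k := v)) (Suc k)"] that by auto
  qed
  obtain f where f: "\<And>k. a < c (P (f k) k)" and fs: "\<And>k. \<exists>v. f (Suc k) = (f k)(k := v)"
  proof -
    have "\<exists>f. \<forall>k. a < c (P (f k) k) \<and> (\<exists>v. f (Suc k) = (f k)(k := v))"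
      by (rule dependent_nat_choice[of "\<lambda>k f. a < c (P f k)" "\<lambda>k f f'. \<exists>v. f' = f(k := v)"])
        (use P0 step in blast)+
    then show thesis using that by blast
  qed
  define m where "m i = f (Suc i) i" for i
  have fm: "f k i = m i" if "i < k" for i k
    using that
  proof (induction k)
    case (Suc k)
    obtain v where "f (Suc k) = (f k)(k := v)" using fs by blast
    then show ?case using Suc by (cases "i = k") (auto simp: m_def)
  qed simp
  have Pm: "a < c (P m k)" for k
  proof -
    have "P (f k) k = P m k" by (auto simp: P_def fm)
    then show ?thesis using f[of k] by simp
  qed
  \<comment> \<open>Here all entries are bounded, but only the levels up to \<open>N\<close> are
    tested. Finitely many prefixes matter, so \<open>KN N\<close> is compact; a point of
    \<open>P m N\<close> qualifies once the entries of its branch from \<open>N\<close> on are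
    replaced by 0.\<close>
  define KN where "KN N = {x \<in> B. \<exists>s. (\<forall>i. s i \<le> m i) \<and> (\<forall>n\<le>N. x \<in> F n s)}" for N
  have PK: "P m N \<subseteq> KN N" for N
  proof
    fix x assume "x \<in> P m N"
    then obtain s where s: "x \<in> B" "\<forall>i<N. s i \<le> m i" "\<forall>n. x \<in> F n s" by (auto simp: P_def)
    define t where "t i = (if i < N then s i else 0)" for i
    have "F n t = F n s" if "n \<le> N" for n
      by (rule dep) (use that in \<open>auto simp: t_def\<close>)
    then have "\<forall>n\<le>N. x \<in> F n t" using s(3) by blast
    moreover have "\<forall>i. t i \<le> m i" using s(2) by (auto simp: t_def)
    ultimately show "x \<in> KN N" using s(1) unfolding KN_def by blast
  qed
  have KN_mono: "KN N' \<subseteq> KN N" if "N \<le> N'" for N N'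
  proof
    fix x assume "x \<in> KN N'"
    then obtain s where s: "x \<in> B" "\<forall>i. s i \<le> m i" "\<forall>n\<le>N'. x \<in> F n s" unfolding KN_def by blast
    then have "\<forall>n\<le>N. x \<in> F n s" using that order_trans[of _ N N'] by blast
    then show "x \<in> KN N" using s unfolding KN_def by blast
  qed
  have KN_cpt: "compact (KN N)" for N
  proof -
    define S where "S = (\<lambda>g i. if i < N then g i else (0::nat)) ` (PiE {..<N} (\<lambda>i. {..m i}))"
    have "finite S" unfolding S_def by (intro finite_imageI finite_PiE) auto
    have "KN N = B \<inter> (\<Union>s\<in>S. \<Inter>n\<in>{..N}. F n s)"
    proof (intro set_eqI iffI)
      fix x assume "x \<in> KN N"
      then obtain s where s: "x \<in> B" "\<forall>i. s i \<le> m i" "\<forall>n\<le>N. x \<in> F n s" by (auto simp: KN_def)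
      let ?s = "\<lambda>i. if i < N then s i else 0"
      have "F n ?s = F n s" if "n \<le> N" for n
        by (rule dep) (use that in auto)
      moreover have "?s \<in> S" unfolding S_def
      proof (rule image_eqI[of _ _ "restrict s {..<N}"])
        show "?s = (\<lambda>i. if i < N then restrict s {..<N} i else 0)" by auto
        show "restrict s {..<N} \<in> PiE {..<N} (\<lambda>i. {..m i})" using s(2) by auto
      qed
      moreover have "\<forall>n\<le>N. x \<in> F n ?s" using calculation(1) s(3) by simp
      ultimately show "x \<in> B \<inter> (\<Union>s\<in>S. \<Inter>n\<in>{..N}. F n s)" using s(1) by blast
    next
      fix x assume "x \<in> B \<inter> (\<Union>s\<in>S. \<Inter>n\<in>{..N}. F n s)"
      then obtain s where s: "x \<in> B" "s \<in> S" "\<forall>n\<le>N. x \<in> F n s" by auto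
      then have "\<forall>i. s i \<le> m i" by (auto simp: S_def PiE_iff)
      then show "x \<in> KN N" using s by (auto simp: KN_def)
    qed
    moreover have "closed (\<Union>s\<in>S. \<Inter>n\<in>{..N}. F n s)"
      using \<open>finite S\<close> cl by (intro closed_UN closed_INT) auto
    ultimately show ?thesis by (simp add: B_def compact_Int_closed)
  qed
  have sub: "(\<Inter>N. KN N) \<subseteq> A"
  proof
    fix x assume x: "x \<in> (\<Inter>N. KN N)"
    \<comment> \<open>Koenig's lemma: \<open>Q k f\<close> says that the prefix of length
      \<open>k\<close> of \<open>f\<close> extends, for each \<open>N\<close>, to a bounded branch
      that is valid up to level \<open>N\<close>. Entry \<open>k\<close> has finitely many possible
      values, so one of them serves all \<open>N\<close>.\<close>
    define R where "R k f N \<longleftrightarrow> (\<exists>s. (\<forall>i<k. s i = f i) \<and> (\<forall>i. s i \<le> m i) \<and> (\<forall>n\<le>N. x \<in> F n s))"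
      for k N and f :: "nat \<Rightarrow> nat"
    define Q where "Q k f \<longleftrightarrow> (\<forall>N. R k f N)" for k f
    have Q0: "Q 0 f" for f using x by (auto simp: Q_def R_def KN_def)
    have Qs: "\<exists>v. Q (Suc k) (f(k := v))" if "Q k f" for k f
    proof (rule ccontr)
      assume "\<not> ?thesis"
      then have "\<forall>v. \<exists>N. \<not> R (Suc k) (f(k := v)) N" by (simp add: Q_def)
      from choice[OF this] obtain N where N: "\<And>v. \<not> R (Suc k) (f(k := v)) (N v)" by blast
      have "R k f (Max (N ` {..m k}))" using that by (simp add: Q_def)
      then obtain s where s: "\<forall>i<k. s i = f i" "\<forall>i. s i \<le> m i" "\<forall>n\<le>Max (N ` {..m k}). x \<in> F n s"
        unfolding R_def by (elim exE conjE)
      have le: "N (s k) \<le> Max (N ` {..m k})" using s(2) by (intro Max_ge) auto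
      have "\<forall>i<Suc k. s i = (f(k := s k)) i" using s(1) by (simp add: less_Suc_eq)
      moreover have "\<forall>n\<le>N (s k). x \<in> F n s" using s(3) le by (meson order_trans)
      ultimately have "R (Suc k) (f(k := s k)) (N (s k))" unfolding R_def using s(2)
        by (intro exI[of _ s] conjI)
      then show False using N by simp
    qed
    obtain g where g: "\<And>k. Q k (g k)" and gs: "\<And>k. \<exists>v. g (Suc k) = (g k)(k := v)"
    proof -
      have "\<exists>g. \<forall>k. Q k (g k) \<and> (\<exists>v. g (Suc k) = (g k)(k := v))"
        by (rule dependent_nat_choice[of Q "\<lambda>k f f'. \<exists>v. f' = f(k := v)"]) (use Q0 Qs in blast)+
      then show thesis using that by blast
    qed
    define t where "t i = g (Suc i) i" for i
    have gt: "g k i = t i" if "i < k" for i k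
      using that
    proof (induction k)
      case (Suc k)
      obtain v where "g (Suc k) = (g k)(k := v)" using gs by blast
      then show ?case using Suc by (cases "i = k") (auto simp: t_def)
    qed simp
    have "x \<in> F n t" for n
    proof -
      have "R n (g n) n" using g[of n] by (simp add: Q_def)
      then obtain s where s: "\<forall>i<n. s i = g n i" "\<forall>k\<le>n. x \<in> F k s" unfolding R_def by (elim exE conjE)
      have "F n s = F n t" by (rule dep) (use s gt in auto)
      then show ?thesis using s(2) by auto
    qed
    then show "x \<in> A" using eq by auto
  qed
  show thesis
  proof (rule that)
    show "compact (\<Inter>N. KN N)" by (intro compact_Inter) (use KN_cpt in auto)
    show "(\<Inter>N. KN N) \<subseteq> A" by fact
    fix U :: "'a set" assume U: "open U" "(\<Inter>N. KN N) \<subseteq> U"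
    have "\<exists>N. KN N \<subseteq> U"
    proof (rule ccontr)
      assume "\<not> ?thesis"
      then have "\<Inter> (range (\<lambda>N. KN N - U)) \<noteq> {}"
        using KN_mono by (intro compact_nest) (auto simp: KN_cpt compact_diff U)
      then show False using U by auto
    qed
    then obtain N where "KN N \<subseteq> U" by blast
    then have "P m N \<subseteq> U" using PK[of N] by blast
    then show "a < c U" using Pm[of N] mono[of "P m N" U] by (metis order.strict_trans2)
  qed
qed

section \<open>Dyadic content\<close>

text \<open>Dyadic cubes are represented by level and lower corner; this is the lower corner of the
  half-open cube of side 1/2^k that contains \<open>x\<close>.\<close>

definition dyadic_corner :: "nat \<Rightarrow> 'a::euclidean_space \<Rightarrow> 'a" where
  "dyadic_corner k x = (\<Sum>b\<in>Basis. (of_int \<lfloor>2 ^ k * (x \<bullet> b)\<rfloor> / 2 ^ k) *\<^sub>R b)"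

lemma dyadic_corner_inner:
  "b \<in> Basis \<Longrightarrow> dyadic_corner k x \<bullet> b = of_int \<lfloor>2 ^ k * (x \<bullet> b)\<rfloor> / 2 ^ k"
  by (simp add: dyadic_corner_def)

lemma floor_dyadic_floor:
  fixes y :: real
  assumes "j \<le> k"
  shows "\<lfloor>2 ^ j * (of_int \<lfloor>2 ^ k * y\<rfloor> / 2 ^ k :: real)\<rfloor> = \<lfloor>2 ^ j * y\<rfloor>"
proof -
  define m where "m = k - j"
  have "k = j + m" using assms by (simp add: m_def)
  then have k: "(2::real) ^ k = 2 ^ j * 2 ^ m" by (simp only: power_add)
  let ?n = "\<lfloor>2 ^ j * y\<rfloor>"
  have "of_int ?n * 2 ^ m \<le> 2 ^ j * y * 2 ^ m" by (intro mult_right_mono) auto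
  then have "of_int (?n * 2 ^ m) \<le> 2 ^ k * y" by (simp add: k mult.assoc mult.commute)
  then have 1: "?n * 2 ^ m \<le> \<lfloor>2 ^ k * y\<rfloor>" by (simp only: le_floor_iff)
  have "of_int ?n * 2 ^ m \<le> (of_int \<lfloor>2 ^ k * y\<rfloor> :: real)"
    using 1[folded of_int_le_iff[where 'a = real]] by simp
  then have "of_int ?n \<le> (of_int \<lfloor>2 ^ k * y\<rfloor> / 2 ^ m :: real)" by (simp add: pos_le_divide_eq)
  also have "\<dots> = 2 ^ j * (of_int \<lfloor>2 ^ k * y\<rfloor> / 2 ^ k :: real)" by (subst (2) k) simp
  finally have 2: "of_int ?n \<le> 2 ^ j * (of_int \<lfloor>2 ^ k * y\<rfloor> / 2 ^ k :: real)" .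
  have "2 ^ j * (of_int \<lfloor>2 ^ k * y\<rfloor> / 2 ^ k :: real) \<le> 2 ^ j * (2 ^ k * y / 2 ^ k)"
    by (intro mult_left_mono divide_right_mono) auto
  also have "\<dots> = 2 ^ j * y" by simp
  also have "\<dots> < of_int ?n + 1" by linarith
  finally show ?thesis by (rule floor_unique[OF 2])
qed

text \<open>The tree structure of the cubes: the lower corner of a fine cube lies in the same coarse
  cube as all its other points. Half-open cubes make this hold without exceptions.\<close>

lemma dyadic_corner_corner: "j \<le> k \<Longrightarrow> dyadic_corner j (dyadic_corner k x) = dyadic_corner j x"
  by (rule euclidean_eqI) (simp only: dyadic_corner_inner floor_dyadic_floor)

lemma norm_diff_dyadic_corner:
  fixes x :: "'a::euclidean_space"
  shows "norm (x - dyadic_corner k x) \<le> real DIM('a) / 2 ^ k"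
proof -
  have "norm (x - dyadic_corner k x) \<le> (\<Sum>b\<in>Basis. \<bar>(x - dyadic_corner k x) \<bullet> b\<bar>)"
    by (rule norm_le_l1)
  also have "\<dots> \<le> (\<Sum>b\<in>(Basis::'a set). 1 / 2 ^ k)"
  proof (rule sum_mono)
    fix b :: 'a assume "b \<in> Basis"
    then have "\<bar>(x - dyadic_corner k x) \<bullet> b\<bar> = \<bar>2 ^ k * (x \<bullet> b) - of_int \<lfloor>2 ^ k * (x \<bullet> b)\<rfloor>\<bar> / 2 ^ k"
      by (simp add: inner_diff_left dyadic_corner_inner field_simps abs_div_pos)
    also have "\<dots> \<le> 1 / 2 ^ k"
      by (intro divide_right_mono) (auto, linarith)
    finally show "\<bar>(x - dyadic_corner k x) \<bullet> b\<bar> \<le> 1 / 2 ^ k" .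
  qed
  finally show ?thesis by simp
qed

lemma card_dyadic_corner_cball:
  fixes x :: "'a::euclidean_space"
  assumes "R \<ge> 0"
  shows "finite (dyadic_corner k ` cball x R)"
    and "real (card (dyadic_corner k ` cball x R)) \<le> (2 * 2 ^ k * R + 2) ^ DIM('a)"
proof -
  define I where "I b = {\<lfloor>2 ^ k * (x \<bullet> b) - 2 ^ k * R\<rfloor>..\<lfloor>2 ^ k * (x \<bullet> b) + 2 ^ k * R\<rfloor>}" for b :: 'a
  define J where "J f = (\<Sum>b\<in>Basis. (of_int (f b) / 2 ^ k) *\<^sub>R b)" for f :: "'a \<Rightarrow> int"
  have sub: "dyadic_corner k ` cball x R \<subseteq> J ` (PiE Basis I)"
  proof
    fix c assume "c \<in> dyadic_corner k ` cball x R"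
    then obtain y where y: "dist x y \<le> R" "c = dyadic_corner k y" by auto
    have "\<lfloor>2 ^ k * (y \<bullet> b)\<rfloor> \<in> I b" if "b \<in> Basis" for b
    proof -
      have "\<bar>(y - x) \<bullet> b\<bar> \<le> R" using Basis_le_norm[OF that, of "y - x"] y(1) by (simp add: dist_norm norm_minus_commute)
      then have "\<bar>2 ^ k * ((y - x) \<bullet> b)\<bar> \<le> 2 ^ k * R" by (simp add: abs_mult)
      then show ?thesis unfolding I_def
        by (auto simp: inner_diff_left right_diff_distrib intro!: floor_mono)
    qed
    then show "c \<in> J ` (PiE Basis I)" unfolding y(2)
      by (intro image_eqI[of _ _ "restrict (\<lambda>b. \<lfloor>2 ^ k * (y \<bullet> b)\<rfloor>) Basis"])
        (auto simp: J_def dyadic_corner_def)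
  qed
  have fin: "finite (PiE Basis I)" by (intro finite_PiE) (auto simp: I_def)
  show "finite (dyadic_corner k ` cball x R)" using sub fin finite_surj by blast
  have "real (card (dyadic_corner k ` cball x R)) \<le> real (card (PiE Basis I))"
    using surj_card_le[OF fin sub] by simp
  also have "\<dots> = (\<Prod>b\<in>Basis. real (card (I b)))" by (simp add: card_PiE)
  also have "\<dots> \<le> (\<Prod>b\<in>(Basis::'a set). 2 * 2 ^ k * R + 2)"
  proof (rule prod_mono, safe)
    fix b :: 'a assume "b \<in> Basis"
    have "real (card (I b)) = max 0 (real_of_int (\<lfloor>2 ^ k * (x \<bullet> b) + 2 ^ k * R\<rfloor> - \<lfloor>2 ^ k * (x \<bullet> b) - 2 ^ k * R\<rfloor> + 1))"
      unfolding I_def by (simp add: of_nat_nat max_def)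
    also have "\<dots> \<le> 2 * 2 ^ k * R + 2" using assms by (simp add: algebra_simps) linarith
    finally show "real (card (I b)) \<le> 2 * 2 ^ k * R + 2" .
  qed simp
  finally show "real (card (dyadic_corner k ` cball x R)) \<le> (2 * 2 ^ k * R + 2) ^ DIM('a)" by simp
qed

text \<open>The weight of a family of cells is encoded as a measure for which every family is
  measurable. Modularity, countable additivity and continuity from below are then facts about
  measures.\<close>

definition dyadic_weight :: "real \<Rightarrow> (nat \<times> 'a) measure" where
  "dyadic_weight s = density (count_space UNIV) (\<lambda>l. ennreal (2 powr (- s * real (fst l))))"

definition dyadic_cover :: "(nat \<times> 'a::euclidean_space) set \<Rightarrow> 'a set \<Rightarrow> bool" where
  "dyadic_cover C A \<longleftrightarrow> (\<forall>x\<in>A. \<exists>k. (k, dyadic_corner k x) \<in> C)"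

text \<open>Cells of all levels compete, as in a Hausdorff content; levels are natural numbers, so
  sides never exceed 1.\<close>

definition dyadic_content :: "real \<Rightarrow> 'a::euclidean_space set \<Rightarrow> ennreal" where
  "dyadic_content s A = (INF C\<in>{C. dyadic_cover C A}. emeasure (dyadic_weight s) C)"

lemma sets_dyadic_weight [simp]: "sets (dyadic_weight s) = UNIV"
  by (simp add: dyadic_weight_def)

lemma dyadic_weight_single: "emeasure (dyadic_weight s) {l} = ennreal (2 powr (- s * real (fst l)))"
  by (simp add: dyadic_weight_def emeasure_density nn_integral_count_space_indicator[symmetric]
      nn_integral_count_space_finite one_ennreal_def[symmetric])

lemma dyadic_weight_level:
  "emeasure (dyadic_weight s) ({k} \<times> B) = ennreal (2 powr (- s * real k)) * emeasure (count_space UNIV) B"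
proof -
  have "emeasure (dyadic_weight s) ({k} \<times> B) =
     (\<integral>\<^sup>+l. ennreal (2 powr (- s * real k)) * indicator ({k} \<times> B) l \<partial>count_space UNIV)"
    unfolding dyadic_weight_def by (subst emeasure_density) (auto intro!: nn_integral_cong simp: indicator_def)
  also have "\<dots> = ennreal (2 powr (- s * real k)) * emeasure (count_space UNIV) ({k} \<times> B)"
    by (simp add: nn_integral_cmult)
  also have "emeasure (count_space UNIV) ({k} \<times> B) = emeasure (count_space UNIV) B"
    by (cases "finite B") (auto simp: emeasure_count_space finite_cartesian_product_iff card_cartesian_product_singleton)
  finally show ?thesis .
qed

lemma dyadic_weight_levels:
  "emeasure (dyadic_weight s) C =
    (\<Sum>k. ennreal (2 powr (- s * real k)) * emeasure (count_space UNIV) {c. (k, c) \<in> C})"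
proof -
  have "C = (\<Union>k. {k} \<times> {c. (k, c) \<in> C})" by auto
  then have "emeasure (dyadic_weight s) C = emeasure (dyadic_weight s) (\<Union>k. {k} \<times> {c. (k, c) \<in> C})" by simp
  also have "\<dots> = (\<Sum>k. emeasure (dyadic_weight s) ({k} \<times> {c. (k, c) \<in> C}))"
    by (rule suminf_emeasure[symmetric]) (auto simp: disjoint_family_on_def)
  finally show ?thesis by (simp add: dyadic_weight_level)
qed

section \<open>Elementary properties of the dyadic content\<close>

lemma dyadic_content_le: "dyadic_cover C A \<Longrightarrow> dyadic_content s A \<le> emeasure (dyadic_weight s) C"
  unfolding dyadic_content_def by (rule INF_lower) simp

lemma dyadic_content_mono: "A \<subseteq> B \<Longrightarrow> dyadic_content s A \<le> dyadic_content s B"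
  unfolding dyadic_content_def dyadic_cover_def by (rule INF_superset_mono) auto

lemma dyadic_content_cover:
  assumes "dyadic_content s A < a"
  obtains C where "dyadic_cover C A" "emeasure (dyadic_weight s) C < a"
  using assms unfolding dyadic_content_def INF_less_iff by blast

lemma dyadic_content_coverE:
  assumes "dyadic_content s A \<noteq> top" "e > 0"
  obtains C where "dyadic_cover C A" "emeasure (dyadic_weight s) C \<le> dyadic_content s A + ennreal e"
proof -
  have "dyadic_content s A < dyadic_content s A + ennreal e"
    using assms by (cases "dyadic_content s A") (auto simp flip: ennreal_plus simp: ennreal_less_iff)
  then show thesis using that by (metis dyadic_content_cover less_imp_le)
qed

lemma dyadic_content_empty [simp]: "dyadic_content s {} = 0"
  using dyadic_content_le[of "{}" "{}" s] by (simp add: dyadic_cover_def)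

lemma dyadic_content_Un: "dyadic_content s (A \<union> B) \<le> dyadic_content s A + dyadic_content s B"
proof (rule ennreal_le_epsilon)
  fix e :: real
  assume fin: "dyadic_content s A + dyadic_content s B < top" and "e > 0"
  then have e: "e / 2 > 0" and "dyadic_content s A \<noteq> top" "dyadic_content s B \<noteq> top" by auto
  then obtain C D where C: "dyadic_cover C A" "emeasure (dyadic_weight s) C \<le> dyadic_content s A + ennreal (e / 2)"
    and D: "dyadic_cover D B" "emeasure (dyadic_weight s) D \<le> dyadic_content s B + ennreal (e / 2)"
    by (metis dyadic_content_coverE)
  have "dyadic_content s (A \<union> B) \<le> emeasure (dyadic_weight s) (C \<union> D)"
    using C D by (intro dyadic_content_le) (auto simp: dyadic_cover_def)
  also have "\<dots> \<le> emeasure (dyadic_weight s) C + emeasure (dyadic_weight s) D"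
    by (intro emeasure_subadditive) auto
  also have "\<dots> \<le> (dyadic_content s A + ennreal (e / 2)) + (dyadic_content s B + ennreal (e / 2))"
    by (intro add_mono C D)
  also have "\<dots> = dyadic_content s A + dyadic_content s B + (ennreal (e / 2) + ennreal (e / 2))"
    by (simp add: ac_simps)
  also have "ennreal (e / 2) + ennreal (e / 2) = ennreal e" using e by (simp flip: ennreal_plus)
  finally show "dyadic_content s (A \<union> B) \<le> dyadic_content s A + dyadic_content s B + ennreal e" .
qed

lemma dyadic_content_UN:
  "finite I \<Longrightarrow> dyadic_content s (\<Union>i\<in>I. A i) \<le> (\<Sum>i\<in>I. dyadic_content s (A i))"
proof (induction rule: finite_induct)
  case (insert i I)
  then show ?case using dyadic_content_Un[of s "A i" "\<Union>i\<in>I. A i"]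
    by (simp add: order_trans[OF _ add_left_mono])
qed simp

lemma dyadic_content_cell:
  "dyadic_content s (A \<inter> {x. dyadic_corner k x = c}) \<le> ennreal (2 powr (- s * real k))"
  using dyadic_content_le[of "{(k, c)}" "A \<inter> {x. dyadic_corner k x = c}" s]
  by (auto simp: dyadic_cover_def dyadic_weight_single)

section \<open>Continuity of the content along increasing unions\<close>

definition coarsest :: "(nat \<times> 'a::euclidean_space) set \<Rightarrow> (nat \<times> 'a) set" where
  "coarsest C = {l \<in> C. \<forall>j<fst l. (j, dyadic_corner j (snd l)) \<notin> C}"

text \<open>Among the cells of the family that contain a given point, the one of least level
  survives: a coarser cell around its corner would contain the point as well.\<close>

lemma dyadic_cover_coarsest:
  assumes "dyadic_cover C A" shows "dyadic_cover (coarsest C) A"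
  unfolding dyadic_cover_def
proof
  fix x assume "x \<in> A"
  then have ex: "\<exists>k. (k, dyadic_corner k x) \<in> C" using assms by (auto simp: dyadic_cover_def)
  define k where "k = (LEAST k. (k, dyadic_corner k x) \<in> C)"
  have "(k, dyadic_corner k x) \<in> C" unfolding k_def using ex by (rule LeastI_ex)
  moreover have "(j, dyadic_corner j x) \<notin> C" if "j < k" for j
    using not_less_Least that unfolding k_def by blast
  ultimately show "\<exists>k. (k, dyadic_corner k x) \<in> coarsest C"
    by (intro exI[of _ k]) (auto simp: coarsest_def dyadic_corner_corner)
qed

text \<open>Strong subadditivity: the cells that are not coarsest in \<open>C \<union> D\<close>, together with the common
  cells, still cover everything that is covered twice.\<close>

lemma dyadic_weight_coarsest_Un:
  assumes C: "dyadic_cover C A" and D: "dyadic_cover D A"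
  shows "emeasure (dyadic_weight s) (coarsest (C \<union> D)) + dyadic_content s A
    \<le> emeasure (dyadic_weight s) C + emeasure (dyadic_weight s) D"
proof -
  define U where "U = coarsest (C \<union> D)"
  define I where "I = ((C \<union> D) - U) \<union> (C \<inter> D)"
  have "dyadic_cover I A" unfolding dyadic_cover_def
  proof
    fix x assume "x \<in> A"
    then obtain k j where k: "(k, dyadic_corner k x) \<in> C" and j: "(j, dyadic_corner j x) \<in> D"
      using C D unfolding dyadic_cover_def by blast
    consider "j = k" | "j < k" | "k < j" by linarith
    then show "\<exists>k. (k, dyadic_corner k x) \<in> I"
    proof cases
      case 1
      then show ?thesis using k j by (auto simp: I_def)
    next
      case 2
      then have "(k, dyadic_corner k x) \<notin> U"
        using j by (auto simp: U_def coarsest_def dyadic_corner_corner intro!: exI[of _ j])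
      then show ?thesis using k by (auto simp: I_def)
    next
      case 3
      then have "(j, dyadic_corner j x) \<notin> U"
        using k by (auto simp: U_def coarsest_def dyadic_corner_corner intro!: exI[of _ k])
      then show ?thesis using j by (auto simp: I_def)
    qed
  qed
  let ?w = "emeasure (dyadic_weight s)"
  have "?w U + dyadic_content s A \<le> ?w U + ?w I"
    by (intro add_left_mono dyadic_content_le) fact
  also have "\<dots> = ?w (U \<union> I) + ?w (U \<inter> I)" by (rule emeasure_Un_Int) auto
  also have "\<dots> \<le> ?w (C \<union> D) + ?w (C \<inter> D)"
    by (intro add_mono emeasure_mono) (auto simp: I_def U_def coarsest_def)
  also have "\<dots> = ?w C + ?w D" by (rule emeasure_Un_Int[symmetric]) auto
  finally show ?thesis unfolding U_def .
qed

text \<open>Near-optimal covers \<open>C n\<close> are merged one at a time, keeping maximal cells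
  only. Since \<open>U N\<close> and \<open>C (Suc N)\<close> both cover \<open>A N\<close>, strong
  subadditivity charges a merge only with the increase of the content and the error of the new
  cover; these errors add up to less than \<open>e\<close>.\<close>

lemma dyadic_content_incseq:
  fixes A :: "nat \<Rightarrow> 'a::euclidean_space set"
  assumes inc: "incseq A"
  shows "dyadic_content s (\<Union>n. A n) \<le> (SUP n. dyadic_content s (A n))"
proof (rule ennreal_le_epsilon)
  fix e :: real
  let ?L = "SUP n. dyadic_content s (A n)" and ?w = "emeasure (dyadic_weight s)"
  assume L: "?L < top" and e: "e > 0"
  have fin: "dyadic_content s (A n) \<noteq> top" for n
  proof -
    have "dyadic_content s (A n) \<le> ?L" by (rule SUP_upper) simp
    then show ?thesis using L by auto
  qed
  have "\<exists>C. dyadic_cover C (A n) \<and> ?w C \<le> dyadic_content s (A n) + ennreal (e * (1/2) ^ Suc n)" for n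
  proof (rule dyadic_content_coverE[OF fin[of n]])
    show "e * (1/2) ^ Suc n > 0" using e by simp
  qed blast
  then have "\<exists>C. \<forall>n. dyadic_cover (C n) (A n) \<and> ?w (C n) \<le> dyadic_content s (A n) + ennreal (e * (1/2) ^ Suc n)"
    by (intro choice allI)
  then obtain C where C: "\<And>n. dyadic_cover (C n) (A n)"
    and wC: "\<And>n. ?w (C n) \<le> dyadic_content s (A n) + ennreal (e * (1/2) ^ Suc n)" by blast
  define U where "U = rec_nat (C 0) (\<lambda>N U. coarsest (U \<union> C (Suc N)))"
  have U0: "U 0 = C 0" and US: "U (Suc N) = coarsest (U N \<union> C (Suc N))" for N by (auto simp: U_def)
  have UA: "dyadic_cover (U N) (A N)" for N
  proof (cases N)
    case (Suc M)
    have "dyadic_cover (U M \<union> C (Suc M)) (A (Suc M))" using C[of "Suc M"] by (auto simp: dyadic_cover_def)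
    then show ?thesis unfolding Suc US by (rule dyadic_cover_coarsest)
  qed (use C[of 0] U0 in simp)
  have wU: "?w (U N) \<le> dyadic_content s (A N) + ennreal (e * (1 - (1/2) ^ Suc N))" for N
  proof (induction N)
    case 0
    then show ?case using wC[of 0] by (simp add: U0)
  next
    case (Suc N)
    let ?d = "\<lambda>n. dyadic_content s (A n)"
    have "dyadic_cover (C (Suc N)) (A N)"
      using C[of "Suc N"] incseqD[OF inc, of N "Suc N"] by (auto simp: dyadic_cover_def)
    then have "?w (U (Suc N)) + ?d N \<le> ?w (U N) + ?w (C (Suc N))"
      unfolding US by (intro dyadic_weight_coarsest_Un UA)
    also have "\<dots> \<le> (?d N + ennreal (e * (1 - (1/2) ^ Suc N))) + (?d (Suc N) + ennreal (e * (1/2) ^ Suc (Suc N)))"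
      by (intro add_mono Suc wC)
    also have "\<dots> = ?d N + (?d (Suc N) + (ennreal (e * (1 - (1/2) ^ Suc N)) + ennreal (e * (1/2) ^ Suc (Suc N))))"
      by (simp add: ac_simps)
    also have "ennreal (e * (1 - (1/2) ^ Suc N)) + ennreal (e * (1/2) ^ Suc (Suc N)) =
        ennreal (e * (1 - (1/2) ^ Suc N) + e * (1/2) ^ Suc (Suc N))"
      using e by (intro ennreal_plus[symmetric]) (auto intro!: mult_nonneg_nonneg power_le_one simp del: power_Suc)
    also have "e * (1 - (1/2) ^ Suc N) + e * (1/2) ^ Suc (Suc N) = e * (1 - (1/2) ^ Suc (Suc N))"
      by (simp add: algebra_simps)
    finally have "?d N + ?w (U (Suc N)) \<le> ?d N + (?d (Suc N) + ennreal (e * (1 - (1/2) ^ Suc (Suc N))))"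
      by (simp add: ac_simps)
    \<comment> \<open>The content of \<open>A N\<close> is finite and can be cancelled.\<close>
    then show ?case using fin[of N] by (simp only: ennreal_add_left_cancel_le) simp
  qed
  have UC: "U N \<subseteq> (\<Union>n. C n)" for N
  proof (induction N)
    case (Suc N)
    then show ?case by (auto simp: US coarsest_def)
  qed (auto simp: U0)
  \<comment> \<open>A cell that is maximal in the union of all \<open>C n\<close> enters
    \<open>U\<close> at some stage and is never removed. So the maximal cells lie in the increasing
    union of the \<open>V m\<close>, along which the weight is continuous from below.\<close>
  define V where "V m = (\<Inter>N\<in>{m..}. U N)" for m
  have sub: "coarsest (\<Union>n. C n) \<subseteq> (\<Union>m. V m)"
  proof
    fix l assume l: "l \<in> coarsest (\<Union>n. C n)"
    then obtain n where n: "l \<in> C n" by (auto simp: coarsest_def)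
    have small: "(j, dyadic_corner j (snd l)) \<notin> C i" if "j < fst l" for i j
      using l that by (auto simp: coarsest_def)
    have "l \<in> U N" if "n \<le> N" for N
      using that
    proof (induction N rule: dec_induct)
      case base
      show ?case
      proof (cases n)
        case (Suc m)
        then show ?thesis using n small UC[of m] by (auto simp: US coarsest_def)
      qed (use n U0 in simp)
    next
      case (step N)
      then show ?case using small UC[of N] by (auto simp: US coarsest_def)
    qed
    then show "l \<in> (\<Union>m. V m)" by (auto simp: V_def)
  qed
  have "dyadic_cover (\<Union>n. C n) (\<Union>n. A n)" using C unfolding dyadic_cover_def by blast
  then have "dyadic_content s (\<Union>n. A n) \<le> ?w (coarsest (\<Union>n. C n))"
    by (intro dyadic_content_le dyadic_cover_coarsest)
  also have "\<dots> \<le> ?w (\<Union>m. V m)" by (intro emeasure_mono sub) simp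
  also have "\<dots> = (SUP m. ?w (V m))"
    by (rule SUP_emeasure_incseq[symmetric]) (auto simp: V_def incseq_def)
  also have "\<dots> \<le> ?L + ennreal e"
  proof (rule SUP_least)
    fix m
    have "?w (V m) \<le> ?w (U m)" by (intro emeasure_mono) (auto simp: V_def)
    also have "\<dots> \<le> dyadic_content s (A m) + ennreal (e * (1 - (1/2) ^ Suc m))" by (rule wU)
    also have "\<dots> \<le> ?L + ennreal e"
      using e by (intro add_mono SUP_upper ennreal_leI) (auto simp: mult_left_le)
    finally show "?w (V m) \<le> ?L + ennreal e" .
  qed
  finally show "dyadic_content s (\<Union>n. A n) \<le> ?L + ennreal e" .
qed

text \<open>A cover by half-open cells need not contain a neighbourhood. Each cell is therefore
  replaced by the cells of its own level that meet a ball about its corner; there are at most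
  \<open>M\<close> of them, so the weight grows at most by the factor \<open>M\<close>.\<close>

lemma dyadic_content_open_nbhd:
  fixes K :: "'a::euclidean_space set"
  assumes "dyadic_content s K = 0" "e > 0"
  obtains U where "open U" "K \<subseteq> U" "dyadic_content s U \<le> ennreal e"
proof -
  define n where "n = real DIM('a)"
  define M where "M = (2 * (n + 1) + 2) ^ DIM('a)"
  have "M > 0" by (auto simp: M_def n_def intro!: zero_less_power)
  then have "dyadic_content s K < ennreal (e / M)" using assms by simp
  then obtain C where C: "dyadic_cover C K" "emeasure (dyadic_weight s) C < ennreal (e / M)"
    by (rule dyadic_content_cover)
  \<comment> \<open>Points of a cell are within \<open>n / 2 ^ k\<close> of its corner, and the
    extra 1 puts them inside the open ball. Inserting this radius into
    \<open>card_dyadic_corner_cball\<close> gives \<open>M\<close>, the same for all levels.\<close>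
  define r where "r k = (n + 1) / 2 ^ k" for k :: nat
  define U where "U = (\<Union>l\<in>C. ball (snd l) (r (fst l)))"
  define D where "D = {(k, c'). \<exists>c. (k, c) \<in> C \<and> c' \<in> dyadic_corner k ` cball c (r k)}"
  have "emeasure (dyadic_weight s) D \<le> ennreal M * emeasure (dyadic_weight s) C"
  proof -
    have lev: "emeasure (count_space UNIV) {c. (k, c) \<in> D} \<le> ennreal M * emeasure (count_space UNIV) {c. (k, c) \<in> C}" for k
    proof (cases "finite {c. (k, c) \<in> C}")
      case True
      have eq: "{c. (k, c) \<in> D} = (\<Union>c\<in>{c. (k, c) \<in> C}. dyadic_corner k ` cball c (r k))"
        by (auto simp: D_def)
      have rk: "r k \<ge> 0" by (simp add: r_def n_def)
      have finD: "finite {c. (k, c) \<in> D}" unfolding eq using True rk by (auto intro: card_dyadic_corner_cball)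
      have "real (card {c. (k, c) \<in> D}) \<le> real (\<Sum>c\<in>{c. (k, c) \<in> C}. card (dyadic_corner k ` cball c (r k)))"
        unfolding eq of_nat_le_iff by (rule card_UN_le[OF True])
      also have "\<dots> \<le> (\<Sum>c\<in>{c. (k, c) \<in> C}. M)"
        unfolding of_nat_sum
      proof (rule sum_mono)
        fix c :: 'a
        show "real (card (dyadic_corner k ` cball c (r k))) \<le> M"
          using card_dyadic_corner_cball(2)[OF rk, of k c] by (simp add: M_def r_def)
      qed
      finally have "real (card {c. (k, c) \<in> D}) \<le> M * real (card {c. (k, c) \<in> C})" by (simp add: mult.commute)
      then show ?thesis using True finD \<open>M > 0\<close>
        by (simp add: ennreal_of_nat_eq_real_of_nat flip: ennreal_mult)
    next
      case False
      then show ?thesis using \<open>M > 0\<close> by (simp add: ennreal_mult_top)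
    qed
    have "emeasure (dyadic_weight s) D \<le> (\<Sum>k. ennreal M * (ennreal (2 powr (- s * real k)) * emeasure (count_space UNIV) {c. (k, c) \<in> C}))"
      unfolding dyadic_weight_levels[of s D]
      by (intro suminf_le allI summableI, subst mult.left_commute) (intro mult_left_mono lev zero_le)
    also have "\<dots> = ennreal M * emeasure (dyadic_weight s) C"
      by (simp add: dyadic_weight_levels ennreal_suminf_cmult)
    finally show ?thesis .
  qed
  also have "\<dots> \<le> ennreal M * ennreal (e / M)" using C by (intro mult_left_mono) auto
  also have "\<dots> = ennreal e" using \<open>M > 0\<close> assms by (simp flip: ennreal_mult)
  finally have wD: "emeasure (dyadic_weight s) D \<le> ennreal e" .
  have "dyadic_cover D U" by (force simp: dyadic_cover_def D_def U_def)
  then have "dyadic_content s U \<le> ennreal e" using wD dyadic_content_le order_trans by blast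
  moreover have "K \<subseteq> U"
  proof
    fix x assume "x \<in> K"
    then obtain k where k: "(k, dyadic_corner k x) \<in> C" using C by (auto simp: dyadic_cover_def)
    have "dist (dyadic_corner k x) x < r k"
      using norm_diff_dyadic_corner[of x k]
      by (simp add: dist_norm norm_minus_commute r_def n_def add_divide_distrib) (smt (verit) divide_pos_pos zero_less_power)
    then show "x \<in> U" using k by (force simp: U_def)
  qed
  moreover have "open U" by (auto simp: U_def)
  ultimately show thesis using that by blast
qed

text \<open>A cell of a cover weighs no more than the whole cover; as \<open>s > 0\<close>, covers
  of small weight thus consist of small cells only. Hence a vanishing content, although blind to
  scale, makes the premeasure vanish at every scale.\<close>

lemma hausdorff_measure_zero:
  fixes A :: "'a::euclidean_space set"
  assumes A: "dyadic_content s A = 0" and s: "s > 0"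
  shows "hausdorff_measure s A = 0"
proof -
  define D where "D = 2 * real DIM('a)"
  have D: "D > 0" by (simp add: D_def)
  have bound: "hausdorff_pre_measure s \<delta> A \<le> 0 + ennreal e" if "\<delta> > 0" "e > 0" for \<delta> e
  proof -
    \<comment> \<open>The first entry absorbs the factor \<open>D powr s\<close> between weights and
      diameters; the second forces all cells of the cover to have diameter at most \<delta>.\<close>
    define e' where "e' = min (e / D powr s) ((\<delta> / D) powr s)"
    have e': "e' > 0" using that D by (auto simp: e'_def)
    obtain C where C: "dyadic_cover C A" "emeasure (dyadic_weight s) C < ennreal e'"
      using dyadic_content_cover[of s A "ennreal e'"] A e' by auto
    define cell where "cell l = {x. dyadic_corner (fst l) x = snd l}" for l :: "nat \<times> 'a"
    have dist_cell: "dist x y \<le> D / 2 ^ fst l" if "x \<in> cell l" "y \<in> cell l" for x y l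
    proof -
      have "dist x y \<le> norm (x - snd l) + norm (y - snd l)"
        using norm_triangle_ineq4[of "x - snd l" "y - snd l"] by (simp add: dist_norm)
      then show ?thesis using norm_diff_dyadic_corner[of x "fst l"] norm_diff_dyadic_corner[of y "fst l"] that
        by (simp add: cell_def D_def)
    qed
    have bdd: "bounded (cell l)" for l
      unfolding bounded_two_points using dist_cell by blast
    have diam: "diameter (cell l) \<le> D / 2 ^ fst l" for l
      using dist_cell D by (intro diameter_le) (auto simp: dist_norm)
    have level: "D / 2 ^ fst l \<le> \<delta>" if "l \<in> C" for l
    proof -
      have "ennreal (2 powr (- s * real (fst l))) \<le> emeasure (dyadic_weight s) C"
        unfolding dyadic_weight_single[of s l, symmetric] using that by (intro emeasure_mono) auto
      then have "ennreal (2 powr (- s * real (fst l))) < ennreal e'" using C(2) by (rule le_less_trans)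
      then have "2 powr (- s * real (fst l)) < e'" by (simp add: ennreal_less_iff)
      also have "e' \<le> (\<delta> / D) powr s" by (simp add: e'_def)
      also have "2 powr (- s * real (fst l)) = (1 / 2 ^ fst l) powr s"
        by (simp add: powr_divide powr_realpow[symmetric] powr_powr powr_minus_divide mult.commute)
      finally have less: "(1 / 2 ^ fst l) powr s < (\<delta> / D) powr s" .
      have "1 / 2 ^ fst l < \<delta> / D"
      proof (rule ccontr)
        assume "\<not> ?thesis"
        then have "(\<delta> / D) powr s \<le> (1 / 2 ^ fst l) powr s"
          using s \<open>\<delta> > 0\<close> D by (intro powr_mono2) auto
        then show False using less by simp
      qed
      then show ?thesis using D by (simp add: field_simps)
    qed
    have diam_pow: "diam_pow s (cell l) \<le> ennreal (D powr s) * ennreal (2 powr (- s * real (fst l)))" for l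
    proof -
      have "diameter (cell l) powr s \<le> (D / 2 ^ fst l) powr s"
        using diam s diameter_ge_0[OF bdd] by (intro powr_mono2) auto
      also have "\<dots> = D powr s * 2 powr (- s * real (fst l))" using D
        by (simp add: powr_divide powr_realpow[symmetric] powr_powr powr_minus_divide mult.commute)
      finally show ?thesis using s by (auto simp: diam_pow_def simp flip: ennreal_mult intro!: ennreal_leI)
    qed
    have "countable C"
    proof -
      have "finite {c. (k, c) \<in> C}" for k
      proof (rule ccontr)
        assume "infinite {c. (k, c) \<in> C}"
        then have "emeasure (dyadic_weight s) ({k} \<times> {c. (k, c) \<in> C}) = top"
          by (simp add: dyadic_weight_level ennreal_mult_top)
        moreover have "emeasure (dyadic_weight s) ({k} \<times> {c. (k, c) \<in> C}) \<le> emeasure (dyadic_weight s) C"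
          by (intro emeasure_mono) auto
        ultimately have "emeasure (dyadic_weight s) C = top" by (simp add: top_le)
        then show False using C(2) by simp
      qed
      then have cnt: "countable (\<Union>k. Pair k ` {c. (k, c) \<in> C})"
        by (intro countable_UN[OF countableI_type] countable_image) (simp add: countable_finite)
      show ?thesis by (rule countable_subset[OF _ cnt]) auto
    qed
    \<comment> \<open>The countable family is renumbered by the naturals in \<open>J\<close>; all
      other indices get the empty set, which contributes 0.\<close>
    define J where "J = to_nat_on C ` C"
    define U where "U i = (if i \<in> J then cell (from_nat_into C i) else {})" for i
    have bij: "bij_betw (to_nat_on C) C J"
      unfolding J_def using inj_on_to_nat_on[OF \<open>countable C\<close>] by (rule inj_on_imp_bij_betw)
    have "A \<subseteq> (\<Union>i. U i)"
    proof
      fix x assume "x \<in> A"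
      then obtain k where k: "(k, dyadic_corner k x) \<in> C" using C by (auto simp: dyadic_cover_def)
      then have "x \<in> U (to_nat_on C (k, dyadic_corner k x))"
        using \<open>countable C\<close> by (auto simp: U_def J_def cell_def)
      then show "x \<in> (\<Union>i. U i)" by blast
    qed
    moreover have "bounded (U i)" for i by (simp add: U_def bdd)
    moreover have "diameter (U i) \<le> \<delta>" for i
    proof (cases "i \<in> J")
      case True
      then have "C \<noteq> {}" by (auto simp: J_def)
      then have "from_nat_into C i \<in> C" by (rule from_nat_into)
      then show ?thesis using True diam[of "from_nat_into C i"] level[of "from_nat_into C i"] by (simp add: U_def)
    qed (use that in \<open>simp add: U_def\<close>)
    ultimately have "hausdorff_pre_measure s \<delta> A \<le> (\<Sum>i. diam_pow s (U i))"
      unfolding hausdorff_pre_measure_def by (intro Inf_lower) blast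
    also have "\<dots> = (\<integral>\<^sup>+i. diam_pow s (U i) \<partial>count_space UNIV)"
      by (rule nn_integral_count_space_nat[symmetric])
    also have "\<dots> = (\<integral>\<^sup>+i. diam_pow s (cell (from_nat_into C i)) \<partial>count_space J)"
      by (subst nn_integral_count_space_indicator) (auto intro!: nn_integral_cong simp: U_def indicator_def diam_pow_def)
    also have "\<dots> = (\<integral>\<^sup>+l. diam_pow s (cell (from_nat_into C (to_nat_on C l))) \<partial>count_space C)"
      by (rule nn_integral_bij_count_space[OF bij, symmetric])
    also have "\<dots> \<le> (\<integral>\<^sup>+l. ennreal (D powr s) * ennreal (2 powr (- s * real (fst l))) \<partial>count_space C)"
      using \<open>countable C\<close> diam_pow by (intro nn_integral_mono) (simp only: space_count_space from_nat_into_to_nat_on)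
    also have "\<dots> = ennreal (D powr s) * (\<integral>\<^sup>+l. ennreal (2 powr (- s * real (fst l))) \<partial>count_space C)"
      by (simp add: nn_integral_cmult)
    also have "(\<integral>\<^sup>+l. ennreal (2 powr (- s * real (fst l))) \<partial>count_space C) = emeasure (dyadic_weight s) C"
      unfolding dyadic_weight_def by (simp add: emeasure_density nn_integral_count_space_indicator)
    also have "ennreal (D powr s) * emeasure (dyadic_weight s) C \<le> ennreal (D powr s) * ennreal (e / D powr s)"
    proof (intro mult_left_mono)
      have "emeasure (dyadic_weight s) C \<le> ennreal e'" using C(2) by simp
      also have "\<dots> \<le> ennreal (e / D powr s)" by (intro ennreal_leI) (simp add: e'_def)
      finally show "emeasure (dyadic_weight s) C \<le> ennreal (e / D powr s)" .
    qed simp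
    also have "\<dots> = ennreal e" using D that by (simp flip: ennreal_mult)
    finally show ?thesis by simp
  qed
  have "hausdorff_pre_measure s \<delta> A \<le> 0" if "\<delta> > 0" for \<delta>
    by (rule ennreal_le_epsilon) (rule bound[OF that])
  then have "hausdorff_measure s A \<le> 0" unfolding hausdorff_measure_def by (intro SUP_least) simp
  then show ?thesis by simp
qed

section \<open>Frostman's lemma\<close>

text \<open>A tiling of an interval by half-open intervals of prescribed lengths. Disjointness is
  expressed through common points, since several tiles of length 0 may coincide.\<close>

definition interval_partition :: "real \<Rightarrow> 'b set \<Rightarrow> ('b \<Rightarrow> real) \<Rightarrow> ('b \<Rightarrow> real) \<Rightarrow> bool" where
  "interval_partition a I p l \<longleftrightarrow>
     (\<forall>t\<in>{a..<a + sum p I}. \<exists>i\<in>I. t \<in> {l i..<l i + p i}) \<and>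
     (\<forall>i\<in>I. {l i..<l i + p i} \<subseteq> {a..<a + sum p I}) \<and>
     (\<forall>i\<in>I. \<forall>j\<in>I. \<forall>t. t \<in> {l i..<l i + p i} \<and> t \<in> {l j..<l j + p j} \<longrightarrow> i = j)"

lemma interval_partitionD:
  assumes "interval_partition a I p l"
  shows "t \<in> {a..<a + sum p I} \<Longrightarrow> \<exists>i\<in>I. t \<in> {l i..<l i + p i}"
    and "i \<in> I \<Longrightarrow> {l i..<l i + p i} \<subseteq> {a..<a + sum p I}"
    and "i \<in> I \<Longrightarrow> j \<in> I \<Longrightarrow> t \<in> {l i..<l i + p i} \<Longrightarrow> t \<in> {l j..<l j + p j} \<Longrightarrow> i = j"
proof -
  show "t \<in> {a..<a + sum p I} \<Longrightarrow> \<exists>i\<in>I. t \<in> {l i..<l i + p i}"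
    using assms[unfolded interval_partition_def, THEN conjunct1] by (rule bspec)
  show "i \<in> I \<Longrightarrow> {l i..<l i + p i} \<subseteq> {a..<a + sum p I}"
    using assms[unfolded interval_partition_def, THEN conjunct2, THEN conjunct1] by (rule bspec)
  have *: "\<forall>i\<in>I. \<forall>j\<in>I. \<forall>t. t \<in> {l i..<l i + p i} \<and> t \<in> {l j..<l j + p j} \<longrightarrow> i = j"
    using assms unfolding interval_partition_def by (elim conjE)
  show "i \<in> I \<Longrightarrow> j \<in> I \<Longrightarrow> t \<in> {l i..<l i + p i} \<Longrightarrow> t \<in> {l j..<l j + p j} \<Longrightarrow> i = j"
    by (rule *[rule_format]) (assumption | rule conjI)+
qed

lemma interval_partition_cong:
  assumes "\<And>i. i \<in> I \<Longrightarrow> l i = l' i"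
  shows "interval_partition a I p l \<longleftrightarrow> interval_partition a I p l'"
  unfolding interval_partition_def by (simp add: assms)

lemma interval_partition_exists:
  assumes "finite I" "\<And>i. i \<in> I \<Longrightarrow> 0 \<le> p i"
  shows "\<exists>l. interval_partition a I p l"
  using assms
proof (induction arbitrary: a rule: finite_induct)
  case empty
  then show ?case by (auto simp: interval_partition_def)
next
  case (insert x I)
  then obtain l where l: "interval_partition (a + p x) I p l" by blast
  define m where "m i = (if i = x then a else l i)" for i
  have m: "m i = l i" if "i \<in> I" for i using that insert by (auto simp: m_def)
  have s: "sum p (insert x I) = p x + sum p I" using insert by simp
  have px: "p x \<ge> 0" "sum p I \<ge> 0" using insert by (auto intro: sum_nonneg)
  have sub: "{l i..<l i + p i} \<subseteq> {a + p x..<a + p x + sum p I}" if "i \<in> I" for i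
    by (rule interval_partitionD(2)[OF l that])
  have "interval_partition a (insert x I) p m"
    unfolding interval_partition_def
  proof (intro conjI ballI allI impI)
    fix t assume t: "t \<in> {a..<a + sum p (insert x I)}"
    show "\<exists>i\<in>insert x I. t \<in> {m i..<m i + p i}"
    proof (cases "t < a + p x")
      case True
      then show ?thesis using t by (auto simp: m_def)
    next
      case False
      then have "t \<in> {a + p x..<a + p x + sum p I}" using t s by auto
      then obtain i where "i \<in> I" "t \<in> {l i..<l i + p i}" using interval_partitionD(1)[OF l] by blast
      then show ?thesis using m by auto
    qed
  next
    fix i assume i: "i \<in> insert x I"
    show "{m i..<m i + p i} \<subseteq> {a..<a + sum p (insert x I)}"
    proof (cases "i = x")
      case False
      then have "{m i..<m i + p i} \<subseteq> {a + p x..<a + p x + sum p I}" using sub[of i] m[of i] i by simp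
      also have "\<dots> \<subseteq> {a..<a + sum p (insert x I)}" using px s by auto
      finally show ?thesis .
    qed (use px s in \<open>auto simp: m_def\<close>)
  next
    fix i j t assume i: "i \<in> insert x I" and j: "j \<in> insert x I"
      and t: "t \<in> {m i..<m i + p i} \<and> t \<in> {m j..<m j + p j}"
    show "i = j"
    proof (cases "i = x"; cases "j = x")
      assume "i \<noteq> x" "j \<noteq> x"
      then have "i \<in> I" "j \<in> I" using i j by auto
      then show ?thesis using t m[of i] m[of j] by (intro interval_partitionD(3)[OF l, of i j t]) auto
    next
      assume "i = x" "j \<noteq> x"
      then show ?thesis using j t sub[of j] m[of j] by (force simp: m_def)
    next
      assume "i \<noteq> x" "j = x"
      then show ?thesis using i t sub[of i] m[of i] by (force simp: m_def)
    qed simp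
  qed
  then show ?case by blast
qed

lemma dyadic_scale:
  fixes r :: real
  assumes "0 < r" "r \<le> 1"
  obtains k :: nat where "r \<le> 1 / 2 ^ k" "1 / 2 ^ k < 2 * r"
proof -
  obtain n where n: "(1/2) ^ n < r" using real_arch_pow_inv[of r "1/2"] assms by auto
  define j where "j = (LEAST n. (1/2) ^ n < r)"
  have j: "(1/2) ^ j < r" unfolding j_def by (rule LeastI) (rule n)
  have "j \<noteq> 0"
  proof
    assume "j = 0"
    then show False using j assms by simp
  qed
  then obtain k where k: "j = Suc k" by (cases j) auto
  have "\<not> (1/2) ^ k < r" using not_less_Least[of k "\<lambda>n. (1/2) ^ n < r"] k unfolding j_def by auto
  then have "r \<le> 1 / 2 ^ k" by (simp add: power_one_over)
  moreover have "1 / 2 ^ k < 2 * r" using j by (simp add: k power_one_over)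
  ultimately show thesis by (rule that)
qed

text \<open>The measure is built from the root of the dyadic tree downwards: the mass of a cell is
  divided among its subcells in proportion to the content of their intersection with \<open>K\<close>, so that it
  never exceeds this content.  The limit point of the cells whose intervals contain \<open>t\<close> maps
  Lebesgue measure on an interval to the desired measure.\<close>

lemma frostman_compact:
  fixes K :: "'a::euclidean_space set"
  assumes K: "compact K" and s: "s > 0" and pos: "dyadic_content s K > 0"
  obtains \<nu> B where "sets \<nu> = sets borel" "emeasure \<nu> (- K) = 0" "emeasure \<nu> UNIV \<noteq> 0" "emeasure \<nu> UNIV \<noteq> \<infinity>"
    "B > 0" "\<And>x r. r > 0 \<Longrightarrow> emeasure \<nu> (cball x r) \<le> ennreal (B * r powr s)"
proof -
  let ?q = "dyadic_corner :: nat \<Rightarrow> 'a \<Rightarrow> 'a"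
  define n where "n = real DIM('a)"
  have n: "n \<ge> 1" unfolding n_def using DIM_positive[where 'a='a] by linarith
  define cell where "cell k c = K \<inter> {x. ?q k x = c}" for k c
  obtain R where R: "K \<subseteq> cball 0 R" "R > 0" using compact_imp_bounded[OF K] bounded_subset_ballD[of K 0]
    by (metis ball_subset_cball subset_trans)
  have finq: "finite (?q k ` K)" for k
    using card_dyadic_corner_cball(1)[of R k 0] R by (meson finite_subset image_mono less_imp_le)
  define h where "h k c = enn2real (dyadic_content s (cell k c))" for k c
  have cell_le: "dyadic_content s (cell k c) \<le> ennreal (2 powr (- s * real k))" for k c
    unfolding cell_def by (rule dyadic_content_cell)
  have h0: "h k c \<ge> 0" for k c by (simp add: h_def)
  have hc: "ennreal (h k c) = dyadic_content s (cell k c)" for k c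
    unfolding h_def using cell_le[of k c] by (intro ennreal_enn2real) (auto intro: le_less_trans simp: less_top[symmetric] top_unique)
  have hle: "h k c \<le> 2 powr (- s * real k)" for k c
    using cell_le[of k c] by (simp add: hc[symmetric])
  define ch where "ch k c = {c' \<in> ?q (Suc k) ` K. ?q k c' = c}" for k c
  have finch: "finite (ch k c)" for k c using finq by (auto simp: ch_def)
  define S where "S k c = (\<Sum>c'\<in>ch k c. h (Suc k) c')" for k c
  have hS: "h k c \<le> S k c" for k c
  proof -
    have "cell k c \<subseteq> (\<Union>c'\<in>ch k c. cell (Suc k) c')"
      by (auto simp: cell_def ch_def dyadic_corner_corner)
    then have "dyadic_content s (cell k c) \<le> (\<Sum>c'\<in>ch k c. dyadic_content s (cell (Suc k) c'))"
      using dyadic_content_UN[OF finch] dyadic_content_mono order_trans by metis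
    also have "\<dots> = ennreal (S k c)" unfolding S_def hc[symmetric] by (simp add: sum_ennreal h0)
    finally show ?thesis unfolding hc[symmetric] by (simp add: S_def sum_nonneg h0)
  qed
  obtain c0 where c0: "c0 \<in> ?q 0 ` K" "h 0 c0 > 0"
  proof -
    have "dyadic_content s K \<le> dyadic_content s (\<Union>c\<in>?q 0 ` K. cell 0 c)"
      by (intro dyadic_content_mono) (auto simp: cell_def)
    also have "\<dots> \<le> (\<Sum>c\<in>?q 0 ` K. dyadic_content s (cell 0 c))"
      by (rule dyadic_content_UN[OF finq])
    finally have "(\<Sum>c\<in>?q 0 ` K. dyadic_content s (cell 0 c)) \<noteq> 0" using pos by auto
    then obtain c where "c \<in> ?q 0 ` K" "dyadic_content s (cell 0 c) \<noteq> 0" using finq by auto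
    then show thesis using that[of c] hc[of 0 c] h0[of 0 c] by (cases "h 0 c = 0") auto
  qed
  \<comment> \<open>Where \<open>S k c = 0\<close> the quotient is 0 by convention, and consistently
    \<open>f k c = 0\<close> because \<open>f k c \<le> h k c \<le> S k c\<close>. The last
    inequality is subadditivity; it keeps the mass below the content at the next level.\<close>
  define f where "f = rec_nat (h 0) (\<lambda>k g c. g (?q k c) * h (Suc k) c / S k (?q k c))"
  have f_0: "f 0 = h 0" and f_S: "f (Suc k) c = f k (?q k c) * h (Suc k) c / S k (?q k c)" for k c
    by (auto simp: f_def)
  have S0: "S k c \<ge> 0" for k c by (simp add: S_def sum_nonneg h0)
  have f0: "f k c \<ge> 0" for k c by (induction k arbitrary: c) (auto simp: f_0 f_S h0 S0)
  have fh: "f k c \<le> h k c" for k c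
  proof (induction k arbitrary: c)
    case (Suc k)
    have "f k (?q k c) \<le> S k (?q k c)" using Suc[of "?q k c"] hS[of k "?q k c"] by linarith
    then show ?case using h0[of "Suc k" c] S0[of k "?q k c"] f0[of k "?q k c"]
      by (cases "S k (?q k c) = 0") (auto simp: f_S pos_divide_le_eq mult.commute intro!: mult_left_mono)
  qed (simp add: f_0)
  have fsum: "(\<Sum>c'\<in>ch k c. f (Suc k) c') = f k c" for k c
  proof -
    have "(\<Sum>c'\<in>ch k c. f (Suc k) c') = (\<Sum>c'\<in>ch k c. f k c * h (Suc k) c' / S k c)"
      by (intro sum.cong) (auto simp: f_S ch_def)
    also have "\<dots> = f k c * S k c / S k c"
      by (simp add: S_def sum_divide_distrib[symmetric] sum_distrib_left[symmetric])
    also have "\<dots> = f k c" using fh[of k c] hS[of k c] f0[of k c] by (cases "S k c = 0") auto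
    finally show ?thesis .
  qed
  \<comment> \<open>Tilings are selected for every possible left end \<open>a\<close>, because the
    left ends \<open>L\<close> are themselves determined by recursion along the ancestors of a
    cell.\<close>
  define sel where "sel k c a = (SOME l. interval_partition a (ch k c) (f (Suc k)) l)" for k c a
  have sel: "interval_partition a (ch k c) (f (Suc k)) (sel k c a)" for k c a
    unfolding sel_def by (rule someI_ex[OF interval_partition_exists]) (rule finch f0)+
  define L where "L = rec_nat (\<lambda>_. 0) (\<lambda>k g c. sel k (?q k c) (g (?q k c)) c)"
  have L_0: "L 0 c = 0" and L_S: "L (Suc k) c = sel k (?q k c) (L k (?q k c)) c" for k c
    by (auto simp: L_def)
  define I where "I k c = {L k c..<L k c + f k c}" for k c
  have part: "interval_partition (L k c) (ch k c) (f (Suc k)) (L (Suc k))" for k c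
  proof -
    have "L (Suc k) c' = sel k c (L k c) c'" if "c' \<in> ch k c" for c' using that by (auto simp: L_S ch_def)
    then show ?thesis using sel[of "L k c" k c] interval_partition_cong[of "ch k c" "L (Suc k)" "sel k c (L k c)"] by simp
  qed
  have I_ex: "\<exists>c'\<in>ch k c. t \<in> I (Suc k) c'" if "t \<in> I k c" for k c t
    using interval_partitionD(1)[OF part[of k c], of t] that unfolding fsum I_def .
  have I_sub: "I (Suc k) c' \<subseteq> I k c" if "c' \<in> ch k c" for k c c'
    using interval_partitionD(2)[OF part that] unfolding fsum I_def .
  have I_inj: "c' = c''" if "c' \<in> ch k c" "c'' \<in> ch k c" "t \<in> I (Suc k) c'" "t \<in> I (Suc k) c''" for k c c' c'' t
    using interval_partitionD(3)[OF part that(1,2)] that(3,4) unfolding I_def .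
  \<comment> \<open>Only the descendants of one root cell \<open>c0\<close> of positive content are
    kept, so that the whole mass is modelled on the single interval \<open>T\<close>.\<close>
  define N where "N k = {c \<in> ?q k ` K. ?q 0 c = c0}" for k
  have finN: "finite (N k)" for k using finq by (auto simp: N_def)
  have chN: "c' \<in> N (Suc k)" if "c \<in> N k" "c' \<in> ch k c" for k c c'
    using that dyadic_corner_corner[of 0 k c'] by (auto simp: N_def ch_def)
  have Nch: "?q k c \<in> N k" "c \<in> ch k (?q k c)" if "c \<in> N (Suc k)" for k c
    using that by (auto simp: N_def ch_def dyadic_corner_corner)
  have N0: "N 0 = {c0}" using c0 by (auto simp: N_def dyadic_corner_corner)
  define T where "T = {0..<f 0 c0}"
  have ex1: "\<exists>!c. c \<in> N k \<and> t \<in> I k c" if "t \<in> T" for k t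
  proof (induction k)
    case 0
    then show ?case using that by (auto simp: N0 I_def T_def L_0)
  next
    case (Suc k)
    then obtain c where c: "c \<in> N k" "t \<in> I k c" and u: "\<And>c'. c' \<in> N k \<Longrightarrow> t \<in> I k c' \<Longrightarrow> c' = c" by blast
    obtain c' where c': "c' \<in> ch k c" "t \<in> I (Suc k) c'" using I_ex[OF c(2)] by blast
    show ?case
    proof (rule ex1I[of _ c'])
      show "c' \<in> N (Suc k) \<and> t \<in> I (Suc k) c'" using chN c c' by blast
      fix d assume d: "d \<in> N (Suc k) \<and> t \<in> I (Suc k) d"
      then have "?q k d = c" using u Nch[of d k] I_sub[of d k "?q k d"] by blast
      then show "d = c'" using d Nch(2)[of d k] I_inj c' by metis
    qed
  qed
  define cc where "cc k t = (THE c. c \<in> N k \<and> t \<in> I k c)" for k t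
  have cc: "cc k t \<in> N k" "t \<in> I k (cc k t)" if "t \<in> T" for k t
    using theI'[OF ex1[OF that, of k]] by (auto simp: cc_def)
  have ccI: "cc k t = c" if "t \<in> T" "c \<in> N k" "t \<in> I k c" for k t c
    using ex1[OF that(1), of k] cc[OF that(1), of k] that by blast
  have cc_S: "?q k (cc (Suc k) t) = cc k t" if "t \<in> T" for k t
    using Nch[OF cc(1)[OF that], of k] I_sub[OF Nch(2)[OF cc(1)[OF that]], of k] cc(2)[OF that, of "Suc k"]
    by (intro ccI[symmetric] that) auto
  have cc_mono: "?q k (cc m t) = cc k t" if "t \<in> T" "k \<le> m" for k m t
    using that(2)
  proof (induction m rule: dec_induct)
    case base
    show ?case using cc(1)[OF that(1), of k] by (auto simp: N_def dyadic_corner_corner)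
  next
    case (step m)
    then show ?case using cc_S[OF that(1), of m] dyadic_corner_corner[of k m "cc (Suc m) t"] by simp
  qed
  \<comment> \<open>Corners need not lie in \<open>K\<close>, so a point of \<open>K\<close> is
    chosen in each cell; the limits \<open>G t\<close> then lie in \<open>K\<close> because it is
    closed.\<close>
  define z where "z k c = (SOME y. y \<in> K \<and> ?q k y = c)" for k c
  have z: "z k c \<in> K" "?q k (z k c) = c" if "c \<in> N k" for k c
  proof -
    have "\<exists>y. y \<in> K \<and> ?q k y = c" using that by (auto simp: N_def)
    from someI_ex[OF this] show "z k c \<in> K" "?q k (z k c) = c" by (auto simp: z_def)
  qed
  define F where "F k t = z k (cc k t)" for k t
  have F: "F k t \<in> K" "?q k (F k t) = cc k t" if "t \<in> T" for k t
    using z[OF cc(1)[OF that]] by (auto simp: F_def)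
  have dist_F: "dist (F m t) (F k t) \<le> 2 * n / 2 ^ k" if "t \<in> T" "k \<le> m" for k m t
  proof -
    have "?q k (F m t) = cc k t"
      using F(2)[OF that(1), of m] cc_mono[OF that] dyadic_corner_corner[OF that(2), of "F m t"] by simp
    then have "dist (F m t) (F k t) \<le> norm (F m t - ?q k (F m t)) + norm (F k t - ?q k (F k t))"
      using norm_triangle_ineq4[of "F m t - cc k t" "F k t - cc k t"] F(2)[OF that(1), of k] by (simp add: dist_norm)
    then show ?thesis using norm_diff_dyadic_corner[of "F m t" k] norm_diff_dyadic_corner[of "F k t" k] by (simp add: n_def)
  qed
  have "\<exists>y. (\<lambda>k. F k t) \<longlonglongrightarrow> y" if "t \<in> T" for t
  proof -
    have "Cauchy (\<lambda>k. F k t)"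
    proof (rule metric_CauchyI)
      fix e :: real assume "e > 0"
      then have "e / (4 * n) > 0" using n by simp
      then obtain k where k: "(1/2) ^ k < e / (4 * n)" using real_arch_pow_inv[of "e / (4 * n)" "1/2"] by auto
      have "dist (F m t) (F m' t) < e" if "m \<ge> k" "m' \<ge> k" for m m'
      proof -
        have "dist (F m t) (F m' t) \<le> dist (F m t) (F k t) + dist (F m' t) (F k t)" by (rule dist_triangle2)
        also have "\<dots> \<le> 4 * n / 2 ^ k" using dist_F[OF \<open>t \<in> T\<close> that(1)] dist_F[OF \<open>t \<in> T\<close> that(2)] by simp
        also have "\<dots> < e" using k n by (simp add: power_one_over field_simps)
        finally show ?thesis .
      qed
      then show "\<exists>M. \<forall>m\<ge>M. \<forall>n\<ge>M. dist (F m t) (F n t) < e" by blast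
    qed
    then show ?thesis by (simp add: Cauchy_convergent_iff convergent_def)
  qed
  then obtain G where G: "\<And>t. t \<in> T \<Longrightarrow> (\<lambda>k. F k t) \<longlonglongrightarrow> G t" by metis
  have GK: "G t \<in> K" if "t \<in> T" for t
    by (rule closed_sequentially[OF compact_imp_closed[OF K] F(1)[OF that] G[OF that]])
  have dist_G: "dist (G t) (F k t) \<le> 2 * n / 2 ^ k" if "t \<in> T" for k t
  proof (rule LIMSEQ_le_const2)
    show "(\<lambda>m. dist (F m t) (F k t)) \<longlonglongrightarrow> dist (G t) (F k t)" by (intro tendsto_intros G that)
    show "\<exists>N. \<forall>m\<ge>N. dist (F m t) (F k t) \<le> 2 * n / 2 ^ k" using dist_F[OF that] by blast
  qed
  define M where "M = restrict_space lborel T"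
  have T_borel: "T \<in> sets borel" by (simp add: T_def)
  have spM: "space M = T" by (simp add: M_def space_restrict_space)
  have F_meas: "F k \<in> borel_measurable M" for k
  proof (rule measurableI)
    fix A :: "'a set" assume "A \<in> sets borel"
    have "F k -` A \<inter> space M = T \<inter> (\<Union>c\<in>{c \<in> N k. z k c \<in> A}. I k c)"
    proof (intro set_eqI iffI)
      fix t assume "t \<in> F k -` A \<inter> space M"
      then have "t \<in> T" "z k (cc k t) \<in> A" by (auto simp: spM F_def)
      then show "t \<in> T \<inter> (\<Union>c\<in>{c \<in> N k. z k c \<in> A}. I k c)" using cc by blast
    next
      fix t assume "t \<in> T \<inter> (\<Union>c\<in>{c \<in> N k. z k c \<in> A}. I k c)"
      then obtain c where "t \<in> T" "c \<in> N k" "z k c \<in> A" "t \<in> I k c" by blast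
      then show "t \<in> F k -` A \<inter> space M" using ccI[of t c k] by (simp add: spM F_def)
    qed
    also have "\<dots> \<in> sets M"
    proof -
      have fin: "finite {c \<in> N k. z k c \<in> A}" using finN[of k] by simp
      have "(\<Union>c\<in>{c \<in> N k. z k c \<in> A}. I k c) \<in> sets borel"
        by (rule sets.finite_UN[OF fin]) (simp add: I_def)
      then show ?thesis unfolding M_def sets_restrict_space by auto
    qed
    finally show "F k -` A \<inter> space M \<in> sets M" .
  qed simp
  have G_meas: "G \<in> borel_measurable M"
  proof (rule borel_measurable_LIMSEQ_metric[where f = F])
    show "F i \<in> borel_measurable M" for i by (rule F_meas)
    show "(\<lambda>i. F i t) \<longlonglongrightarrow> G t" if "t \<in> space M" for t using that G spM by simp
  qed
  define \<nu> where "\<nu> = distr M borel G"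
  have \<nu>: "emeasure \<nu> A = emeasure lborel {t \<in> T. G t \<in> A}" if "A \<in> sets borel" for A
  proof -
    have "emeasure \<nu> A = emeasure M (G -` A \<inter> space M)" unfolding \<nu>_def by (rule emeasure_distr[OF G_meas that])
    also have "\<dots> = emeasure lborel (G -` A \<inter> space M)"
      unfolding M_def by (rule emeasure_restrict_space) (use T_borel in \<open>auto simp: space_restrict_space\<close>)
    also have "G -` A \<inter> space M = {t \<in> T. G t \<in> A}" by (auto simp: spM)
    finally show ?thesis .
  qed
  have tot: "emeasure \<nu> UNIV = ennreal (f 0 c0)" proof -
    have "emeasure \<nu> UNIV = emeasure lborel T" by (subst \<nu>) auto
    then show ?thesis using f0[of 0 c0] by (simp add: T_def)
  qed
  \<comment> \<open>For 1/2^k comparable to r, the limits in a ball of radius r come from cells that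
    meet a ball of radius at most (1 + 2 n)/2^k, which bounds their number; each has mass at most
    2^(-s k) <= (2 r)^s. The summand 1 gives \<open>B \<ge> 1\<close> for radii above 1, where the
    total mass is at most 1.\<close>
  define B where "B = (2 * (1 + 2 * n) + 2) ^ DIM('a) * 2 powr s + 1"
  have B: "B \<ge> 1" using n by (simp add: B_def)
  show thesis
  proof (rule that)
    show "sets \<nu> = sets borel" by (simp add: \<nu>_def)
    have "{t \<in> T. G t \<in> - K} = {}" using GK by auto
    moreover have "- K \<in> sets borel" using compact_imp_closed[OF K] by auto
    ultimately show "emeasure \<nu> (- K) = 0" by (simp only: \<nu> emeasure_empty)
    show "emeasure \<nu> UNIV \<noteq> 0" using c0(2) by (simp add: tot f_0)
    show "emeasure \<nu> UNIV \<noteq> \<infinity>" by (simp add: tot)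
    show "B > 0" using B by simp
    fix x :: 'a and r :: real assume r: "r > 0"
    show "emeasure \<nu> (cball x r) \<le> ennreal (B * r powr s)"
    proof (cases "r \<le> 1")
      case False
      have "emeasure \<nu> (cball x r) \<le> emeasure \<nu> UNIV" by (intro emeasure_mono) (auto simp: \<nu>_def)
      also have "\<dots> \<le> ennreal 1" unfolding tot f_0 using hle[of 0 c0] by (intro ennreal_leI) simp
      also have "\<dots> \<le> ennreal (B * r powr s)"
        using False B s ge_one_powr_ge_zero[of r s] mult_mono[of 1 B 1 "r powr s"] by (intro ennreal_leI) auto
      finally show ?thesis .
    next
      case True
      then obtain k where k: "r \<le> 1 / 2 ^ k" "1 / 2 ^ k < 2 * r" using dyadic_scale r by blast
      define \<rho> where "\<rho> = r + 2 * n / 2 ^ k"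
      have \<rho>: "\<rho> \<ge> 0" using r n by (simp add: \<rho>_def)
      define Q where "Q = N k \<inter> ?q k ` cball x \<rho>"
      have finQ: "finite Q" using finN by (simp add: Q_def)
      have "{t \<in> T. G t \<in> cball x r} \<subseteq> (\<Union>c\<in>Q. I k c)"
      proof
        fix t assume t: "t \<in> {t \<in> T. G t \<in> cball x r}"
        then have tT: "t \<in> T" and "dist x (G t) \<le> r" by auto
        then have "dist x (F k t) \<le> \<rho>" using dist_triangle[of x "F k t" "G t"] dist_G[OF tT, of k] by (simp add: \<rho>_def)
        then have "cc k t \<in> Q" unfolding Q_def using F(2)[OF tT, of k] cc(1)[OF tT, of k] by (auto simp: image_iff intro!: bexI[of _ "F k t"])
        then show "t \<in> (\<Union>c\<in>Q. I k c)" using cc(2)[OF tT] by blast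
      qed
      then have "emeasure \<nu> (cball x r) \<le> emeasure lborel (\<Union>c\<in>Q. I k c)"
        using finQ by (subst \<nu>) (auto intro!: emeasure_mono sets.finite_UN simp: I_def)
      also have "\<dots> \<le> (\<Sum>c\<in>Q. emeasure lborel (I k c))"
        using finQ by (intro emeasure_subadditive_finite) (auto simp: I_def)
      also have "\<dots> \<le> (\<Sum>c\<in>Q. ennreal (2 powr (- s * real k)))"
      proof (rule sum_mono)
        fix c
        have "emeasure lborel (I k c) = ennreal (f k c)" using f0[of k c] by (simp add: I_def)
        then show "emeasure lborel (I k c) \<le> ennreal (2 powr (- s * real k))"
          using fh[of k c] hle[of k c] by (simp add: ennreal_leI)
      qed
      also have "\<dots> = ennreal (real (card Q) * 2 powr (- s * real k))"
        by (simp add: ennreal_of_nat_eq_real_of_nat ennreal_mult)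
      also have "\<dots> \<le> ennreal (B * r powr s)"
      proof (rule ennreal_leI)
        have "real (card Q) \<le> real (card (?q k ` cball x \<rho>))"
          unfolding Q_def of_nat_le_iff by (intro card_mono card_dyadic_corner_cball(1) \<rho>) auto
        also have "\<dots> \<le> (2 * 2 ^ k * \<rho> + 2) ^ DIM('a)" by (rule card_dyadic_corner_cball(2)[OF \<rho>])
        also have "\<dots> \<le> (2 * (1 + 2 * n) + 2) ^ DIM('a)"
        proof (rule power_mono)
          have "2 ^ k * \<rho> \<le> 1 + 2 * n" using k(1) by (simp add: \<rho>_def field_simps)
          then show "2 * 2 ^ k * \<rho> + 2 \<le> 2 * (1 + 2 * n) + 2" by simp
        qed (use \<rho> in simp)
        finally have 1: "real (card Q) \<le> (2 * (1 + 2 * n) + 2) ^ DIM('a)" .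
        have "2 powr (- s * real k) = (1 / 2 ^ k) powr s"
          by (simp add: powr_divide powr_realpow[symmetric] powr_powr powr_minus_divide mult.commute)
        also have "\<dots> \<le> (2 * r) powr s" using k(2) s by (intro powr_mono2) auto
        also have "\<dots> = 2 powr s * r powr s" using r by (simp add: powr_mult)
        finally have "real (card Q) * 2 powr (- s * real k) \<le> (2 * (1 + 2 * n) + 2) ^ DIM('a) * (2 powr s * r powr s)"
          using 1 n by (intro mult_mono) auto
        also have "\<dots> \<le> B * r powr s" by (simp add: B_def algebra_simps)
        finally show "real (card Q) * 2 powr (- s * real k) \<le> B * r powr s" .
      qed
      finally show ?thesis .
    qed
  qed
qed


text \<open>Exponent 0 is allowed whatever the dimension, with a Dirac mass. For
  \<open>s > 0\<close> capacitability supplies a compact \<open>K\<close> whose open neighbourhoods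
  all have content above some \<open>a > 0\<close>. A null \<open>K\<close> would have
  neighbourhoods of arbitrarily small content, so \<open>frostman_compact\<close> applies.\<close>

theorem frostman:
  fixes A :: "'a::euclidean_space set"
  assumes A: "A \<in> sets borel" "A \<noteq> {}" and s: "s = 0 \<or> s > 0 \<and> ereal s < hausdorff_dim A"
  obtains \<nu> K B where "prob_space \<nu>" "sets \<nu> = sets borel" "compact K" "K \<subseteq> A" "emeasure \<nu> (- K) = 0"
    "B > 0" "\<And>x r. r > 0 \<Longrightarrow> emeasure \<nu> (cball x r) \<le> ennreal (B * r powr s)"
proof (cases "s = 0")
  case True
  obtain a where a: "a \<in> A" using A by blast
  interpret prob_space "return borel a" by (rule prob_space_return) simp
  show thesis
    by (rule that[of "return borel a" "{a}" 1])
      (use a True in \<open>auto simp: prob_space_axioms emeasure_return indicator_def\<close>)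
next
  case False
  then have s: "s > 0" "ereal s < hausdorff_dim A" using s by auto
  have "hausdorff_measure s A \<noteq> 0"
  proof
    assume "hausdorff_measure s A = 0"
    then have "hausdorff_dim A \<le> ereal s" unfolding hausdorff_dim_def using s by (intro Inf_lower) auto
    then show False using s by simp
  qed
  then have "dyadic_content s A > 0" using hausdorff_measure_zero[of s A] s by (metis not_gr_zero)
  then obtain a where a: "0 < a" "a < dyadic_content s A" using dense by blast
  obtain K where K: "compact K" "K \<subseteq> A" and KU: "\<And>U. open U \<Longrightarrow> K \<subseteq> U \<Longrightarrow> a < dyadic_content s U"
  proof (rule capacitability[OF dyadic_content_mono dyadic_content_incseq A(1) a(2)])
    fix K assume "compact K" "K \<subseteq> A" "\<And>U. open U \<Longrightarrow> K \<subseteq> U \<Longrightarrow> a < dyadic_content s U"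
    then show thesis by (rule that)
  qed
  have "dyadic_content s K > 0"
  proof (rule ccontr)
    assume "\<not> ?thesis"
    then have z: "dyadic_content s K = 0" by simp
    obtain e where e: "e > 0" "ennreal e \<le> a"
    proof (cases a)
      case (real r)
      then show thesis using a that[of r] by simp
    next
      case top
      then show thesis using that[of 1] by simp
    qed
    obtain U where "open U" "K \<subseteq> U" "dyadic_content s U \<le> ennreal e"
      using dyadic_content_open_nbhd[OF z e(1)] by blast
    then show False using KU[of U] e(2) by (meson leD order_trans)
  qed
  then obtain \<nu> B where \<nu>: "sets \<nu> = sets borel" "emeasure \<nu> (- K) = 0" "emeasure \<nu> UNIV \<noteq> 0" "emeasure \<nu> UNIV \<noteq> \<infinity>"
    "B > 0" "\<And>x r. r > 0 \<Longrightarrow> emeasure \<nu> (cball x r) \<le> ennreal (B * r powr s)"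
    using frostman_compact[OF K(1) s(1)] by metis
  define m where "m = enn2real (emeasure \<nu> UNIV)"
  have em: "emeasure \<nu> UNIV = ennreal m" unfolding m_def using \<nu>(4) by (simp add: ennreal_enn2real_if)
  have m: "m > 0" using \<nu>(3,4) unfolding m_def by (simp add: enn2real_positive_iff less_top zero_less_iff_neq_zero)
  define \<nu>' where "\<nu>' = scale_measure (ennreal (1 / m)) \<nu>"
  show thesis
  proof (rule that[of \<nu>' K "B / m"])
    have "space \<nu> = UNIV" using \<nu>(1) by (metis sets_eq_imp_space_eq space_borel)
    then show "prob_space \<nu>'"
      by (intro prob_spaceI) (use m in \<open>simp add: \<nu>'_def space_scale_measure em flip: ennreal_mult\<close>)
    show "sets \<nu>' = sets borel" using \<nu>(1) by (simp add: \<nu>'_def)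
    show "emeasure \<nu>' (- K) = 0" using \<nu>(2) by (simp add: \<nu>'_def)
    show "B / m > 0" using \<nu>(5) m by simp
    fix x :: 'a and r :: real assume r: "r > 0"
    have "emeasure \<nu>' (cball x r) \<le> ennreal (1 / m) * ennreal (B * r powr s)"
      unfolding \<nu>'_def emeasure_scale_measure by (intro mult_left_mono \<nu>(6) r) simp
    also have "\<dots> = ennreal (B / m * r powr s)" using m \<nu>(5) by (simp flip: ennreal_mult)
    finally show "emeasure \<nu>' (cball x r) \<le> ennreal (B / m * r powr s)" .
  qed (use K in auto)
qed

section \<open>Covering numbers of the orthogonal group\<close>

lemma norm_sq_vec: "(norm (x :: 'a::real_normed_vector^'n))\<^sup>2 = (\<Sum>i\<in>UNIV. (norm (x $ i))\<^sup>2)"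
  unfolding norm_vec_def L2_set_def by (simp add: sum_nonneg)

lemma norm_orthogonal_matrix_mult:
  assumes "orthogonal_matrix (g :: real^'n^'n)"
  shows "norm (g *v v) = norm v"
proof -
  have "orthogonal_transformation (\<lambda>x. g *v x)"
    using assms by (simp add: orthogonal_transformation_matrix)
  then show ?thesis by (rule orthogonal_transformation_norm)
qed

lemma orthogonal_matrix_norm_row: "orthogonal_matrix (g :: real^'n^'n) \<Longrightarrow> norm (g $ i) = 1"
  unfolding orthogonal_matrix_orthonormal_rows row_def by (simp add: vec_lambda_eta)

lemma orthogonal_matrix_inner_rows: "orthogonal_matrix (g :: real^'n^'n) \<Longrightarrow> i \<noteq> j \<Longrightarrow> g $ i \<bullet> g $ j = 0"
  unfolding orthogonal_matrix_orthonormal_rows row_def orthogonal_def by (simp add: vec_lambda_eta)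

text \<open>The squared Frobenius norm is the sum of the squared norms of the columns, and left
  multiplication moves each column by an isometry.\<close>

lemma norm_orthogonal_matrix_mult_matrix:
  assumes "orthogonal_matrix (h :: real^'n^'n)"
  shows "norm (h ** A) = norm (A :: real^'n^'n)"
proof -
  have sq: "(norm B)\<^sup>2 = (\<Sum>j\<in>UNIV. (norm (column j B))\<^sup>2)" for B :: "real^'n^'n"
  proof -
    have "(norm B)\<^sup>2 = (\<Sum>i\<in>UNIV. \<Sum>j\<in>UNIV. (B $ i $ j)\<^sup>2)"
      by (simp add: norm_sq_vec)
    also have "\<dots> = (\<Sum>j\<in>UNIV. \<Sum>i\<in>UNIV. (B $ i $ j)\<^sup>2)" by (rule sum.swap)
    also have "\<dots> = (\<Sum>j\<in>UNIV. (norm (column j B))\<^sup>2)"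
      by (simp add: norm_sq_vec column_def)
    finally show ?thesis .
  qed
  have "column j (h ** A) = h *v column j A" for j
    by (simp add: vec_eq_iff column_def matrix_matrix_mult_def matrix_vector_mult_def)
  then have "(norm (h ** A))\<^sup>2 = (norm A)\<^sup>2"
    unfolding sq by (simp add: norm_orthogonal_matrix_mult[OF assms])
  then show ?thesis by simp
qed

lemma norm_le_sum_rows: "norm (A :: real^'n^'m) \<le> (\<Sum>i\<in>UNIV. norm (A $ i))"
  unfolding norm_vec_def by (rule L2_set_le_sum) simp

lemma matrix_sub_ldistrib: "(A :: real^'n^'m) ** (B - C) = A ** B - A ** C"
  by (simp add: matrix_matrix_mult_def vec_eq_iff sum_subtractf right_diff_distrib)

lemma card_floor_interval:
  fixes x :: real
  assumes "x \<ge> 0"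
  shows "real (card {\<lfloor>- x\<rfloor>..\<lfloor>x\<rfloor>}) \<le> 2 * x + 2"
proof -
  have "real (card {\<lfloor>- x\<rfloor>..\<lfloor>x\<rfloor>}) = max 0 (real_of_int (\<lfloor>x\<rfloor> - \<lfloor>- x\<rfloor> + 1))"
    by (simp add: of_nat_nat max_def)
  also have "\<dots> \<le> 2 * x + 2" using assms by linarith
  finally show ?thesis .
qed

text \<open>In the orthonormal coordinates given by the rows of \<open>g\<close>, one coordinate of a unit vector is
  large and is determined up to sign, in a Lipschitz way, by the others; those with index in \<open>J\<close> are
  of order \<open>\<rho>\<close>.\<close>

lemma sphere_slab_pieces:
  fixes J :: "'n::finite set"
  assumes a: "a \<ge> 0" and i: "i \<notin> J"
  obtains C where "C > 0"
    "\<And>\<rho> g. 0 < \<rho> \<Longrightarrow> \<rho> \<le> 1 \<Longrightarrow> orthogonal_matrix (g :: real^'n^'n) \<Longrightarrow>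
       \<exists>P. finite P \<and> real (card P) \<le> C * (1 / \<rho>) ^ (card (- J) - 1) \<and>
         {v. norm v = 1 \<and> (\<forall>k\<in>J. \<bar>g $ k \<bullet> v\<bar> \<le> a * \<rho>)} \<subseteq> \<Union>P \<and>
         (\<forall>p\<in>P. \<forall>v\<in>p. \<forall>w\<in>p. dist v w \<le> C * \<rho>)"
proof -
  define d where "d = real CARD('n)"
  have d: "d \<ge> 1" unfolding d_def by (simp add: Suc_le_eq)
  define A where "A = 2 * a + 3"
  define D where "D = (5 * A) ^ CARD('n) * (1 + a * d)"
  define C where "C = 2 * d * D + 2 * d^2"
  define e where "e = card (- J) - 1"
  have cJ: "card (- J) = Suc e"
  proof -
    have "card (- J) > 0" using i by (auto simp: card_gt_0_iff)
    then show ?thesis by (simp add: e_def)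
  qed
  have A: "A \<ge> 1" using a by (simp add: A_def)
  have D: "D \<ge> 0" unfolding D_def using a d A by (intro mult_nonneg_nonneg) auto
  have C: "C > 0" unfolding C_def using d D by (intro add_nonneg_pos) auto
  show thesis
  proof (rule that[OF C])
    fix \<rho> :: real and g :: "real^'n^'n"
    assume \<rho>: "0 < \<rho>" "\<rho> \<le> 1" and g: "orthogonal_matrix g"
    define V where "V = {v. norm v = 1 \<and> (\<forall>k\<in>J. \<bar>g $ k \<bullet> v\<bar> \<le> a * \<rho>)}"
    define y where "y v = g *v v" for v
    have yk: "y v $ k = g $ k \<bullet> v" for v k by (simp add: y_def matrix_vector_mul_component)
    have ex: "\<exists>m. 1 / d \<le> (y v $ m)\<^sup>2" if "v \<in> V" for v
    proof (rule ccontr)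
      assume "\<not> ?thesis"
      then have "(\<Sum>m\<in>UNIV. (y v $ m)\<^sup>2) < (\<Sum>m\<in>(UNIV::'n set). 1 / d)"
        by (intro sum_strict_mono) (auto simp: not_le)
      moreover have "(\<Sum>m\<in>UNIV. (y v $ m)\<^sup>2) = (norm (y v))\<^sup>2"
        by (simp add: norm_sq_vec)
      moreover have "norm (y v) = 1" using that g by (simp add: V_def y_def norm_orthogonal_matrix_mult)
      ultimately show False using d by (simp add: d_def)
    qed
    define mm where "mm v = (SOME m. 1 / d \<le> (y v $ m)\<^sup>2)" for v
    have mm: "1 / d \<le> \<bar>y v $ mm v\<bar>" if "v \<in> V" for v
    proof -
      have 1: "1 / d \<le> (y v $ mm v)\<^sup>2" unfolding mm_def using ex[OF that] by (rule someI_ex)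
      have "(1 / d)\<^sup>2 \<le> 1 / d" using d by (simp add: power2_eq_square field_simps)
      then have "(1 / d)\<^sup>2 \<le> (\<bar>y v $ mm v\<bar>)\<^sup>2" using 1 by simp
      then show ?thesis by (rule power2_le_imp_le) simp
    qed
    \<comment> \<open>Vectors share a piece if they agree in the index of a large coordinate, in its
      sign, and in the other coordinates rounded at scale \<rho>; the large coordinate is then
      recovered from the norm.\<close>
    define code where "code v = (mm v, y v $ mm v > 0, \<lambda>k. if k = mm v then 0 else \<lfloor>y v $ k / \<rho>\<rfloor>)" for v
    have yle: "\<bar>y v $ k\<bar> \<le> 1" if "v \<in> V" for v k
      using component_le_norm_cart[of "y v" k] that g by (simp add: V_def y_def norm_orthogonal_matrix_mult)
    have yJ: "\<bar>y v $ k\<bar> \<le> a * \<rho>" if "v \<in> V" "k \<in> J" for v k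
      using that by (auto simp: V_def yk)
    define Bd where "Bd m k = (if k = m then {0} else if k \<in> J then {\<lfloor>- a\<rfloor>..\<lfloor>a\<rfloor>} else {\<lfloor>- (1 / \<rho>)\<rfloor>..\<lfloor>1 / \<rho>\<rfloor>})" for m k :: 'n
    \<comment> \<open>A coordinate in \<open>J\<close> is at most \<open>a * \<rho>\<close>, so it
      can be the large one only if \<open>1 / \<rho> \<le> a * d\<close>. In that case no free
      coordinate is saved, but the surplus factor \<open>1 / \<rho>\<close> is bounded; it accounts
      for \<open>1 + a * d\<close> in \<open>D\<close>.\<close>
    define M where "M = {m. m \<notin> J \<or> 1 / \<rho> \<le> a * d}"
    define Rg where "Rg = (\<Union>m\<in>M. {m} \<times> (UNIV :: bool set) \<times> PiE UNIV (Bd m))"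
    have finPi: "finite (PiE UNIV (Bd m))" for m by (intro finite_PiE) (auto simp: Bd_def)
    have finRg: "finite Rg" unfolding Rg_def by (auto intro!: finite_cartesian_product finPi)
    have codeV: "code ` V \<subseteq> Rg"
    proof
      fix c assume "c \<in> code ` V"
      then obtain v where v: "v \<in> V" "c = code v" by auto
      have "mm v \<in> M"
      proof (cases "mm v \<in> J")
        case True
        then have "1 / d \<le> a * \<rho>" using mm[OF v(1)] yJ[OF v(1) True] by linarith
        then have "1 / \<rho> \<le> a * d" using d \<rho> by (simp add: field_simps)
        then show ?thesis by (simp add: M_def)
      qed (simp add: M_def)
      moreover have "(\<lambda>k. if k = mm v then 0 else \<lfloor>y v $ k / \<rho>\<rfloor>) \<in> PiE UNIV (Bd (mm v))"
      proof (rule PiE_I)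
        fix k :: 'n
        have 1: "- (1 / \<rho>) \<le> y v $ k / \<rho>" "y v $ k / \<rho> \<le> 1 / \<rho>"
          using yle[OF v(1), of k] \<rho> by (auto simp: field_simps)
        have 2: "- a \<le> y v $ k / \<rho>" "y v $ k / \<rho> \<le> a" if "k \<in> J"
          using yJ[OF v(1) that] \<rho> by (auto simp: field_simps abs_le_iff)
        show "(if k = mm v then 0 else \<lfloor>y v $ k / \<rho>\<rfloor>) \<in> Bd (mm v) k"
          using 1[THEN floor_mono] 2[THEN floor_mono] by (auto simp: Bd_def)
      qed simp
      ultimately show "c \<in> Rg" by (auto simp: Rg_def v(2) code_def)
    qed
    have cardPi: "real (card (PiE UNIV (Bd m))) \<le> D * (1 / \<rho>) ^ e" if "m \<in> M" for m
    proof -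
      define U where "U = (if m \<in> J then - J else - J - {m})"
      have \<rho>1: "1 \<le> 1 / \<rho>" using \<rho> by simp
      have "real (card (PiE UNIV (Bd m))) = (\<Prod>k\<in>UNIV. real (card (Bd m k)))" by (simp add: card_PiE)
      also have "\<dots> \<le> (\<Prod>k\<in>(UNIV::'n set). (5 * A) * (if k \<in> U then 1 / \<rho> else 1))"
      proof (rule prod_mono, safe)
        fix k :: 'n
        have "real (card {\<lfloor>- a\<rfloor>..\<lfloor>a\<rfloor>}) \<le> 5 * A" using card_floor_interval[OF a] a by (simp add: A_def)
        moreover have "real (card {\<lfloor>- (1 / \<rho>)\<rfloor>..\<lfloor>1 / \<rho>\<rfloor>}) \<le> 5 * A * (1 / \<rho>)"
        proof -
          have "real (card {\<lfloor>- (1 / \<rho>)\<rfloor>..\<lfloor>1 / \<rho>\<rfloor>}) \<le> 2 * (1 / \<rho>) + 2" using \<rho>1 by (intro card_floor_interval) linarith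
          also have "\<dots> \<le> 5 * (1 / \<rho>)" using \<rho>1 by linarith
          also have "\<dots> \<le> 5 * A * (1 / \<rho>)" using A \<rho> by (intro mult_right_mono) auto
          finally show ?thesis .
        qed
        moreover have "5 * A * 1 \<le> 5 * A * (1 / \<rho>)" using A \<rho>1 by (intro mult_left_mono) auto
        ultimately show "real (card (Bd m k)) \<le> 5 * A * (if k \<in> U then 1 / \<rho> else 1)"
          using A by (auto simp: Bd_def U_def)
      qed simp
      also have "\<dots> = (5 * A) ^ CARD('n) * (1 / \<rho>) ^ card U"
        by (simp add: prod.distrib prod.If_cases)
      also have "\<dots> \<le> (5 * A) ^ CARD('n) * ((1 + a * d) * (1 / \<rho>) ^ e)"
      proof (rule mult_left_mono)
        show "(1 / \<rho>) ^ card U \<le> (1 + a * d) * (1 / \<rho>) ^ e"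
        proof (cases "m \<in> J")
          case True
          then have "1 / \<rho> \<le> 1 + a * d" using that by (simp add: M_def)
          moreover have "(1 / \<rho>) ^ card U = (1 / \<rho>) * (1 / \<rho>) ^ e" using True cJ by (simp add: U_def)
          ultimately show ?thesis using \<rho> mult_right_mono[of "1 / \<rho>" "1 + a * d" "(1 / \<rho>) ^ e"] by simp
        next
          case False
          then have "card U = e" using cJ by (simp add: U_def)
          then show ?thesis using a d \<rho> mult_right_mono[of 1 "1 + a * d" "(1 / \<rho>) ^ e"] by simp
        qed
      qed (use A in simp)
      finally show ?thesis by (simp add: D_def mult.assoc)
    qed
    have cardRg: "real (card Rg) \<le> C * (1 / \<rho>) ^ e"
    proof -
      have "real (card Rg) \<le> real (\<Sum>m\<in>M. card ({m} \<times> (UNIV :: bool set) \<times> PiE UNIV (Bd m)))"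
        unfolding Rg_def of_nat_le_iff by (rule card_UN_le) simp
      also have "\<dots> = (\<Sum>m\<in>M. 2 * real (card (PiE UNIV (Bd m))))"
        by (simp add: card_cartesian_product)
      also have "\<dots> \<le> (\<Sum>m\<in>M. 2 * (D * (1 / \<rho>) ^ e))"
        using cardPi by (intro sum_mono) simp
      also have "\<dots> = real (card M) * (2 * (D * (1 / \<rho>) ^ e))" by simp
      also have "\<dots> \<le> d * (2 * (D * (1 / \<rho>) ^ e))"
        using D \<rho> unfolding d_def by (intro mult_right_mono) (auto intro: card_mono)
      also have "\<dots> \<le> C * (1 / \<rho>) ^ e"
        unfolding C_def using \<rho> by (simp add: algebra_simps)
      finally show ?thesis .
    qed
    define P where "P = (\<lambda>c. {v \<in> V. code v = c}) ` (code ` V)"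
    have fincV: "finite (code ` V)" using codeV finRg finite_subset by blast
    have "real (card P) \<le> C * (1 / \<rho>) ^ e"
    proof -
      have "card P \<le> card (code ` V)" unfolding P_def by (rule card_image_le[OF fincV])
      also have "\<dots> \<le> card Rg" by (rule card_mono[OF finRg codeV])
      finally show ?thesis using cardRg by linarith
    qed
    moreover have "dist v w \<le> C * \<rho>" if "v \<in> V" "w \<in> V" and cd: "code v = code w" for v w
    proof -
      define m where "m = mm v"
      have m: "mm w = m" "y v $ m > 0 \<longleftrightarrow> y w $ m > 0" using cd by (auto simp: code_def m_def)
      have fl: "\<lfloor>y v $ k / \<rho>\<rfloor> = \<lfloor>y w $ k / \<rho>\<rfloor>" if "k \<noteq> m" for k
      proof -
        have "(\<lambda>k. if k = m then 0 else \<lfloor>y v $ k / \<rho>\<rfloor>) = (\<lambda>k. if k = m then 0 else \<lfloor>y w $ k / \<rho>\<rfloor>)"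
          using cd m(1) unfolding code_def m_def by simp
        from fun_cong[OF this, of k] show ?thesis using that by simp
      qed
      have close: "\<bar>y v $ k - y w $ k\<bar> \<le> \<rho>" if "k \<noteq> m" for k
      proof -
        have "\<bar>y v $ k / \<rho> - y w $ k / \<rho>\<bar> \<le> 1" using fl[OF that] by linarith
        then have "\<bar>(y v $ k - y w $ k) / \<rho>\<bar> \<le> 1" by (simp only: diff_divide_distrib)
        then show ?thesis using \<rho> by (simp only: abs_divide) (simp add: pos_divide_le_eq)
      qed
      have sq1: "(\<Sum>k\<in>UNIV. (y u $ k)\<^sup>2) = 1" if "u \<in> V" for u
      proof -
        have "(\<Sum>k\<in>UNIV. (y u $ k)\<^sup>2) = (norm (y u))\<^sup>2"
          by (simp add: norm_sq_vec)
        then show ?thesis using that g by (simp add: V_def y_def norm_orthogonal_matrix_mult)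
      qed
      have sqm: "(y u $ m)\<^sup>2 = 1 - (\<Sum>k\<in>UNIV - {m}. (y u $ k)\<^sup>2)" if "u \<in> V" for u
        using sq1[OF that] sum.remove[of UNIV m "\<lambda>k. (y u $ k)\<^sup>2"] by simp
      have "\<bar>(y v $ m)\<^sup>2 - (y w $ m)\<^sup>2\<bar> = \<bar>\<Sum>k\<in>UNIV - {m}. (y w $ k)\<^sup>2 - (y v $ k)\<^sup>2\<bar>"
        by (simp add: sqm that sum_subtractf)
      also have "\<dots> \<le> (\<Sum>k\<in>UNIV - {m}. \<bar>(y w $ k)\<^sup>2 - (y v $ k)\<^sup>2\<bar>)" by (rule sum_abs)
      also have "\<dots> \<le> (\<Sum>k\<in>UNIV - {m}. 2 * \<rho>)"
      proof (rule sum_mono)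
        fix k assume "k \<in> UNIV - {m}"
        then have c: "\<bar>y w $ k - y v $ k\<bar> \<le> \<rho>" using close[of k] by auto
        have "\<bar>(y w $ k)\<^sup>2 - (y v $ k)\<^sup>2\<bar> = \<bar>y w $ k + y v $ k\<bar> * \<bar>y w $ k - y v $ k\<bar>"
          by (simp add: power2_eq_square flip: abs_mult) (simp add: algebra_simps)
        also have "\<dots> \<le> 2 * \<rho>"
          using c yle[OF that(1), of k] yle[OF that(2), of k] by (intro mult_mono) auto
        finally show "\<bar>(y w $ k)\<^sup>2 - (y v $ k)\<^sup>2\<bar> \<le> 2 * \<rho>" .
      qed
      also have "\<dots> \<le> 2 * \<rho> * d"
      proof -
        have "real (card (UNIV - {m})) \<le> d" unfolding d_def of_nat_le_iff by (intro card_mono) auto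
        then show ?thesis using \<rho> by simp
      qed
      finally have 1: "\<bar>(y v $ m)\<^sup>2 - (y w $ m)\<^sup>2\<bar> \<le> 2 * \<rho> * d" .
      \<comment> \<open>Equal signs add the absolute values. Dividing the difference of squares by
        this sum gives the Lipschitz dependence of the large coordinate on the others.\<close>
      have 2: "\<bar>y v $ m + y w $ m\<bar> \<ge> 2 / d"
      proof -
        have "1 / d \<le> \<bar>y v $ m\<bar>" "1 / d \<le> \<bar>y w $ m\<bar>"
          using mm[OF that(1)] mm[OF that(2)] m(1) by (auto simp: m_def)
        moreover have "1 / d > 0" "2 / d = 1 / d + 1 / d" using d by auto
        ultimately show ?thesis using m(2) by (cases "y v $ m > 0") linarith+
      qed
      have "2 / d * \<bar>y v $ m - y w $ m\<bar> \<le> \<bar>y v $ m + y w $ m\<bar> * \<bar>y v $ m - y w $ m\<bar>"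
        using 2 by (intro mult_right_mono) auto
      also have "\<dots> = \<bar>(y v $ m)\<^sup>2 - (y w $ m)\<^sup>2\<bar>"
        by (simp add: power2_eq_square flip: abs_mult) (simp add: algebra_simps)
      finally have "2 / d * \<bar>y v $ m - y w $ m\<bar> \<le> 2 * \<rho> * d" using 1 by linarith
      then have ym: "\<bar>y v $ m - y w $ m\<bar> \<le> \<rho> * d * d" using d by (simp add: field_simps)
      have "dist v w = norm (g *v (v - w))" using g by (simp add: norm_orthogonal_matrix_mult dist_norm)
      also have "\<dots> = norm (y v - y w)" by (simp add: y_def matrix_vector_mult_diff_distrib)
      also have "\<dots> \<le> (\<Sum>k\<in>UNIV. \<bar>(y v - y w) $ k\<bar>)" by (rule norm_le_l1_cart)
      also have "\<dots> = \<bar>y v $ m - y w $ m\<bar> + (\<Sum>k\<in>UNIV - {m}. \<bar>(y v - y w) $ k\<bar>)"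
        by (subst sum.remove[of _ m]) auto
      also have "(\<Sum>k\<in>UNIV - {m}. \<bar>(y v - y w) $ k\<bar>) \<le> (\<Sum>k\<in>UNIV - {m}. \<rho>)"
        using close by (intro sum_mono) auto
      also have "\<dots> \<le> d * \<rho>"
      proof -
        have "real (card (UNIV - {m})) \<le> d" unfolding d_def of_nat_le_iff by (intro card_mono) auto
        then show ?thesis using \<rho> by simp
      qed
      finally have "dist v w \<le> \<rho> * d * d + d * \<rho>" using ym by linarith
      also have "\<dots> \<le> 2 * d^2 * \<rho>" using d \<rho> by (simp add: power2_eq_square)
      also have "\<dots> \<le> C * \<rho>" unfolding C_def using d D \<rho> by (intro mult_right_mono) auto
      finally show ?thesis .
    qed
    moreover have "V \<subseteq> \<Union>P" by (auto simp: P_def)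
    moreover have "finite P" unfolding P_def using fincV by simp
    ultimately show "\<exists>P. finite P \<and> real (card P) \<le> C * (1 / \<rho>) ^ (card (- J) - 1) \<and>
         {v. norm v = 1 \<and> (\<forall>k\<in>J. \<bar>g $ k \<bullet> v\<bar> \<le> a * \<rho>)} \<subseteq> \<Union>P \<and>
         (\<forall>p\<in>P. \<forall>v\<in>p. \<forall>w\<in>p. dist v w \<le> C * \<rho>)"
      unfolding e_def[symmetric] V_def[symmetric]
      by (intro exI[of _ P]) (auto simp: P_def)
  qed
qed

text \<open>The rows are chosen one after the other: a row orthogonal to \<open>j\<close> given ones varies in a sphere
  of dimension \<open>CARD('n) - j - 1\<close>, and these dimensions add up to the exponent.\<close>

lemma orthogonal_group_cover:
  fixes J :: "'n::finite set"
  assumes "a \<ge> 0"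
  shows "\<exists>C>0. \<forall>\<rho> (g::real^'n^'n). 0 < \<rho> \<longrightarrow> \<rho> \<le> 1 \<longrightarrow> orthogonal_matrix g \<longrightarrow>
    (\<exists>F. finite F \<and> real (card F) \<le> C * (1 / \<rho>) ^ (\<Sum>k<card (- J). k) \<and>
       {h. orthogonal_matrix h \<and> (\<forall>i\<in>J. norm (h $ i - g $ i) \<le> a * \<rho>)} \<subseteq> (\<Union>x\<in>F. cball x (C * \<rho>)))"
  using assms
proof (induction "card (- J)" arbitrary: J a)
  case 0
  then have J: "J = UNIV" by auto
  define C where "C = real CARD('n) * a + 1"
  have "{h. orthogonal_matrix h \<and> (\<forall>i\<in>J. norm (h $ i - g $ i) \<le> a * \<rho>)} \<subseteq> (\<Union>x\<in>{g}. cball x (C * \<rho>))"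
    if "0 < \<rho>" for \<rho> and g :: "real^'n^'n"
  proof safe
    fix h :: "real^'n^'n" assume h: "\<forall>i\<in>J. norm (h $ i - g $ i) \<le> a * \<rho>"
    have "norm (h - g) \<le> (\<Sum>i\<in>UNIV. norm ((h - g) $ i))" by (rule norm_le_sum_rows)
    also have "\<dots> \<le> (\<Sum>i\<in>(UNIV::'n set). a * \<rho>)" using h J by (intro sum_mono) auto
    also have "\<dots> \<le> C * \<rho>" using that by (simp add: C_def algebra_simps)
    finally show "h \<in> (\<Union>x\<in>{g}. cball x (C * \<rho>))" by (simp add: dist_norm norm_minus_commute)
  qed
  moreover have "C \<ge> 1" using 0 by (simp add: C_def)
  ultimately show ?case using J by (intro exI[of _ C]) (auto intro!: exI[of _ "{_}"])
next
  case (Suc k)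
  then have "- J \<noteq> {}" by (metis card.empty nat.distinct(1))
  then obtain i where i: "i \<notin> J" by blast
  have "- insert i J = - J - {i}" by auto
  then have k: "k = card (- insert i J)" using i Suc(2) by simp
  obtain C1 where C1: "C1 > 0" and pieces: "\<And>\<rho> g. 0 < \<rho> \<Longrightarrow> \<rho> \<le> 1 \<Longrightarrow> orthogonal_matrix (g :: real^'n^'n) \<Longrightarrow>
       \<exists>P. finite P \<and> real (card P) \<le> C1 * (1 / \<rho>) ^ (card (- J) - 1) \<and>
         {v. norm v = 1 \<and> (\<forall>k\<in>J. \<bar>g $ k \<bullet> v\<bar> \<le> a * \<rho>)} \<subseteq> \<Union>P \<and>
         (\<forall>p\<in>P. \<forall>v\<in>p. \<forall>w\<in>p. dist v w \<le> C1 * \<rho>)"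
  proof (rule sphere_slab_pieces[OF Suc(3) i])
    fix C1 assume "C1 > 0" "\<And>\<rho> g. 0 < \<rho> \<Longrightarrow> \<rho> \<le> 1 \<Longrightarrow> orthogonal_matrix (g :: real^'n^'n) \<Longrightarrow>
       \<exists>P. finite P \<and> real (card P) \<le> C1 * (1 / \<rho>) ^ (card (- J) - 1) \<and>
         {v. norm v = 1 \<and> (\<forall>k\<in>J. \<bar>g $ k \<bullet> v\<bar> \<le> a * \<rho>)} \<subseteq> \<Union>P \<and>
         (\<forall>p\<in>P. \<forall>v\<in>p. \<forall>w\<in>p. dist v w \<le> C1 * \<rho>)"
    then show thesis by (rule that)
  qed
  \<comment> \<open>Two members close to \<open>g\<close> in the rows of \<open>J\<close> differ
    there by up to \<open>2 * a * \<rho>\<close>, and by at most \<open>C1 * \<rho>\<close> in row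
    \<open>i\<close> if they share a piece; one constant serves both kinds of rows.\<close>
  define a' where "a' = max (2 * a) C1"
  have a': "a' \<ge> 0" "2 * a \<le> a'" "C1 \<le> a'" using C1 by (auto simp: a'_def)
  obtain C2 where C2: "C2 > 0" and cov: "\<And>\<rho> g. 0 < \<rho> \<Longrightarrow> \<rho> \<le> 1 \<Longrightarrow> orthogonal_matrix (g::real^'n^'n) \<Longrightarrow>
    (\<exists>F. finite F \<and> real (card F) \<le> C2 * (1 / \<rho>) ^ (\<Sum>k<k. k) \<and>
       {h. orthogonal_matrix h \<and> (\<forall>j\<in>insert i J. norm (h $ j - g $ j) \<le> a' * \<rho>)} \<subseteq> (\<Union>x\<in>F. cball x (C2 * \<rho>)))"
    using Suc(1)[OF k a'(1)] unfolding k[symmetric] by blast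
  define C where "C = max (C1 * C2) C2"
  have C: "C > 0" using C2 by (simp add: C_def)
  have "\<exists>F. finite F \<and> real (card F) \<le> C * (1 / \<rho>) ^ (\<Sum>k<card (- J). k) \<and>
       {h. orthogonal_matrix h \<and> (\<forall>i\<in>J. norm (h $ i - g $ i) \<le> a * \<rho>)} \<subseteq> (\<Union>x\<in>F. cball x (C * \<rho>))"
    if \<rho>: "0 < \<rho>" "\<rho> \<le> 1" and g: "orthogonal_matrix g" for \<rho> and g :: "real^'n^'n"
  proof -
    define T where "T = {h. orthogonal_matrix h \<and> (\<forall>i\<in>J. norm (h $ i - g $ i) \<le> a * \<rho>)}"
    obtain P where P: "finite P" "real (card P) \<le> C1 * (1 / \<rho>) ^ k"
      "{v. norm v = 1 \<and> (\<forall>k\<in>J. \<bar>g $ k \<bullet> v\<bar> \<le> a * \<rho>)} \<subseteq> \<Union>P"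
      "\<forall>p\<in>P. \<forall>v\<in>p. \<forall>w\<in>p. dist v w \<le> C1 * \<rho>"
    proof -
      have "card (- J) - 1 = k" using Suc(2) by simp
      from pieces[OF \<rho> g, unfolded this] show thesis by (elim exE conjE) (rule that)
    qed
    have "\<exists>F. finite F \<and> real (card F) \<le> C2 * (1 / \<rho>) ^ (\<Sum>k<k. k) \<and>
        {h \<in> T. h $ i \<in> p} \<subseteq> (\<Union>x\<in>F. cball x (C2 * \<rho>))" if p: "p \<in> P" for p
    proof (cases "{h \<in> T. h $ i \<in> p} = {}")
      case True
      then show ?thesis using C2 \<rho> by (intro exI[of _ "{}"]) (simp add: True)
    next
      case False
      \<comment> \<open>The induction hypothesis needs an orthogonal centre whose row
        \<open>i\<close> lies in \<open>p\<close>, which \<open>g\<close> need not be; any member of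
        the nonempty class will do.\<close>
      then obtain h0 where h0: "h0 \<in> T" "h0 $ i \<in> p" by blast
      have sub: "{h \<in> T. h $ i \<in> p} \<subseteq> {h. orthogonal_matrix h \<and> (\<forall>j\<in>insert i J. norm (h $ j - h0 $ j) \<le> a' * \<rho>)}"
      proof safe
        fix h assume h: "h \<in> T" "h $ i \<in> p"
        then show "orthogonal_matrix h" by (simp add: T_def)
        have "dist (h $ i) (h0 $ i) \<le> C1 * \<rho>" using P(4) p h h0 by blast
        also have "\<dots> \<le> a' * \<rho>" using a' \<rho> by (intro mult_right_mono) auto
        finally show "norm (h $ i - h0 $ i) \<le> a' * \<rho>" by (simp add: dist_norm)
        fix j assume j: "j \<in> J"
        have "norm (h $ j - g $ j) \<le> a * \<rho>" "norm (h0 $ j - g $ j) \<le> a * \<rho>" using h h0 j by (auto simp: T_def)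
        then have "norm (h $ j - h0 $ j) \<le> 2 * a * \<rho>"
          using norm_triangle_ineq4[of "h $ j - g $ j" "h0 $ j - g $ j"] by simp
        also have "\<dots> \<le> a' * \<rho>" using a' \<rho> by (intro mult_right_mono) auto
        finally show "norm (h $ j - h0 $ j) \<le> a' * \<rho>" .
      qed
      have "orthogonal_matrix h0" using h0 by (simp add: T_def)
      from cov[OF \<rho> this] show ?thesis by (elim exE conjE) (intro exI conjI, assumption+, erule order_trans[OF sub])
    qed
    then have "\<forall>p\<in>P. \<exists>F. finite F \<and> real (card F) \<le> C2 * (1 / \<rho>) ^ (\<Sum>k<k. k) \<and>
        {h \<in> T. h $ i \<in> p} \<subseteq> (\<Union>x\<in>F. cball x (C2 * \<rho>))" by (rule ballI)
    from bchoice[OF this] obtain F where "\<forall>p\<in>P. finite (F p) \<and> real (card (F p)) \<le> C2 * (1 / \<rho>) ^ (\<Sum>k<k. k) \<and>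
        {h \<in> T. h $ i \<in> p} \<subseteq> (\<Union>x\<in>F p. cball x (C2 * \<rho>))" ..
    then have F: "\<And>p. p \<in> P \<Longrightarrow> finite (F p)" "\<And>p. p \<in> P \<Longrightarrow> real (card (F p)) \<le> C2 * (1 / \<rho>) ^ (\<Sum>k<k. k)"
        "\<And>p. p \<in> P \<Longrightarrow> {h \<in> T. h $ i \<in> p} \<subseteq> (\<Union>x\<in>F p. cball x (C2 * \<rho>))"
      by simp_all
    have "T \<subseteq> (\<Union>x\<in>(\<Union>p\<in>P. F p). cball x (C * \<rho>))"
    proof
      fix h assume h: "h \<in> T"
      then have o: "orthogonal_matrix h" by (simp add: T_def)
      \<comment> \<open>Row \<open>i\<close> of \<open>h\<close> is orthogonal to the rows of
        \<open>h\<close> in \<open>J\<close>, hence almost orthogonal to the nearby rows of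
        \<open>g\<close>: this confines it to a slab and lowers the dimension of its sphere.\<close>
      have "\<bar>g $ k \<bullet> h $ i\<bar> \<le> a * \<rho>" if "k \<in> J" for k
      proof -
        have "h $ k \<bullet> h $ i = 0" using orthogonal_matrix_inner_rows[OF o] that i by metis
        then have "\<bar>g $ k \<bullet> h $ i\<bar> = \<bar>(g $ k - h $ k) \<bullet> h $ i\<bar>" by (simp add: inner_diff_left)
        also have "\<dots> \<le> norm (g $ k - h $ k) * norm (h $ i)" by (rule Cauchy_Schwarz_ineq2)
        also have "\<dots> \<le> a * \<rho>" using h that orthogonal_matrix_norm_row[OF o, of i] by (simp add: T_def norm_minus_commute)
        finally show ?thesis .
      qed
      then have "h $ i \<in> \<Union>P" using P(3) orthogonal_matrix_norm_row[OF o, of i] by blast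
      then obtain p where p: "p \<in> P" "h $ i \<in> p" by blast
      then obtain x where x: "x \<in> F p" "h \<in> cball x (C2 * \<rho>)" using F(3)[OF p(1)] h by blast
      have "C2 * \<rho> \<le> C * \<rho>" using \<rho> by (intro mult_right_mono) (auto simp: C_def)
      then have "h \<in> cball x (C * \<rho>)" using x(2) by auto
      then show "h \<in> (\<Union>x\<in>(\<Union>p\<in>P. F p). cball x (C * \<rho>))" using x(1) p(1) by blast
    qed
    moreover have "real (card (\<Union>p\<in>P. F p)) \<le> C * (1 / \<rho>) ^ (\<Sum>k<card (- J). k)"
    proof -
      have "real (card (\<Union>p\<in>P. F p)) \<le> real (\<Sum>p\<in>P. card (F p))"
        unfolding of_nat_le_iff by (rule card_UN_le[OF P(1)])
      also have "\<dots> = (\<Sum>p\<in>P. real (card (F p)))" by simp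
      also have "\<dots> \<le> (\<Sum>p\<in>P. C2 * (1 / \<rho>) ^ (\<Sum>k<k. k))" by (intro sum_mono F(2))
      also have "\<dots> = real (card P) * (C2 * (1 / \<rho>) ^ (\<Sum>k<k. k))" by simp
      also have "\<dots> \<le> (C1 * (1 / \<rho>) ^ k) * (C2 * (1 / \<rho>) ^ (\<Sum>k<k. k))"
        using P(2) C2 \<rho> by (intro mult_right_mono) auto
      also have "\<dots> = (C1 * C2) * ((1 / \<rho>) ^ (\<Sum>k<Suc k. k))"
        by (simp add: power_add)
      also have "\<dots> \<le> C * (1 / \<rho>) ^ (\<Sum>k<Suc k. k)"
        using \<rho> by (intro mult_right_mono) (auto simp: C_def)
      finally show ?thesis unfolding Suc(2)[symmetric] .
    qed
    moreover have "finite (\<Union>p\<in>P. F p)" using P(1) F(1) by blast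
    ultimately show ?thesis unfolding T_def by blast
  qed
  then show ?case using C by (intro exI[of _ C]) blast
qed

lemma sum_lessThan_id: "real (\<Sum>k<n. k) = real n * (real n - 1) / 2"
  by (induction n) (auto simp: field_simps)

text \<open>The set of \<open>g\<close> with \<open>transpose g *v \<xi>\<close> close to a given vector is a neighbourhood of a coset
  of the stabiliser of \<open>\<xi>\<close>, a group of dimension \<open>(CARD('n) - 1) * (CARD('n) - 2) / 2\<close>.\<close>

lemma orthogonal_orbit_measure:
  fixes \<theta> :: "(real^'n^'n) measure"
  assumes sets: "sets \<theta> = sets borel" and t: "t \<ge> 0" and B: "B > 0"
    and ball: "\<And>x r. r > 0 \<Longrightarrow> emeasure \<theta> (cball x r) \<le> ennreal (B * r powr t)"
  defines "d \<equiv> real CARD('n)"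
  obtains C where "C > 0" "\<And>S \<xi> w \<rho>. norm \<xi> = 1 \<Longrightarrow> 0 < \<rho> \<Longrightarrow> \<rho> \<le> 1 \<Longrightarrow>
    S \<subseteq> {g. orthogonal_matrix g \<and> norm (transpose g *v \<xi> - w) \<le> \<rho>} \<Longrightarrow>
    emeasure \<theta> S \<le> ennreal (C * \<rho> powr (t - (d - 1) * (d - 2) / 2))"
proof -
  define i where "i = (undefined :: 'n)"
  obtain C where C: "C > 0" and cov: "\<And>\<rho> (g::real^'n^'n). 0 < \<rho> \<Longrightarrow> \<rho> \<le> 1 \<Longrightarrow> orthogonal_matrix g \<Longrightarrow>
    (\<exists>F. finite F \<and> real (card F) \<le> C * (1 / \<rho>) ^ (\<Sum>k<card (- {i}). k) \<and>
       {h. orthogonal_matrix h \<and> (\<forall>j\<in>{i}. norm (h $ j - g $ j) \<le> 2 * \<rho>)} \<subseteq> (\<Union>x\<in>F. cball x (C * \<rho>)))"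
    using orthogonal_group_cover[of 2 "{i}"] by auto
  define p where "p = (d - 1) * (d - 2) / 2"
  have d1: "d \<ge> 1" unfolding d_def by (simp add: Suc_le_eq)
  have "card (- {i}) = CARD('n) - 1" by (simp add: Compl_eq_Diff_UNIV)
  then have p: "real (\<Sum>k<card (- {i}). k) = p"
    using d1 by (simp only: sum_lessThan_id) (simp add: p_def d_def of_nat_diff algebra_simps)
  show thesis
  proof (rule that)
    show "C * (B * C powr t) > 0" using C B by simp
    fix S :: "(real^'n^'n) set" and \<xi> w :: "real^'n" and \<rho> :: real
    assume \<xi>: "norm \<xi> = 1" and \<rho>: "0 < \<rho>" "\<rho> \<le> 1"
      and S: "S \<subseteq> {g. orthogonal_matrix g \<and> norm (transpose g *v \<xi> - w) \<le> \<rho>}"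
    have "emeasure \<theta> S \<le> ennreal (C * (B * C powr t) * \<rho> powr (t - p))"
    proof (cases "S = {}")
      case False
      then obtain g1 where g1: "g1 \<in> S" by blast
      obtain h where h: "orthogonal_matrix h" "h *v (axis i 1) = \<xi>"
        using orthogonal_matrix_exists_basis[OF \<xi>, of i] .
      \<comment> \<open>Left translation by \<open>transpose h\<close>, an isometry of matrices,
        turns the condition on \<open>transpose g *v \<xi>\<close> into one on row \<open>i\<close>,
        so that the cover for \<open>J = {i}\<close> applies.\<close>
      have row: "(transpose h ** g) $ i = transpose g *v \<xi>" for g
      proof -
        have "(transpose h ** g) $ i = transpose (transpose h ** g) *v axis i 1"
          by (simp add: matrix_vector_mul_component vec_eq_iff inner_axis transpose_def)
        also have "\<dots> = transpose g *v (h *v axis i 1)"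
          by (simp add: matrix_transpose_mul matrix_vector_mul_assoc)
        finally show ?thesis using h by simp
      qed
      have oh: "orthogonal_matrix (transpose h)" using h by simp
      have og: "orthogonal_matrix (transpose h ** g)" if "g \<in> S" for g
        using that oh S by (auto intro: orthogonal_matrix_mul)
      obtain F where F: "finite F" "real (card F) \<le> C * (1 / \<rho>) ^ (\<Sum>k<card (- {i}). k)"
        "{k. orthogonal_matrix k \<and> (\<forall>j\<in>{i}. norm (k $ j - (transpose h ** g1) $ j) \<le> 2 * \<rho>)} \<subseteq> (\<Union>x\<in>F. cball x (C * \<rho>))"
        using cov[OF \<rho> og[OF g1]] by blast
      have "S \<subseteq> (\<Union>x\<in>F. cball (h ** x) (C * \<rho>))"
      proof
        fix g assume g: "g \<in> S"
        have "norm (transpose g *v \<xi> - transpose g1 *v \<xi>) \<le> 2 * \<rho>"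
        proof -
          have "norm (transpose g *v \<xi> - w) \<le> \<rho>" "norm (transpose g1 *v \<xi> - w) \<le> \<rho>" using g g1 S by blast+
          then show ?thesis
            using norm_triangle_ineq4[of "transpose g *v \<xi> - w" "transpose g1 *v \<xi> - w"] by simp
        qed
        then have "norm ((transpose h ** g) $ i - (transpose h ** g1) $ i) \<le> 2 * \<rho>"
          unfolding row .
        then have "transpose h ** g \<in> (\<Union>x\<in>F. cball x (C * \<rho>))"
          using F(3) og[OF g] by blast
        then obtain x where x: "x \<in> F" "dist x (transpose h ** g) \<le> C * \<rho>" by auto
        have "h ** (transpose h ** g) = g"
          using h by (simp add: matrix_mul_assoc orthogonal_matrix_def)
        then have "dist (h ** x) g = norm (h ** (x - transpose h ** g))"
          by (simp add: dist_norm matrix_sub_ldistrib)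
        also have "\<dots> = dist x (transpose h ** g)"
          using h by (simp add: norm_orthogonal_matrix_mult_matrix dist_norm)
        finally have "g \<in> cball (h ** x) (C * \<rho>)" using x(2) by simp
        then show "g \<in> (\<Union>x\<in>F. cball (h ** x) (C * \<rho>))" using x(1) by blast
      qed
      then have "emeasure \<theta> S \<le> emeasure \<theta> (\<Union>x\<in>F. cball (h ** x) (C * \<rho>))"
        using F(1) by (intro emeasure_mono) (auto simp: sets intro!: sets.finite_UN)
      also have "\<dots> \<le> (\<Sum>x\<in>F. emeasure \<theta> (cball (h ** x) (C * \<rho>)))"
        using F(1) by (intro emeasure_subadditive_finite) (auto simp: sets)
      also have "\<dots> \<le> (\<Sum>x\<in>F. ennreal (B * (C * \<rho>) powr t))"
        using C \<rho> by (intro sum_mono ball) simp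
      also have "\<dots> = ennreal (real (card F) * (B * (C * \<rho>) powr t))"
        using B by (simp add: ennreal_of_nat_eq_real_of_nat ennreal_mult)
      also have "\<dots> \<le> ennreal (C * (B * C powr t) * \<rho> powr (t - p))"
      proof (rule ennreal_leI)
        have "(1 / \<rho>) ^ (\<Sum>k<card (- {i}). k) = (1 / \<rho>) powr p"
          unfolding p[symmetric] using \<rho> by (intro powr_realpow[symmetric]) simp
        also have "\<dots> = \<rho> powr (- p)" using \<rho> by (simp add: powr_minus_divide powr_divide)
        finally have "real (card F) * (B * (C * \<rho>) powr t) \<le> (C * \<rho> powr (- p)) * (B * (C powr t * \<rho> powr t))"
          using F(2) B C \<rho> by (intro mult_mono) (auto simp: powr_mult)
        also have "\<dots> = C * (B * C powr t) * (\<rho> powr (- p) * \<rho> powr t)" by (simp add: ac_simps)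
        also have "\<rho> powr (- p) * \<rho> powr t = \<rho> powr (t - p)" by (simp flip: powr_add)
        finally show "real (card F) * (B * (C * \<rho>) powr t) \<le> C * (B * C powr t) * \<rho> powr (t - p)" .
      qed
      finally show ?thesis .
    qed simp
    then show "emeasure \<theta> S \<le> ennreal (C * (B * C powr t) * \<rho> powr (t - (d - 1) * (d - 2) / 2))"
      by (simp add: p_def)
  qed
qed

text \<open>With no row prescribed, the group is covered by about \<rho>^(-(d^2 - d)/2) balls with
  radius of order \<rho>; a larger \<open>t\<close> would make the mass of \<open>K\<close> tend to
  0 with \<rho>.\<close>

lemma orthogonal_group_exponent_le:
  fixes \<theta> :: "(real^'n^'n) measure"
  assumes sets: "sets \<theta> = sets borel" and t: "t \<ge> 0" and B: "B > 0"
    and ball: "\<And>x r. r > 0 \<Longrightarrow> emeasure \<theta> (cball x r) \<le> ennreal (B * r powr t)"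
    and mass: "emeasure \<theta> K \<noteq> 0" and K: "K \<subseteq> {g. orthogonal_matrix g}"
  defines "d \<equiv> real CARD('n)"
  shows "t \<le> (d^2 - d) / 2"
proof (rule ccontr)
  assume neg: "\<not> ?thesis"
  define p where "p = (d^2 - d) / 2"
  have tp: "t - p > 0" using neg by (simp add: p_def)
  obtain C where C: "C > 0" and cov: "\<And>\<rho> (g::real^'n^'n). 0 < \<rho> \<Longrightarrow> \<rho> \<le> 1 \<Longrightarrow> orthogonal_matrix g \<Longrightarrow>
    (\<exists>F. finite F \<and> real (card F) \<le> C * (1 / \<rho>) ^ (\<Sum>k<card (- {} :: 'n set). k) \<and>
       {h. orthogonal_matrix h \<and> (\<forall>j\<in>{}. norm (h $ j - g $ j) \<le> 0 * \<rho>)} \<subseteq> (\<Union>x\<in>F. cball x (C * \<rho>)))"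
    using orthogonal_group_cover[where J = "{} :: 'n set" and a = 0, OF order_refl] by blast
  have p: "real (\<Sum>k<card (- {} :: 'n set). k) = p"
    by (simp only: sum_lessThan_id) (simp add: p_def d_def power2_eq_square algebra_simps)
  define c where "c = C * (B * C powr t)"
  have c: "c > 0" using C B by (simp add: c_def)
  have le: "emeasure \<theta> K \<le> ennreal (c * \<rho> powr (t - p))" if \<rho>: "0 < \<rho>" "\<rho> \<le> 1" for \<rho>
  proof -
    obtain F where F: "finite F" "real (card F) \<le> C * (1 / \<rho>) ^ (\<Sum>k<card (- {} :: 'n set). k)"
      "{h :: real^'n^'n. orthogonal_matrix h} \<subseteq> (\<Union>x\<in>F. cball x (C * \<rho>))"
      using cov[OF \<rho> orthogonal_matrix_id] by auto
    have "emeasure \<theta> K \<le> emeasure \<theta> (\<Union>x\<in>F. cball x (C * \<rho>))"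
      using F K by (intro emeasure_mono) (auto simp: sets intro!: sets.finite_UN)
    also have "\<dots> \<le> (\<Sum>x\<in>F. emeasure \<theta> (cball x (C * \<rho>)))"
      using F(1) by (intro emeasure_subadditive_finite) (auto simp: sets)
    also have "\<dots> \<le> (\<Sum>x\<in>F. ennreal (B * (C * \<rho>) powr t))"
      using C \<rho> by (intro sum_mono ball) simp
    also have "\<dots> = ennreal (real (card F) * (B * (C * \<rho>) powr t))"
      using B by (simp add: ennreal_of_nat_eq_real_of_nat ennreal_mult)
    also have "\<dots> \<le> ennreal (c * \<rho> powr (t - p))"
    proof (rule ennreal_leI)
      have "(1 / \<rho>) ^ (\<Sum>k<card (- {} :: 'n set). k) = (1 / \<rho>) powr p"
        unfolding p[symmetric] using \<rho> by (intro powr_realpow[symmetric]) simp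
      also have "\<dots> = \<rho> powr (- p)" using \<rho> by (simp add: powr_minus_divide powr_divide)
      finally have "real (card F) * (B * (C * \<rho>) powr t) \<le> (C * \<rho> powr (- p)) * (B * (C powr t * \<rho> powr t))"
        using F(2) B C \<rho> by (intro mult_mono) (auto simp: powr_mult)
      also have "\<dots> = C * (B * C powr t) * (\<rho> powr (- p) * \<rho> powr t)" by (simp add: ac_simps)
      also have "\<rho> powr (- p) * \<rho> powr t = \<rho> powr (t - p)" by (simp flip: powr_add)
      finally show "real (card F) * (B * (C * \<rho>) powr t) \<le> c * \<rho> powr (t - p)" unfolding c_def .
    qed
    finally show ?thesis .
  qed
  have "emeasure \<theta> K \<le> 0 + ennreal e" if "e > 0" for e
  proof -
    define \<rho> where "\<rho> = min 1 ((e / c) powr (1 / (t - p)))"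
    have \<rho>: "0 < \<rho>" "\<rho> \<le> 1" using that c by (auto simp: \<rho>_def)
    have "\<rho> powr (t - p) \<le> ((e / c) powr (1 / (t - p))) powr (t - p)"
      using tp \<rho> by (intro powr_mono2) (auto simp: \<rho>_def)
    also have "\<dots> = e / c" using tp that c by (simp add: powr_powr)
    finally have "c * \<rho> powr (t - p) \<le> e" using c by (simp add: field_simps)
    then show ?thesis using le[OF \<rho>] by (simp add: order_trans[OF _ ennreal_leI])
  qed
  then have "emeasure \<theta> K \<le> 0" by (rule ennreal_le_epsilon)
  then show False using mass by simp
qed

section \<open>Gaussians and polar coordinates\<close>

lemma fourier_transform_cis: "fourier_transform \<mu> \<xi> = (LINT x|\<mu>. cis (- (2 * pi * (\<xi> \<bullet> x))))"
  unfolding fourier_transform_def cis_conv_exp by (simp add: mult_ac)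

lemma borel_measurable_cis [measurable]:
  assumes [measurable]: "f \<in> borel_measurable M"
  shows "(\<lambda>x. cis (f x)) \<in> borel_measurable M"
proof -
  have "cis \<in> borel_measurable borel"
    by (intro borel_measurable_continuous_onI) (simp add: cis_conv_exp continuous_intros)
  then show ?thesis by measurable
qed

lemma borel_measurable_fourier_transform [measurable]:
  fixes \<mu> :: "'a::euclidean_space measure"
  assumes "sigma_finite_measure \<mu>" and [measurable_cong]: "sets \<mu> = sets borel"
  shows "fourier_transform \<mu> \<in> borel_measurable borel"
proof -
  interpret sigma_finite_measure \<mu> by fact
  show ?thesis unfolding fourier_transform_cis by measurable
qed

lemma norm_fourier_transform_le:
  assumes "finite_measure \<mu>" "sets \<mu> = sets borel"
  shows "norm (fourier_transform \<mu> \<xi>) \<le> measure \<mu> UNIV"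
proof -
  interpret finite_measure \<mu> by fact
  have sp: "space \<mu> = UNIV" using assms(2) by (metis sets_eq_imp_space_eq space_borel)
  note assms(2)[measurable_cong]
  have "norm (fourier_transform \<mu> \<xi>) \<le> (LINT x|\<mu>. norm (cis (- (2 * pi * (\<xi> \<bullet> x)))))"
    unfolding fourier_transform_cis by (rule integral_norm_bound)
  then show ?thesis by (simp add: sp)
qed

lemma exp_scaleR_cis: "exp r *\<^sub>R cis t = exp (of_real r + \<i> * of_real t)"
  by (simp add: exp_add cis_conv_exp scaleR_conv_of_real exp_of_real)

text \<open>The characteristic function of the standard normal distribution, after the substitution
  x = c y with c = sqrt (2 pi), which turns x^2/2 into pi y^2 and the normalising factor into
  1.\<close>

lemma gaussian_fourier_real:
  fixes z :: real
  shows "has_bochner_integral lborel (\<lambda>y. exp (of_real (- pi * y\<^sup>2) + \<i> * of_real (2 * pi * z * y))) (of_real (exp (- pi * z\<^sup>2)) :: complex)"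
proof -
  define c where "c = sqrt (2 * pi)"
  have c: "c > 0" "c * c = 2 * pi" by (auto simp: c_def)
  define f where "f x = std_normal_density x *\<^sub>R cis (c * z * x)" for x
  have [measurable]: "f \<in> borel_measurable borel" unfolding f_def by measurable
  have "integrable lborel std_normal_density" using integrable_std_normal_moment[of 0] by simp
  then have int: "integrable lborel f"
    by (rule Bochner_Integration.integrable_bound) (auto simp: f_def)
  have "of_real (exp (- pi * z\<^sup>2)) = char std_normal_distribution (c * z)"
    using c by (simp add: char_std_normal_distribution power_mult_distrib power2_eq_square)
  also have "\<dots> = integral\<^sup>L lborel f"
    unfolding char_def f_def cis_conv_exp by (subst integral_density) auto
  finally have "has_bochner_integral lborel f (of_real (exp (- pi * z\<^sup>2)))"
    using int by (simp add: has_bochner_integral_iff)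
  then have "has_bochner_integral lborel (\<lambda>y. f (0 + c * y)) (of_real (exp (- pi * z\<^sup>2)) /\<^sub>R \<bar>c\<bar>)"
    using c(1) lborel_has_bochner_integral_real_affine_iff[of c f "of_real (exp (- pi * z\<^sup>2))" 0] by simp
  then have "has_bochner_integral lborel (\<lambda>y. c *\<^sub>R f (0 + c * y)) (c *\<^sub>R (of_real (exp (- pi * z\<^sup>2)) /\<^sub>R \<bar>c\<bar>))"
    by (intro has_bochner_integral_scaleR_right)
  moreover have "c *\<^sub>R f (0 + c * y) = exp (of_real (- pi * y\<^sup>2) + \<i> * of_real (2 * pi * z * y))" for y
  proof -
    have 1: "(c * y)\<^sup>2 / 2 = pi * y\<^sup>2" using c(2) by (simp add: power_mult_distrib power2_eq_square)
    have 2: "c * z * (c * y) = 2 * pi * z * y" using c(2) by (metis mult.assoc mult.commute mult.left_commute)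
    have "c * std_normal_density (c * y) = exp (- (pi * y\<^sup>2))"
      using c(1) 1 by (simp add: std_normal_density_def c_def[symmetric])
    then have "c *\<^sub>R f (0 + c * y) = exp (- pi * y\<^sup>2) *\<^sub>R cis (2 * pi * z * y)"
      unfolding f_def by (simp add: 2)
    then show ?thesis by (simp only: exp_scaleR_cis)
  qed
  moreover have "c *\<^sub>R (of_real (exp (- pi * z\<^sup>2)) /\<^sub>R \<bar>c\<bar>) = (of_real (exp (- pi * z\<^sup>2)) :: complex)"
    using c(1) by simp
  ultimately show ?thesis by simp
qed

lemma norm_sq_Basis: "(norm (x :: 'a::euclidean_space))\<^sup>2 = (\<Sum>b\<in>Basis. (x \<bullet> b)\<^sup>2)"
  unfolding power2_norm_eq_inner by (subst euclidean_inner) (simp add: power2_eq_square)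

lemma gaussian_integral:
  "(\<integral>\<^sup>+(x::'a::euclidean_space). ennreal (exp (- pi * (norm x)\<^sup>2)) \<partial>lborel) = 1"
proof -
  have 1: "(\<integral>\<^sup>+y. ennreal (exp (- pi * y\<^sup>2)) \<partial>lborel) = 1"
  proof -
    have h: "has_bochner_integral lborel (\<lambda>y. complex_of_real (exp (- pi * y\<^sup>2))) 1"
      using gaussian_fourier_real[of 0] by (simp flip: exp_of_real)
    have "has_bochner_integral lborel (\<lambda>y. exp (- pi * y\<^sup>2)) (1::real)"
      using has_bochner_integral_bounded_linear[OF bounded_linear_Re h] by simp
    then show ?thesis by (subst nn_integral_eq_integral) (auto simp: has_bochner_integral_iff)
  qed
  have "exp (- pi * (norm x)\<^sup>2) = (\<Prod>b\<in>Basis. exp (- pi * (x \<bullet> b)\<^sup>2))" for x :: 'a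
    by (simp add: norm_sq_Basis sum_distrib_left flip: exp_sum sum_negf)
  then have "(\<integral>\<^sup>+(x::'a). ennreal (exp (- pi * (norm x)\<^sup>2)) \<partial>lborel) =
      (\<integral>\<^sup>+(x::'a). (\<Prod>b\<in>Basis. ennreal (exp (- pi * (x \<bullet> b)\<^sup>2))) \<partial>lborel)"
    by (simp add: prod_ennreal)
  also have "\<dots> = (\<Prod>b\<in>(Basis::'a set). \<integral>\<^sup>+y. ennreal (exp (- pi * y\<^sup>2)) \<partial>lborel)"
    by (rule nn_integral_lborel_prod[of "\<lambda>_ y. ennreal (exp (- pi * y\<^sup>2))"]) auto
  also have "\<dots> = 1" unfolding 1 by simp
  finally show ?thesis .
qed

text \<open>The factor \<open>pi\<close> in the exponent makes the total mass 1 and the density its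
  own Fourier transform, so that no constants enter the convolution arguments.\<close>

definition gaussian_measure :: "'a::euclidean_space measure" where
  "gaussian_measure = density lborel (\<lambda>x. ennreal (exp (- pi * (norm x)\<^sup>2)))"

lemma sets_gaussian_measure [simp, measurable_cong]: "sets gaussian_measure = sets borel"
  by (simp add: gaussian_measure_def)

lemma space_gaussian_measure [simp]: "space gaussian_measure = UNIV"
  by (simp add: gaussian_measure_def)

lemma prob_space_gaussian_measure: "prob_space gaussian_measure"
  by (rule prob_spaceI) (use gaussian_integral in \<open>simp add: gaussian_measure_def emeasure_density\<close>)

lemma gaussian_measure_fourier:
  fixes x :: "'a::euclidean_space"
  shows "(LINT y|gaussian_measure. cis (2 * pi * (x \<bullet> y))) = of_real (exp (- pi * (norm x)\<^sup>2))"
proof -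
  interpret product_sigma_finite "\<lambda>_ :: 'a. lborel :: real measure" by standard
  define E where "E b y = exp (of_real (- pi * y\<^sup>2) + \<i> * of_real (2 * pi * (x \<bullet> b) * y))" for b :: 'a and y :: real
  have Em: "E b \<in> borel_measurable borel" for b
    unfolding E_def by (intro borel_measurable_continuous_onI continuous_intros)
  have prod: "exp (- pi * (norm y)\<^sup>2) *\<^sub>R cis (2 * pi * (x \<bullet> y)) = (\<Prod>b\<in>Basis. E b (y \<bullet> b))" for y
  proof -
    have "(\<Prod>b\<in>Basis. E b (y \<bullet> b)) = exp (\<Sum>b\<in>Basis. of_real (- pi * (y \<bullet> b)\<^sup>2) + \<i> * of_real (2 * pi * (x \<bullet> b) * (y \<bullet> b)))"
      unfolding E_def by (rule exp_sum[symmetric]) simp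
    also have "(\<Sum>b\<in>Basis. of_real (- pi * (y \<bullet> b)\<^sup>2) + \<i> * of_real (2 * pi * (x \<bullet> b) * (y \<bullet> b))) =
        of_real (- pi * (\<Sum>b\<in>Basis. (y \<bullet> b)\<^sup>2)) + \<i> * of_real (2 * pi * (\<Sum>b\<in>Basis. (x \<bullet> b) * (y \<bullet> b)))"
      by (simp add: sum.distrib sum_subtractf sum_distrib_left sum_negf mult.assoc)
    also have "(\<Sum>b\<in>Basis. (x \<bullet> b) * (y \<bullet> b)) = x \<bullet> y" by (simp add: euclidean_inner[of x y])
    also have "(\<Sum>b\<in>Basis. (y \<bullet> b)\<^sup>2) = (norm y)\<^sup>2" by (simp add: norm_sq_Basis)
    finally show ?thesis by (simp only: exp_scaleR_cis mult.assoc)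
  qed
  have "(LINT y|gaussian_measure. cis (2 * pi * (x \<bullet> y))) = (LINT y|lborel. exp (- pi * (norm y)\<^sup>2) *\<^sub>R cis (2 * pi * (x \<bullet> y)))"
    unfolding gaussian_measure_def by (subst integral_density) auto
  also have "\<dots> = (LINT y|lborel. (\<Prod>b\<in>Basis. E b (y \<bullet> b)))" by (simp only: prod)
  also have "\<dots> = (LINT f|(\<Pi>\<^sub>M b\<in>(Basis::'a set). lborel). (\<Prod>b\<in>Basis. E b ((\<Sum>b\<in>Basis. f b *\<^sub>R b) \<bullet> b)))"
    unfolding lborel_eq[where 'a = 'a]
  proof (rule integral_distr)
    show "(\<lambda>y::'a. \<Prod>b\<in>Basis. E b (y \<bullet> b)) \<in> borel_measurable borel"
      using Em by measurable
  qed measurable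
  also have "\<dots> = (LINT f|(\<Pi>\<^sub>M b\<in>(Basis::'a set). lborel). (\<Prod>b\<in>Basis. E b (f b)))"
    by (intro Bochner_Integration.integral_cong refl prod.cong) simp
  also have "\<dots> = (\<Prod>b\<in>(Basis::'a set). LINT y|lborel. E b y)"
    using gaussian_fourier_real unfolding E_def has_bochner_integral_iff by (intro product_integral_prod) auto
  also have "\<dots> = (\<Prod>b\<in>Basis. of_real (exp (- pi * (x \<bullet> b)\<^sup>2)))"
    unfolding E_def using gaussian_fourier_real[THEN has_bochner_integral_integral_eq] by simp
  also have "\<dots> = of_real (exp (- pi * (norm x)\<^sup>2))"
    by (simp add: norm_sq_Basis sum_distrib_left flip: of_real_prod exp_sum sum_negf)
  finally show ?thesis .
qed

lemma Fubini_bounded: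
  fixes f :: "'a \<Rightarrow> 'b \<Rightarrow> 'c::{banach, second_countable_topology}"
  assumes "finite_measure M" "finite_measure N"
    and f: "case_prod f \<in> borel_measurable (M \<Otimes>\<^sub>M N)"
    and B: "\<And>x y. norm (f x y) \<le> B"
  shows "(LINT y|N. LINT x|M. f x y) = (LINT x|M. LINT y|N. f x y)"
proof -
  interpret M: finite_measure M by fact
  interpret N: finite_measure N by fact
  interpret pair_sigma_finite M N ..
  interpret P: finite_measure "M \<Otimes>\<^sub>M N" by (rule finite_measure_pair_measure) fact+
  have "integrable (M \<Otimes>\<^sub>M N) (case_prod f)"
    by (rule P.integrable_const_bound[of _ B]) (use f B in auto)
  then show ?thesis by (rule Fubini_integral)
qed

text \<open>The variance of \<open>norm (f x)\<close> is nonnegative; the uniform bound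
  \<open>B\<close> secures integrability.\<close>

lemma (in prob_space) norm_integral_sq_le:
  fixes f :: "'a \<Rightarrow> complex"
  assumes [measurable]: "f \<in> borel_measurable M" and B: "\<And>x. norm (f x) \<le> B"
  shows "ennreal ((norm (LINT x|M. f x))\<^sup>2) \<le> (\<integral>\<^sup>+x. ennreal ((norm (f x))\<^sup>2) \<partial>M)"
proof -
  have B0: "B \<ge> 0" using B norm_ge_zero order_trans by blast
  have i1: "integrable M (\<lambda>x. norm (f x))" by (rule integrable_const_bound[of _ B]) (use B in auto)
  have i2: "integrable M (\<lambda>x. (norm (f x))\<^sup>2)"
    by (rule integrable_const_bound[of _ "B\<^sup>2"]) (use B B0 in \<open>auto intro!: power_mono\<close>)
  define a where "a = (LINT x|M. norm (f x))"
  have "0 \<le> (LINT x|M. (norm (f x) - a)\<^sup>2)" by simp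
  also have "(LINT x|M. (norm (f x) - a)\<^sup>2) = (LINT x|M. (norm (f x))\<^sup>2 - 2 * a * norm (f x) + a\<^sup>2)"
    by (simp add: power2_diff algebra_simps)
  also have "\<dots> = (LINT x|M. (norm (f x))\<^sup>2) - 2 * a * a + a\<^sup>2"
    using i1 i2 by (simp add: a_def prob_space)
  finally have "a\<^sup>2 \<le> (LINT x|M. (norm (f x))\<^sup>2)" by (simp add: power2_eq_square)
  moreover have "(norm (LINT x|M. f x))\<^sup>2 \<le> a\<^sup>2"
    unfolding a_def by (intro power_mono integral_norm_bound) simp
  ultimately have "ennreal ((norm (LINT x|M. f x))\<^sup>2) \<le> ennreal (LINT x|M. (norm (f x))\<^sup>2)"
    by (intro ennreal_leI) linarith
  also have "\<dots> = (\<integral>\<^sup>+x. ennreal ((norm (f x))\<^sup>2) \<partial>M)"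
    using i2 by (intro nn_integral_eq_integral[symmetric]) auto
  finally show ?thesis .
qed

text \<open>Multiplying \<open>\<mu>\<close> by a Gaussian convolves its transform with the same Gaussian.\<close>

lemma fourier_gaussian_smoothing:
  fixes \<mu> :: "'a::euclidean_space measure"
  assumes fin: "finite_measure \<mu>" and s [measurable_cong]: "sets \<mu> = sets borel"
  shows "ennreal ((norm (fourier_transform (density \<mu> (\<lambda>x. ennreal (exp (- pi * (norm x)\<^sup>2)))) \<xi>))\<^sup>2)
    \<le> (\<integral>\<^sup>+x. ennreal ((norm (fourier_transform \<mu> x))\<^sup>2) * ennreal (exp (- pi * (norm (x - \<xi>))\<^sup>2)) \<partial>lborel)"
proof -
  interpret \<mu>: finite_measure \<mu> by fact
  interpret G: prob_space "gaussian_measure :: 'a measure" by (rule prob_space_gaussian_measure)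
  note meas = borel_measurable_fourier_transform[OF \<mu>.sigma_finite_measure_axioms s, measurable]
  have "fourier_transform (density \<mu> (\<lambda>x. ennreal (exp (- pi * (norm x)\<^sup>2)))) \<xi> =
      (LINT x|\<mu>. exp (- pi * (norm x)\<^sup>2) *\<^sub>R cis (- (2 * pi * (\<xi> \<bullet> x))))"
    unfolding fourier_transform_cis by (subst integral_density) auto
  \<comment> \<open>The Gaussian weight is itself written as an integral of characters, so that
    Fubini turns the multiplication into an average of translates of the transform.\<close>
  also have "\<dots> = (LINT x|\<mu>. (LINT y|gaussian_measure. cis (- (2 * pi * ((\<xi> + y) \<bullet> x)))))"
  proof (intro Bochner_Integration.integral_cong refl)
    fix x :: 'a
    have "(LINT y|gaussian_measure. cis (- (2 * pi * ((\<xi> + y) \<bullet> x)))) =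
        (LINT y|gaussian_measure. cis (- (2 * pi * (\<xi> \<bullet> x))) * cis (2 * pi * ((- x) \<bullet> y)))"
      by (intro Bochner_Integration.integral_cong refl) (simp add: cis_mult inner_add_left algebra_simps inner_commute)
    also have "\<dots> = cis (- (2 * pi * (\<xi> \<bullet> x))) * of_real (exp (- pi * (norm (- x))\<^sup>2))"
      by (simp only: integral_mult_right_zero gaussian_measure_fourier)
    finally show "exp (- pi * (norm x)\<^sup>2) *\<^sub>R cis (- (2 * pi * (\<xi> \<bullet> x))) = (LINT y|gaussian_measure. cis (- (2 * pi * ((\<xi> + y) \<bullet> x))))"
      by (simp add: scaleR_conv_of_real)
  qed
  also have "\<dots> = (LINT y|gaussian_measure. (LINT x|\<mu>. cis (- (2 * pi * ((\<xi> + y) \<bullet> x)))))"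
    by (rule Fubini_bounded[where B = 1, symmetric, OF \<mu>.finite_measure_axioms G.finite_measure_axioms]) auto
  also have "\<dots> = (LINT y|gaussian_measure. fourier_transform \<mu> (\<xi> + y))"
    by (simp add: fourier_transform_cis)
  finally have eq: "fourier_transform (density \<mu> (\<lambda>x. ennreal (exp (- pi * (norm x)\<^sup>2)))) \<xi> =
      (LINT y|gaussian_measure. fourier_transform \<mu> (\<xi> + y))" .
  have "ennreal ((norm (LINT y|gaussian_measure. fourier_transform \<mu> (\<xi> + y)))\<^sup>2)
      \<le> (\<integral>\<^sup>+y. ennreal ((norm (fourier_transform \<mu> (\<xi> + y)))\<^sup>2) \<partial>gaussian_measure)"
    by (rule G.norm_integral_sq_le[where B = "measure \<mu> UNIV"]) (use norm_fourier_transform_le[OF fin s] in auto)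
  also have "\<dots> = (\<integral>\<^sup>+y. ennreal (exp (- pi * (norm y)\<^sup>2)) * ennreal ((norm (fourier_transform \<mu> (\<xi> + y)))\<^sup>2) \<partial>lborel)"
    unfolding gaussian_measure_def by (rule nn_integral_density) auto
  also have "\<dots> = (\<integral>\<^sup>+y. (\<lambda>x. ennreal ((norm (fourier_transform \<mu> x))\<^sup>2) * ennreal (exp (- pi * (norm (x - \<xi>))\<^sup>2))) (\<xi> + y) \<partial>lborel)"
    by (simp add: mult.commute)
  also have "\<dots> = (\<integral>\<^sup>+x. ennreal ((norm (fourier_transform \<mu> x))\<^sup>2) * ennreal (exp (- pi * (norm (x - \<xi>))\<^sup>2)) \<partial>distr lborel borel ((+) \<xi>))"
    by (rule nn_integral_distr[symmetric]) auto
  finally show ?thesis unfolding eq lborel_distr_plus .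
qed

section \<open>Fourier energy at a given scale\<close>

lemma nn_integral_lborel_scale:
  fixes f :: "'a::euclidean_space \<Rightarrow> ennreal"
  assumes [measurable]: "f \<in> borel_measurable borel" and c: "c > 0"
  shows "(\<integral>\<^sup>+x. f x \<partial>lborel) = ennreal (c ^ DIM('a)) * (\<integral>\<^sup>+x. f (c *\<^sub>R x) \<partial>lborel)"
proof -
  have "(\<integral>\<^sup>+x. f x \<partial>lborel) = (\<integral>\<^sup>+x. f x \<partial>density (distr lborel borel (\<lambda>x. 0 + c *\<^sub>R x)) (\<lambda>_. ennreal (\<bar>c\<bar> ^ DIM('a))))"
    using c lborel_affine[of c "0::'a"] by simp
  also have "\<dots> = ennreal (c ^ DIM('a)) * (\<integral>\<^sup>+x. f (c *\<^sub>R x) \<partial>lborel)"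
    using c by (simp add: nn_integral_density nn_integral_distr nn_integral_cmult)
  finally show ?thesis .
qed

text \<open>The squared modulus of the transform is a double integral of characters in y - x, and
  integrating these against a Gaussian in frequency gives a Gaussian in space. The identity is used
  both ways: from ball masses to Fourier integrals, and from Fourier integrals to average ball
  masses.\<close>

lemma gaussian_energy:
  fixes m :: "'a::euclidean_space measure"
  assumes "prob_space m" and s [measurable_cong]: "sets m = sets borel" and R: "R > 0"
  shows "(\<integral>\<^sup>+\<xi>. ennreal ((norm (fourier_transform m \<xi>))\<^sup>2) * ennreal (exp (- pi * (norm \<xi> / R)\<^sup>2)) \<partial>lborel)
    = (\<integral>\<^sup>+x. (\<integral>\<^sup>+y. ennreal (R ^ DIM('a) * exp (- pi * (R * dist x y)\<^sup>2)) \<partial>m) \<partial>m)"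
proof -
  interpret m: prob_space m by fact
  interpret G: prob_space "gaussian_measure :: 'a measure" by (rule prob_space_gaussian_measure)
  note meas = borel_measurable_fourier_transform[OF m.sigma_finite_measure_axioms s, measurable]
  let ?F = "\<lambda>\<eta>. fourier_transform m (R *\<^sub>R \<eta>)"
  have sq: "complex_of_real ((norm (?F \<eta>))\<^sup>2) = (LINT x|m. LINT y|m. cis (2 * pi * (R *\<^sub>R (y - x) \<bullet> \<eta>)))" for \<eta>
  proof -
    have "cnj (?F \<eta>) = (LINT y|m. cnj (cis (- (2 * pi * (R *\<^sub>R \<eta> \<bullet> y)))))"
      unfolding fourier_transform_cis by (rule Bochner_Integration.integral_cnj[symmetric])
    then have cnj: "cnj (?F \<eta>) = (LINT y|m. cis (2 * pi * (R *\<^sub>R \<eta> \<bullet> y)))"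
      by (simp only: cis_cnj minus_minus)
    have "complex_of_real ((norm (?F \<eta>))\<^sup>2) = ?F \<eta> * cnj (?F \<eta>)" by (rule complex_norm_square)
    also have "\<dots> = ?F \<eta> * (LINT y|m. cis (2 * pi * (R *\<^sub>R \<eta> \<bullet> y)))" unfolding cnj ..
    also have "\<dots> = (LINT x|m. LINT y|m. cis (- (2 * pi * (R *\<^sub>R \<eta> \<bullet> x))) * cis (2 * pi * (R *\<^sub>R \<eta> \<bullet> y)))"
      unfolding fourier_transform_cis by simp
    also have "\<dots> = (LINT x|m. LINT y|m. cis (2 * pi * (R *\<^sub>R (y - x) \<bullet> \<eta>)))"
      by (intro Bochner_Integration.integral_cong refl) (simp add: cis_mult inner_diff_left algebra_simps inner_commute)
    finally show ?thesis .
  qed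
  have e1: "norm (LINT y|m. cis (2 * pi * (R *\<^sub>R (y - x) \<bullet> \<eta>))) \<le> 1" for x \<eta>
  proof -
    have "norm (LINT y|m. cis (2 * pi * (R *\<^sub>R (y - x) \<bullet> \<eta>))) \<le> (LINT y|m. norm (cis (2 * pi * (R *\<^sub>R (y - x) \<bullet> \<eta>))))"
      by (rule integral_norm_bound)
    then show ?thesis by (simp add: m.prob_space)
  qed
  define k where "k x y = exp (- pi * (R * dist x y)\<^sup>2)" for x y :: 'a
  have "complex_of_real (LINT \<eta>|gaussian_measure. (norm (?F \<eta>))\<^sup>2) = (LINT \<eta>|gaussian_measure. complex_of_real ((norm (?F \<eta>))\<^sup>2))"
    by (rule integral_complex_of_real[symmetric])
  also have "\<dots> = (LINT \<eta>|gaussian_measure. LINT x|m. LINT y|m. cis (2 * pi * (R *\<^sub>R (y - x) \<bullet> \<eta>)))"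
    by (simp only: sq)
  also have "\<dots> = (LINT x|m. LINT \<eta>|gaussian_measure. LINT y|m. cis (2 * pi * (R *\<^sub>R (y - x) \<bullet> \<eta>)))"
    by (rule Fubini_bounded[where B = 1, OF m.finite_measure_axioms G.finite_measure_axioms])
      (use e1 in \<open>auto simp: case_prod_beta\<close>)
  also have "\<dots> = (LINT x|m. LINT y|m. LINT \<eta>|gaussian_measure. cis (2 * pi * (R *\<^sub>R (y - x) \<bullet> \<eta>)))"
    by (intro Bochner_Integration.integral_cong refl
        Fubini_bounded[where B = 1, OF m.finite_measure_axioms G.finite_measure_axioms]) auto
  also have "\<dots> = (LINT x|m. LINT y|m. complex_of_real (k x y))"
  proof -
    have "(norm (R *\<^sub>R (y - x)))\<^sup>2 = (R * dist x y)\<^sup>2" for x y :: 'a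
      using R by (simp add: dist_norm norm_minus_commute)
    then show ?thesis by (simp only: gaussian_measure_fourier k_def)
  qed
  also have "\<dots> = complex_of_real (LINT x|m. LINT y|m. k x y)"
    by (simp only: integral_complex_of_real)
  finally have main: "(LINT \<eta>|gaussian_measure. (norm (?F \<eta>))\<^sup>2) = (LINT x|m. LINT y|m. k x y)"
    by (simp only: of_real_eq_iff)
  have k01: "0 \<le> k x y" "k x y \<le> 1" for x y by (auto simp: k_def)
  have km [measurable]: "(\<lambda>p. k (fst p) (snd p)) \<in> borel_measurable (m \<Otimes>\<^sub>M m)" unfolding k_def by measurable
  have int_k: "integrable m (k x)" for x
    by (rule m.integrable_const_bound[of _ 1]) (use k01 in \<open>auto simp: k_def[abs_def]\<close>)
  have Ik: "ennreal (LINT x|m. LINT y|m. k x y) = (\<integral>\<^sup>+x. (\<integral>\<^sup>+y. ennreal (k x y) \<partial>m) \<partial>m)"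
  proof -
    have "ennreal (LINT y|m. k x y) = (\<integral>\<^sup>+y. ennreal (k x y) \<partial>m)" for x
      using int_k k01 by (intro nn_integral_eq_integral[symmetric]) auto
    moreover have "integrable m (\<lambda>x. LINT y|m. k x y)"
    proof (rule m.integrable_const_bound[of _ 1])
      show "AE x in m. norm (LINT y|m. k x y) \<le> 1"
      proof (rule AE_I2)
        fix x
        have "(LINT y|m. k x y) \<le> (LINT y|m. 1)" using k01 int_k by (intro integral_mono) auto
        then show "norm (LINT y|m. k x y) \<le> 1" using k01 by (simp add: m.prob_space integral_nonneg_AE)
      qed
      show "(\<lambda>x. LINT y|m. k x y) \<in> borel_measurable m" unfolding k_def by measurable
    qed
    then have "ennreal (LINT x|m. LINT y|m. k x y) = (\<integral>\<^sup>+x. ennreal (LINT y|m. k x y) \<partial>m)"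
      using k01 by (intro nn_integral_eq_integral[symmetric]) (auto intro!: AE_I2 integral_nonneg)
    ultimately show ?thesis by simp
  qed
  have "(\<integral>\<^sup>+\<xi>. ennreal ((norm (fourier_transform m \<xi>))\<^sup>2) * ennreal (exp (- pi * (norm \<xi> / R)\<^sup>2)) \<partial>lborel) =
      ennreal (R ^ DIM('a)) * (\<integral>\<^sup>+\<eta>. ennreal ((norm (?F \<eta>))\<^sup>2) * ennreal (exp (- pi * (norm (R *\<^sub>R \<eta>) / R)\<^sup>2)) \<partial>lborel)"
    by (rule nn_integral_lborel_scale[OF _ R]) measurable
  also have "(\<integral>\<^sup>+\<eta>. ennreal ((norm (?F \<eta>))\<^sup>2) * ennreal (exp (- pi * (norm (R *\<^sub>R \<eta>) / R)\<^sup>2)) \<partial>lborel) =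
      (\<integral>\<^sup>+\<eta>. ennreal ((norm (?F \<eta>))\<^sup>2) \<partial>gaussian_measure)"
    unfolding gaussian_measure_def using R by (subst nn_integral_density) (auto simp: mult.commute)
  also have "\<dots> = ennreal (LINT \<eta>|gaussian_measure. (norm (?F \<eta>))\<^sup>2)"
  proof (rule nn_integral_eq_integral)
    have "norm (fourier_transform m \<xi>) \<le> 1" for \<xi>
      using norm_fourier_transform_le[OF m.finite_measure_axioms s, of \<xi>] m.measure_le_1 order_trans by blast
    then show "integrable gaussian_measure (\<lambda>\<eta>. (norm (?F \<eta>))\<^sup>2)"
      by (intro G.integrable_const_bound[of _ 1]) (auto simp: power_le_one)
  qed auto
  also have "\<dots> = (\<integral>\<^sup>+x. (\<integral>\<^sup>+y. ennreal (k x y) \<partial>m) \<partial>m)" unfolding main Ik ..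
  also have "ennreal (R ^ DIM('a)) * (\<integral>\<^sup>+x. (\<integral>\<^sup>+y. ennreal (k x y) \<partial>m) \<partial>m) =
      (\<integral>\<^sup>+x. (\<integral>\<^sup>+y. ennreal (R ^ DIM('a)) * ennreal (k x y) \<partial>m) \<partial>m)"
  proof -
    have "(\<lambda>x. \<integral>\<^sup>+y. ennreal (k x y) \<partial>m) \<in> borel_measurable m" unfolding k_def by measurable
    moreover have "(\<lambda>y. ennreal (k x y)) \<in> borel_measurable m" for x unfolding k_def by measurable
    ultimately show ?thesis by (simp add: nn_integral_cmult)
  qed
  also have "\<dots> = (\<integral>\<^sup>+x. (\<integral>\<^sup>+y. ennreal (R ^ DIM('a) * k x y) \<partial>m) \<partial>m)"
    using R k01 by (simp add: ennreal_mult)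
  finally show ?thesis unfolding k_def .
qed

section \<open>Integration in polar coordinates\<close>

lemma nn_integral_sphere_measure:
  fixes f :: "'a::euclidean_space \<Rightarrow> ennreal"
  assumes [measurable]: "f \<in> borel_measurable borel"
  shows "(\<integral>\<^sup>+v. f v \<partial>sphere_measure) =
    ennreal (real DIM('a)) * (\<integral>\<^sup>+y. f (sgn y) * indicator (cball 0 1 - {0}) y \<partial>lborel)"
proof -
  have sgn: "(sgn :: 'a \<Rightarrow> 'a) \<in> borel_measurable borel"
    unfolding sgn_div_norm[abs_def] by measurable
  have D: "cball (0::'a) 1 - {0} \<in> sets borel" by auto
  have sgn': "(sgn :: 'a \<Rightarrow> 'a) \<in> borel_measurable (restrict_space lborel (cball 0 1 - {0}))"
    by (rule measurable_restrict_space1) (use sgn in simp)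
  have "(\<integral>\<^sup>+v. f v \<partial>sphere_measure) = of_nat DIM('a) * (\<integral>\<^sup>+y. f (sgn y) \<partial>restrict_space lborel (cball 0 1 - {0}))"
    unfolding sphere_measure_def
    by (subst nn_integral_scale_measure) (auto simp: nn_integral_distr[OF sgn'])
  also have "(\<integral>\<^sup>+y. f (sgn y) \<partial>restrict_space lborel (cball 0 1 - {0})) = (\<integral>\<^sup>+y. f (sgn y) * indicator (cball 0 1 - {0}) y \<partial>lborel)"
    by (rule nn_integral_restrict_space) (use D in auto)
  finally show ?thesis by (simp add: ennreal_of_nat_eq_real_of_nat)
qed

text \<open>Only Tonelli's theorem and the scaling of Lebesgue measure are used: each vector \<open>y\<close> of the
  punctured unit ball, over which the surface measure is an average, is traded for the radius.\<close>

lemma nn_integral_polar: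
  fixes F :: "'a::euclidean_space \<Rightarrow> ennreal" and h :: "real \<Rightarrow> ennreal"
  assumes [measurable]: "F \<in> borel_measurable borel" "h \<in> borel_measurable borel"
  shows "(\<integral>\<^sup>+x. h (norm x) * F x \<partial>lborel) =
    (\<integral>\<^sup>+s. h s * ennreal (s ^ (DIM('a) - 1)) * indicator {0<..} s * (\<integral>\<^sup>+v. F (s *\<^sub>R v) \<partial>sphere_measure) \<partial>lborel)"
proof -
  have P: "pair_sigma_finite (lborel :: 'a measure) (lborel :: real measure)" ..
  have Q: "pair_sigma_finite (lborel :: real measure) (lborel :: 'a measure)" ..
  define N where "N = DIM('a)"
  have N: "N > 0" by (simp add: N_def)
  define D where "D = cball (0::'a) 1 - {0}"
  have D [measurable]: "D \<in> sets borel" by (auto simp: D_def)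
  have D' [measurable]: "- {0::'a} \<in> sets borel" by auto
  have sgn [measurable]: "(sgn :: 'a \<Rightarrow> 'a) \<in> borel_measurable borel"
    unfolding sgn_div_norm[abs_def] by measurable
  \<comment> \<open>\<open>?P\<close> arises from the substitution s = norm y * r in the radius, and
    \<open>?Q\<close> from z = r y in space, where the unit ball condition on \<open>y\<close>
    becomes \<open>norm z \<le> r\<close>.\<close>
  let ?g = "\<lambda>s. h s * ennreal (s ^ (N - 1)) * indicator {0<..} s * ennreal (real N)"
  let ?P = "\<lambda>y r. ennreal (norm y) * (h (norm y * r) * ennreal ((norm y * r) ^ (N - 1)) * indicator {0<..} r * ennreal (real N) * (F (r *\<^sub>R y) * indicator D y))"
  let ?Q = "\<lambda>z r. ennreal (real N * (1 / r) ^ (N + 1)) * indicator {0<..} r * (if norm z \<le> r then 1 else 0) * (ennreal (norm z ^ N) * (h (norm z) * (F z * indicator (- {0}) z)))"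
  have "(\<integral>\<^sup>+s. h s * ennreal (s ^ (N - 1)) * indicator {0<..} s * (\<integral>\<^sup>+v. F (s *\<^sub>R v) \<partial>sphere_measure) \<partial>lborel) =
      (\<integral>\<^sup>+s. (\<integral>\<^sup>+y. ?g s * (F (s *\<^sub>R sgn y) * indicator D y) \<partial>lborel) \<partial>lborel)"
  proof (rule nn_integral_cong)
    fix s :: real
    have "(\<integral>\<^sup>+y. ?g s * (F (s *\<^sub>R sgn y) * indicator D y) \<partial>lborel) = ?g s * (\<integral>\<^sup>+y. F (s *\<^sub>R sgn y) * indicator D y \<partial>lborel)"
      by (rule nn_integral_cmult) measurable
    moreover have "(\<integral>\<^sup>+v. F (s *\<^sub>R v) \<partial>sphere_measure) = ennreal (real N) * (\<integral>\<^sup>+y. F (s *\<^sub>R sgn y) * indicator D y \<partial>lborel)"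
      unfolding N_def D_def by (rule nn_integral_sphere_measure) measurable
    ultimately show "h s * ennreal (s ^ (N - 1)) * indicator {0<..} s * (\<integral>\<^sup>+v. F (s *\<^sub>R v) \<partial>sphere_measure) =
        (\<integral>\<^sup>+y. ?g s * (F (s *\<^sub>R sgn y) * indicator D y) \<partial>lborel)"
      by (simp only: mult.assoc)
  qed
  also have "\<dots> = (\<integral>\<^sup>+y. (\<integral>\<^sup>+s. ?g s * (F (s *\<^sub>R sgn y) * indicator D y) \<partial>lborel) \<partial>lborel)"
    by (rule pair_sigma_finite.Fubini'[OF P]) measurable
  also have "\<dots> = (\<integral>\<^sup>+y. (\<integral>\<^sup>+r. ?P y r \<partial>lborel) \<partial>lborel)"
  proof (rule nn_integral_cong)
    fix y :: 'a
    show "(\<integral>\<^sup>+s. ?g s * (F (s *\<^sub>R sgn y) * indicator D y) \<partial>lborel) =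
      (\<integral>\<^sup>+r. ?P y r \<partial>lborel)"
    proof (cases "y = 0")
      case True
      then show ?thesis by (simp add: D_def)
    next
      case False
      then have y: "norm y > 0" by simp
      have ind: "indicator {0<..} (norm y * r) = (indicator {0<..} r :: ennreal)" for r
        using y by (auto simp: indicator_def zero_less_mult_iff)
      have sc: "(norm y * r) *\<^sub>R sgn y = r *\<^sub>R y" for r
        using y by (simp add: sgn_div_norm)
      have "(\<integral>\<^sup>+s. ?g s * (F (s *\<^sub>R sgn y) * indicator D y) \<partial>lborel) =
          ennreal \<bar>norm y\<bar> * (\<integral>\<^sup>+r. (\<lambda>s. ?g s * (F (s *\<^sub>R sgn y) * indicator D y)) (0 + norm y * r) \<partial>lborel)"
        by (rule nn_integral_real_affine) (use y in \<open>auto\<close>)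
      then show ?thesis by (simp add: nn_integral_cmult ind sc)
    qed
  qed
  also have "\<dots> = (\<integral>\<^sup>+r. (\<integral>\<^sup>+y. ?P y r \<partial>lborel) \<partial>lborel)"
    by (rule pair_sigma_finite.Fubini'[OF Q]) measurable
  also have "\<dots> = (\<integral>\<^sup>+r. (\<integral>\<^sup>+z. ?Q z r \<partial>lborel) \<partial>lborel)"
  proof (rule nn_integral_cong)
    fix r :: real
    show "(\<integral>\<^sup>+y. ?P y r \<partial>lborel) =
      (\<integral>\<^sup>+z. ?Q z r \<partial>lborel)"
    proof (cases "r > 0")
      case False
      then show ?thesis by simp
    next
      case r: True
      have "(\<integral>\<^sup>+z. ?Q z r \<partial>lborel) =
        ennreal (r ^ N) * (\<integral>\<^sup>+y. ?Q (r *\<^sub>R y) r \<partial>lborel)"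
        unfolding N_def by (rule nn_integral_lborel_scale[OF _ r]) measurable
      also have "\<dots> = (\<integral>\<^sup>+y. ennreal (r ^ N) * (?Q (r *\<^sub>R y) r) \<partial>lborel)"
        by (rule nn_integral_cmult[symmetric]) measurable
      also have "\<dots> = (\<integral>\<^sup>+y. ?P y r \<partial>lborel)"
      proof (rule nn_integral_cong)
        fix y :: 'a
        have "(if norm (r *\<^sub>R y) \<le> r then 1 else 0) * indicator (- {0}) (r *\<^sub>R y) = (indicator D y :: ennreal)"
          using r by (auto simp: indicator_def D_def)
        moreover have "ennreal (r ^ N) * ennreal (real N * (1 / r) ^ (N + 1)) * ennreal (norm (r *\<^sub>R y) ^ N)
            = ennreal (norm y) * ennreal ((norm y * r) ^ (N - 1)) * ennreal (real N)"
        proof -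
          have "r ^ N * (real N * (1 / r) ^ (N + 1)) * norm (r *\<^sub>R y) ^ N = norm y * (norm y * r) ^ (N - 1) * real N"
            using r N by (cases N) (auto simp: power_mult_distrib power_one_over field_simps)
          then show ?thesis using r by (simp flip: ennreal_mult)
        qed
        ultimately show "ennreal (r ^ N) * (?Q (r *\<^sub>R y) r)
          = ?P y r"
        proof -
          assume i: "(if norm (r *\<^sub>R y) \<le> r then 1 else 0) * indicator (- {0}) (r *\<^sub>R y) = (indicator D y :: ennreal)"
            and p: "ennreal (r ^ N) * ennreal (real N * (1 / r) ^ (N + 1)) * ennreal (norm (r *\<^sub>R y) ^ N)
            = ennreal (norm y) * ennreal ((norm y * r) ^ (N - 1)) * ennreal (real N)"
          have nr: "norm (r *\<^sub>R y) = norm y * r" using r by simp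
          have "ennreal (r ^ N) * (ennreal (real N * (1 / r) ^ (N + 1)) * indicator {0<..} r * (if norm y * r \<le> r then 1 else 0) * (ennreal ((norm y * r) ^ N) * (h (norm y * r) * (F (r *\<^sub>R y) * indicator (- {0}) (r *\<^sub>R y)))))
            = (ennreal (r ^ N) * ennreal (real N * (1 / r) ^ (N + 1)) * ennreal ((norm y * r) ^ N)) * ((if norm y * r \<le> r then 1 else 0) * indicator (- {0}) (r *\<^sub>R y)) * (indicator {0<..} r * h (norm y * r) * F (r *\<^sub>R y))"
            by (simp only: mult_ac)
          then show ?thesis unfolding nr p[unfolded nr] i[unfolded nr] by (simp only: mult_ac)
        qed
      qed
      finally show ?thesis by simp
    qed
  qed
  also have "\<dots> = (\<integral>\<^sup>+z. (\<integral>\<^sup>+r. ?Q z r \<partial>lborel) \<partial>lborel)"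
    by (rule pair_sigma_finite.Fubini'[OF P]) measurable
  also have "\<dots> = (\<integral>\<^sup>+z. h (norm z) * F z \<partial>lborel)"
  proof (rule nn_integral_cong_AE)
    have "AE z in (lborel :: 'a measure). z \<noteq> 0" by (rule AE_lborel_singleton)
    then show "AE z in (lborel :: 'a measure). (\<integral>\<^sup>+r. ?Q z r \<partial>lborel) = h (norm z) * F z"
    proof eventually_elim
      case (elim z)
      then have z: "norm z > 0" by simp
      have "(\<integral>\<^sup>+r. ennreal (real N * (1 / r) ^ (N + 1)) * indicator {0<..} r * (if norm z \<le> r then 1 else 0) \<partial>lborel) =
        (\<integral>\<^sup>+r. ennreal (real N * (1 / r) ^ (N + 1)) * indicator {norm z..} r \<partial>lborel)"
      proof (rule nn_integral_cong)
        fix r :: real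
        have "r > 0" if "norm z \<le> r" using that z by linarith
        then show "ennreal (real N * (1 / r) ^ (N + 1)) * indicator {0<..} r * (if norm z \<le> r then 1 else 0) =
            ennreal (real N * (1 / r) ^ (N + 1)) * indicator {norm z..} r" by (auto simp: indicator_def)
      qed
      \<comment> \<open>An antiderivative of N r^(-N-1) is -r^(-N). The integral over r >= norm z is
        therefore (1 / norm z)^N, which cancels the factor \<open>norm z ^ N\<close> in
        \<open>?Q\<close>.\<close>
      also have "\<dots> = ennreal (0 - (- ((1 / norm z) ^ N)))"
      proof (rule nn_integral_FTC_atLeast)
        fix r assume "norm z \<le> r"
        then have r: "r > 0" using z by linarith
        have "((\<lambda>r::real. 1 / r) has_real_derivative - (1 / r\<^sup>2)) (at r)"
          using r by (auto intro!: derivative_eq_intros simp: power2_eq_square)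
        from DERIV_minus[OF DERIV_power[OF this, of N]]
        have "((\<lambda>r. - ((1 / r) ^ N)) has_real_derivative - (real N * (- (1 / r\<^sup>2) * (1 / r) ^ (N - Suc 0)))) (at r)" .
        moreover have "- (real N * (- (1 / r\<^sup>2) * (1 / r) ^ (N - Suc 0))) = real N * (1 / r) ^ (N + 1)"
          using N r by (cases N) (auto simp: power2_eq_square power_one_over)
        ultimately show "((\<lambda>r. - ((1 / r) ^ N)) has_real_derivative real N * (1 / r) ^ (N + 1)) (at r)" by simp
        show "0 \<le> real N * (1 / r) ^ (N + 1)" using r by simp
      next
        have "((\<lambda>r::real. - ((1 / r) ^ N)) \<longlongrightarrow> - (0 ^ N)) at_top"
          by (intro tendsto_intros tendsto_divide_0[OF tendsto_const] filterlim_at_top_imp_at_infinity filterlim_ident)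
        then show "((\<lambda>r::real. - ((1 / r) ^ N)) \<longlongrightarrow> 0) at_top" by (simp only: zero_power[OF N] minus_zero)
      qed measurable
      finally have I: "(\<integral>\<^sup>+r. ennreal (real N * (1 / r) ^ (N + 1)) * indicator {0<..} r * (if norm z \<le> r then 1 else 0) \<partial>lborel) = ennreal ((1 / norm z) ^ N)" by simp
      have "(\<integral>\<^sup>+r. ?Q z r \<partial>lborel) =
        ennreal ((1 / norm z) ^ N) * (ennreal (norm z ^ N) * (h (norm z) * (F z * indicator (- {0}) z)))"
        unfolding I[symmetric] by (rule nn_integral_multc) measurable
      also have "\<dots> = (ennreal ((1 / norm z) ^ N) * ennreal (norm z ^ N)) * (h (norm z) * F z)"
        using elim by (simp add: mult.assoc)
      also have "ennreal ((1 / norm z) ^ N) * ennreal (norm z ^ N) = 1"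
        using z by (simp add: power_one_over flip: ennreal_mult)
      finally show ?case by simp
    qed
  qed
  finally show ?thesis unfolding N_def ..
qed

section \<open>Radon measures and spherical shells\<close>

lemma space_eq_UNIV_borel: "sets M = sets borel \<Longrightarrow> space M = UNIV"
  by (metis sets_eq_imp_space_eq space_borel)

lemma radon_measure_finite:
  fixes M :: "'a::euclidean_space measure"
  assumes "finite_measure M" and s: "sets M = sets borel"
  shows "radon_measure M"
proof -
  interpret finite_measure M by fact
  have fin: "emeasure M (space M) \<noteq> \<infinity>" by simp
  have "emeasure M V = (SUP K\<in>{K. compact K \<and> K \<subseteq> V}. emeasure M K)" if "open V" for V
    using inner_regular[OF s fin, of V] that by (simp add: conj_commute)
  moreover have "emeasure M B = (INF V\<in>{V. open V \<and> B \<subseteq> V}. emeasure M V)" if "B \<in> sets borel" for B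
    using outer_regular[OF s fin, of B] that by (simp add: conj_commute)
  moreover have "emeasure M K < \<infinity>" for K using emeasure_finite[of K] by (simp add: less_top[symmetric])
  ultimately show ?thesis unfolding radon_measure_def using s by blast
qed

lemma closed_measure_support: "closed (measure_support M)"
proof -
  have "- measure_support M = \<Union>{U. open U \<and> emeasure M U = 0}"
    by (auto simp: measure_support_def not_gr_zero)
  then have "open (- measure_support M)" by auto
  then show ?thesis by (simp add: closed_def)
qed

lemma measure_support_subset:
  assumes "closed K" "emeasure M (- K) = 0"
  shows "measure_support M \<subseteq> K"
  using assms by (auto simp: measure_support_def closed_def)

lemma radon_measures_onI:
  fixes M :: "'a::euclidean_space measure"
  assumes "prob_space M" and s: "sets M = sets borel" and K: "compact K" "K \<subseteq> A" "emeasure M (- K) = 0"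
  shows "M \<in> radon_measures_on A" "emeasure M UNIV = 1"
proof -
  interpret prob_space M by fact
  show 1: "emeasure M UNIV = 1" using emeasure_space_1 space_eq_UNIV_borel[OF s] by simp
  have sub: "measure_support M \<subseteq> K" using K by (intro measure_support_subset compact_imp_closed)
  then have "compact (measure_support M)"
    using K(1) closed_measure_support[of M] compact_Int_closed[of K "measure_support M"] by (simp add: Int_absorb1)
  then show "M \<in> radon_measures_on A"
    unfolding radon_measures_on_def using sub K radon_measure_finite[OF finite_measure_axioms s] 1 by auto
qed

text \<open>The definition of the support does not say that its complement is null. The complement
  is a union of null open sets, of which countably many suffice by Lindelof's theorem; finiteness
  follows, as the compact support has finite mass.\<close>

lemma radon_measures_onE:
  fixes M :: "'a::euclidean_space measure"
  assumes M: "M \<in> radon_measures_on A"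
  obtains K where "sets M = sets borel" "finite_measure M" "compact K" "K \<subseteq> A" "emeasure M (- K) = 0" "emeasure M UNIV \<noteq> 0"
proof -
  define K where "K = measure_support M"
  have s: "sets M = sets borel" and K: "compact K" "K \<subseteq> A" and nz: "emeasure M UNIV \<noteq> 0"
    and fin: "emeasure M K < \<infinity>"
    using M unfolding radon_measures_on_def radon_measure_def K_def by auto
  let ?F = "{U. open U \<and> emeasure M U = 0}"
  obtain F where F: "F \<subseteq> ?F" "countable F" "\<Union>F = \<Union>?F"
    using Lindelof[of ?F] by blast
  have eq: "- K = \<Union>F" unfolding F(3) K_def by (auto simp: measure_support_def not_gr_zero)
  have "\<Union>F \<in> null_sets M"
  proof -
    have "\<forall>U\<in>F. U \<in> null_sets M" using F(1) s by (auto simp: null_sets_def)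
    then show ?thesis using null_sets_UN'[OF F(2), of "\<lambda>x. x" M] by simp
  qed
  then have z: "emeasure M (- K) = 0" by (simp add: eq null_sets_def)
  have "emeasure M UNIV = emeasure M (K \<union> - K)" by simp
  also have "\<dots> \<le> emeasure M K + emeasure M (- K)"
    using K(1) s by (intro emeasure_subadditive) (auto simp: compact_imp_closed)
  also have "\<dots> < \<infinity>" using fin z by simp
  finally have "finite_measure M" by (intro finite_measureI) (simp add: space_eq_UNIV_borel[OF s])
  then show thesis using that s K z nz by blast
qed

section \<open>Gaussian sums over layers and spherical shells\<close>

definition gauss_series :: "real \<Rightarrow> real" where
  "gauss_series \<beta> = (\<Sum>k. exp (- (pi / 2) * (real k)\<^sup>2) * (real k + 1) powr \<beta>)"

lemma summable_gauss_series: "summable (\<lambda>k. exp (- (pi / 2) * (real k)\<^sup>2) * (real k + 1) powr \<beta>)"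
proof (rule summable_comparison_test_bigo)
  show "summable (\<lambda>k. norm ((1 / 2 :: real) ^ k))" by simp
  show "(\<lambda>k. exp (- (pi / 2) * (real k)\<^sup>2) * (real k + 1) powr \<beta>) \<in> O(\<lambda>k. (1 / 2) ^ k)"
    by real_asymp
qed

lemma gauss_series_nonneg: "gauss_series \<beta> \<ge> 0"
  unfolding gauss_series_def by (rule suminf_nonneg[OF summable_gauss_series]) simp

text \<open>On the layer k <= u < k + 1 the integrand is at most exp(-pi k^2/2), which outweighs the
  polynomial growth of the masses. The exponent is \<open>pi / 2\<close> because, for the rotation
  kernel, the other half of \<open>pi\<close> is spent on locating a sphere.\<close>

lemma gauss_layer_bound:
  assumes [measurable]: "u \<in> borel_measurable M" and u: "\<And>x. u x \<ge> (0::real)" and A: "A \<ge> 0"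
    and bound: "\<And>k::nat. emeasure M {x \<in> space M. u x \<le> real k + 1} \<le> ennreal (A * (real k + 1) powr \<beta>)"
  shows "(\<integral>\<^sup>+x. ennreal (exp (- (pi / 2) * (u x)\<^sup>2)) \<partial>M) \<le> ennreal (A * gauss_series \<beta>)"
proof -
  define e where "e k = exp (- (pi / 2) * (real k)\<^sup>2)" for k :: nat
  have "(\<integral>\<^sup>+x. ennreal (exp (- (pi / 2) * (u x)\<^sup>2)) \<partial>M) \<le>
      (\<integral>\<^sup>+x. (\<Sum>k. ennreal (e k) * indicator {x \<in> space M. u x \<le> real k + 1} x) \<partial>M)"
  proof (rule nn_integral_mono)
    fix x assume x: "x \<in> space M"
    define k where "k = nat \<lfloor>u x\<rfloor>"
    have k: "real k \<le> u x" "u x \<le> real k + 1" using u[of x] by (auto simp: k_def)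
    have "(real k)\<^sup>2 \<le> (u x)\<^sup>2" using k by (intro power_mono) auto
    then have "exp (- (pi / 2) * (u x)\<^sup>2) \<le> e k" unfolding e_def by simp
    then have "ennreal (exp (- (pi / 2) * (u x)\<^sup>2)) \<le> ennreal (e k) * indicator {x \<in> space M. u x \<le> real k + 1} x"
      using k x by (simp add: ennreal_leI)
    also have "\<dots> \<le> (\<Sum>k. ennreal (e k) * indicator {x \<in> space M. u x \<le> real k + 1} x)"
    proof -
      have "f k \<le> (\<Sum>k. f k)" for f :: "nat \<Rightarrow> ennreal"
        using sum_le_suminf[of f "{k}"] by simp
      from this[of "\<lambda>k. ennreal (e k) * indicator {x \<in> space M. u x \<le> real k + 1} x"] show ?thesis .
    qed
    finally show "ennreal (exp (- (pi / 2) * (u x)\<^sup>2)) \<le> (\<Sum>k. ennreal (e k) * indicator {x \<in> space M. u x \<le> real k + 1} x)" .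
  qed
  also have "\<dots> = (\<Sum>k. (\<integral>\<^sup>+x. ennreal (e k) * indicator {x \<in> space M. u x \<le> real k + 1} x \<partial>M))"
    by (rule nn_integral_suminf) measurable
  also have "\<dots> = (\<Sum>k. ennreal (e k) * emeasure M {x \<in> space M. u x \<le> real k + 1})"
    by (intro suminf_cong nn_integral_cmult_indicator) measurable
  also have "\<dots> \<le> (\<Sum>k. ennreal (A * (e k * (real k + 1) powr \<beta>)))"
  proof (intro suminf_le allI summableI)
    fix k
    have "ennreal (e k) * emeasure M {x \<in> space M. u x \<le> real k + 1} \<le> ennreal (e k) * ennreal (A * (real k + 1) powr \<beta>)"
      by (intro mult_left_mono bound) simp
    also have "\<dots> = ennreal (A * (e k * (real k + 1) powr \<beta>))"
      using A by (simp add: e_def mult_ac flip: ennreal_mult)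
    finally show "ennreal (e k) * emeasure M {x \<in> space M. u x \<le> real k + 1} \<le> ennreal (A * (e k * (real k + 1) powr \<beta>))" .
  qed
  also have "\<dots> = ennreal (\<Sum>k. A * (e k * (real k + 1) powr \<beta>))"
    using A summable_mult[OF summable_gauss_series, of A \<beta>]
    by (intro suminf_ennreal2) (auto simp: e_def)
  also have "(\<Sum>k. A * (e k * (real k + 1) powr \<beta>)) = A * gauss_series \<beta>"
    unfolding gauss_series_def e_def by (rule suminf_mult[OF summable_gauss_series])
  finally show ?thesis .
qed

text \<open>From ln (1 + v) <= v and q v <= q^2/pi + pi v^2/4, a completed square. A Gaussian can
  thus absorb any power at the price of \<open>pi / 4\<close> of its exponent.\<close>

lemma one_plus_powr_le_exp:
  fixes v q :: real
  assumes "q \<ge> 0" "v \<ge> 0"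
  shows "(1 + v) powr q \<le> exp (q\<^sup>2 / pi) * exp (pi / 4 * v\<^sup>2)"
proof -
  have "(1 + v) powr q = exp (q * ln (1 + v))" using assms by (simp add: powr_def)
  also have "\<dots> \<le> exp (q * v)" using assms ln_add_one_self_le_self[of v] by (simp add: mult_left_mono)
  also have "\<dots> \<le> exp (q\<^sup>2 / pi + pi / 4 * v\<^sup>2)"
  proof -
    have "0 \<le> (2 * q - pi * v)\<^sup>2 / (4 * pi)" by simp
    also have "\<dots> = q\<^sup>2 / pi + pi / 4 * v\<^sup>2 - q * v"
      by (simp add: power2_eq_square field_simps)
    finally show ?thesis by simp
  qed
  finally show ?thesis by (simp add: exp_add)
qed

text \<open>Peetre's inequality; negative exponents use the product bound with \<open>r\<close> and
  \<open>s\<close> exchanged. It moves a weight from the variable radius \<open>s\<close> to the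
  centre \<open>r\<close> of a shell.\<close>

lemma peetre:
  fixes s r p :: real
  assumes "s \<ge> 0" "r \<ge> 0"
  shows "(1 + s) powr p \<le> (1 + r) powr p * (1 + \<bar>s - r\<bar>) powr \<bar>p\<bar>"
proof -
  define a where "a = \<bar>s - r\<bar>"
  have "r * a \<ge> 0" "s * a \<ge> 0" "a \<ge> s - r" "a \<ge> r - s" using assms by (auto simp: a_def)
  moreover have "(1 + r) * (1 + a) = 1 + r + a + r * a" "(1 + s) * (1 + a) = 1 + s + a + s * a"
    by (simp_all add: algebra_simps)
  ultimately have 1: "1 + s \<le> (1 + r) * (1 + \<bar>s - r\<bar>)" "1 + r \<le> (1 + s) * (1 + \<bar>s - r\<bar>)"
    unfolding a_def[symmetric] by linarith+
  show ?thesis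
  proof (cases "p \<ge> 0")
    case True
    have "(1 + s) powr p \<le> ((1 + r) * (1 + \<bar>s - r\<bar>)) powr p"
      using True assms 1 by (intro powr_mono2) auto
    then show ?thesis using True assms by (simp add: powr_mult)
  next
    case False
    have "(1 + r) powr (- p) \<le> ((1 + s) * (1 + \<bar>s - r\<bar>)) powr (- p)"
      using False assms 1 by (intro powr_mono2) auto
    then have "(1 + r) powr (- p) \<le> (1 + s) powr (- p) * (1 + \<bar>s - r\<bar>) powr (- p)"
      using assms by (simp add: powr_mult)
    then have h: "1 / (1 + r) powr p \<le> 1 / (1 + s) powr p * (1 + \<bar>s - r\<bar>) powr (- p)"
      by (simp only: powr_minus_divide[of "1 + r"] powr_minus_divide[of "1 + s"])
    have gen: "y \<le> x * A" if "x > 0" "y > 0" "1 / x \<le> 1 / y * A" for x y A :: real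
      using that by (simp add: field_simps)
    have "(1 + s) powr p \<le> (1 + r) powr p * (1 + \<bar>s - r\<bar>) powr (- p)"
      by (rule gen[OF _ _ h]) (use assms in auto)
    then show ?thesis using False by simp
  qed
qed

lemma gaussian_integral_quarter:
  "(\<integral>\<^sup>+s. ennreal (exp (- (pi / 4) * (s - r)\<^sup>2)) \<partial>lborel) = 2" for r :: real
proof -
  have "(\<integral>\<^sup>+s. ennreal (exp (- (pi / 4) * (s - r)\<^sup>2)) \<partial>lborel) =
      ennreal \<bar>2\<bar> * (\<integral>\<^sup>+y. ennreal (exp (- (pi / 4) * ((r + 2 * y) - r)\<^sup>2)) \<partial>lborel)"
    by (rule nn_integral_real_affine) auto
  also have "(\<integral>\<^sup>+y. ennreal (exp (- (pi / 4) * ((r + 2 * y) - r)\<^sup>2)) \<partial>lborel) = (\<integral>\<^sup>+(y::real). ennreal (exp (- pi * (norm y)\<^sup>2)) \<partial>lborel)"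
    by (intro nn_integral_cong) (simp add: power_mult_distrib)
  also have "\<dots> = 1" by (rule gaussian_integral)
  finally show ?thesis by simp
qed

lemma space_sphere_measure [simp]: "space sphere_measure = UNIV"
  by (simp add: sphere_measure_def space_scale_measure)

lemma emeasure_sphere_measure_finite: "emeasure (sphere_measure :: 'a::euclidean_space measure) UNIV < \<infinity>"
proof -
  have "emeasure (sphere_measure :: 'a measure) UNIV = (\<integral>\<^sup>+v. 1 \<partial>(sphere_measure :: 'a measure))"
    by simp
  also have "\<dots> = ennreal (real DIM('a)) * emeasure lborel (cball (0::'a) 1 - {0})"
    by (subst nn_integral_sphere_measure) auto
  also have "\<dots> < \<infinity>"
  proof -
    have "emeasure lborel (cball (0::'a) 1 - {0}) \<le> emeasure lborel (cball (0::'a) 1)"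
      by (intro emeasure_mono) auto
    also have "\<dots> < \<infinity>" by (rule emeasure_lborel_cball_finite)
    finally show ?thesis by (simp add: ennreal_mult_less_top)
  qed
  finally show ?thesis .
qed

text \<open>In polar coordinates the radial Gaussian is integrated against s^(d-1) times the
  spherical average, which is of order s^(d-1-\<alpha>). By \<open>peetre\<close> and
  \<open>one_plus_powr_le_exp\<close>, a Gaussian centred at \<open>r\<close> sees this power at s =
  r up to a constant.\<close>

lemma spherical_shell_bound:
  fixes \<mu> :: "'a::euclidean_space measure"
  assumes fin: "finite_measure \<mu>" and s: "sets \<mu> = sets borel"
    and \<alpha>: "\<alpha> \<ge> 0" and C: "C > 0" and sph: "\<And>r. r > 0 \<Longrightarrow> spherical_average \<mu> r \<le> ennreal (C * r powr (- \<alpha>))"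
  obtains D where "D > 0" "\<And>r. r \<ge> 0 \<Longrightarrow>
    (\<integral>\<^sup>+x. ennreal (exp (- (pi / 2) * (norm x - r)\<^sup>2)) * ennreal ((norm (fourier_transform \<mu> x))\<^sup>2) \<partial>lborel)
      \<le> ennreal (D * (1 + r) powr (real DIM('a) - 1 - \<alpha>))"
proof -
  interpret \<mu>: finite_measure \<mu> by fact
  note meas = borel_measurable_fourier_transform[OF \<mu>.sigma_finite_measure_axioms s, measurable]
  define M where "M = measure \<mu> UNIV"
  define T where "T = enn2real (emeasure (sphere_measure :: 'a measure) UNIV)"
  have T: "emeasure (sphere_measure :: 'a measure) UNIV = ennreal T"
    unfolding T_def using emeasure_sphere_measure_finite[where 'a = 'a] by (simp add: ennreal_enn2real_if less_top)
  have T0: "T \<ge> 0" by (simp add: T_def)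
  have triv: "spherical_average \<mu> r \<le> ennreal (M\<^sup>2 * T)" for r
  proof -
    have "spherical_average \<mu> r \<le> (\<integral>\<^sup>+v. ennreal (M\<^sup>2) \<partial>(sphere_measure :: 'a measure))"
      unfolding spherical_average_def M_def
      by (intro nn_integral_mono ennreal_leI power_mono norm_fourier_transform_le fin s) simp
    also have "\<dots> = ennreal (M\<^sup>2) * ennreal T" by (simp add: T)
    finally show ?thesis using T0 by (simp add: ennreal_mult)
  qed
  define C1 where "C1 = (M\<^sup>2 * T + C) * 2 powr \<alpha>"
  have C1: "C1 > 0" unfolding C1_def using C T0 by (intro mult_pos_pos add_nonneg_pos) auto
  \<comment> \<open>The assumed bound may blow up at r = 0. There the trivial bound by the total
    mass replaces it, and both are merged into one bound in 1 + r; for r > 1 this uses r >= (1 +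
    r)/2.\<close>
  have av: "spherical_average \<mu> r \<le> ennreal (C1 * (1 + r) powr (- \<alpha>))" if r: "r > 0" for r
  proof (cases "r \<le> 1")
    case True
    have "1 = 2 powr \<alpha> * 2 powr (- \<alpha>)" by (simp flip: powr_add)
    also have "\<dots> \<le> 2 powr \<alpha> * (1 + r) powr (- \<alpha>)"
      using True r \<alpha> by (intro mult_left_mono powr_mono2') auto
    finally have 1: "1 \<le> 2 powr \<alpha> * (1 + r) powr (- \<alpha>)" .
    have "M\<^sup>2 * T \<le> (M\<^sup>2 * T + C) * 1" using C by simp
    also have "\<dots> \<le> (M\<^sup>2 * T + C) * (2 powr \<alpha> * (1 + r) powr (- \<alpha>))"
      using 1 T0 C by (intro mult_left_mono) auto
    finally show ?thesis using order_trans[OF triv[of r] ennreal_leI] by (simp add: C1_def mult.assoc)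
  next
    case False
    have "r powr (- \<alpha>) \<le> ((1 + r) / 2) powr (- \<alpha>)"
      using False \<alpha> by (intro powr_mono2') auto
    also have "\<dots> = 2 powr \<alpha> * (1 + r) powr (- \<alpha>)"
      using r by (simp add: powr_divide powr_minus_divide)
    finally have "C * r powr (- \<alpha>) \<le> (M\<^sup>2 * T + C) * (2 powr \<alpha> * (1 + r) powr (- \<alpha>))"
      using C T0 by (intro mult_mono) auto
    then show ?thesis using order_trans[OF sph[OF r] ennreal_leI] by (simp add: C1_def mult.assoc)
  qed
  define N where "N = DIM('a)"
  have N: "N > 0" by (simp add: N_def)
  define p where "p = real N - 1 - \<alpha>"
  define E where "E = exp (\<bar>p\<bar>\<^sup>2 / pi)"
  show thesis
  proof (rule that)
    show "2 * (C1 * E) > 0" using C1 by (simp add: E_def)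
    fix r :: real assume r: "r \<ge> 0"
    let ?h = "\<lambda>s. ennreal (exp (- (pi / 2) * (s - r)\<^sup>2))"
    have "(\<integral>\<^sup>+x. ?h (norm x) * ennreal ((norm (fourier_transform \<mu> x))\<^sup>2) \<partial>lborel) =
      (\<integral>\<^sup>+s. ?h s * ennreal (s ^ (N - 1)) * indicator {0<..} s * spherical_average \<mu> s \<partial>lborel)"
      unfolding N_def spherical_average_def by (rule nn_integral_polar) measurable
    also have "\<dots> \<le> (\<integral>\<^sup>+s. ennreal (C1 * E * (1 + r) powr p) * ennreal (exp (- (pi / 4) * (s - r)\<^sup>2)) \<partial>lborel)"
    proof (rule nn_integral_mono)
      fix s :: real
      show "?h s * ennreal (s ^ (N - 1)) * indicator {0<..} s * spherical_average \<mu> s \<le>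
        ennreal (C1 * E * (1 + r) powr p) * ennreal (exp (- (pi / 4) * (s - r)\<^sup>2))"
      proof (cases "s > 0")
        case s: True
        have "s ^ (N - 1) \<le> (1 + s) ^ (N - 1)" using s by (intro power_mono) auto
        also have "\<dots> = (1 + s) powr (real N - 1)"
          using s N by (subst powr_realpow[symmetric]) (auto simp: of_nat_diff)
        finally have "s ^ (N - 1) * (C1 * (1 + s) powr (- \<alpha>)) \<le> (1 + s) powr (real N - 1) * (C1 * (1 + s) powr (- \<alpha>))"
          using C1 by (intro mult_right_mono) auto
        also have "\<dots> = C1 * ((1 + s) powr (real N - 1) * (1 + s) powr (- \<alpha>))" by (simp add: mult_ac)
        also have "(1 + s) powr (real N - 1) * (1 + s) powr (- \<alpha>) = (1 + s) powr p"
          by (simp add: p_def flip: powr_add)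
        also have "C1 * (1 + s) powr p \<le> C1 * ((1 + r) powr p * (1 + \<bar>s - r\<bar>) powr \<bar>p\<bar>)"
          using C1 s r by (intro mult_left_mono peetre) auto
        also have "\<dots> \<le> C1 * ((1 + r) powr p * (E * exp (pi / 4 * (s - r)\<^sup>2)))"
        proof -
          have "(1 + \<bar>s - r\<bar>) powr \<bar>p\<bar> \<le> E * exp (pi / 4 * (s - r)\<^sup>2)"
            using one_plus_powr_le_exp[of "\<bar>p\<bar>" "\<bar>s - r\<bar>"] by (simp add: E_def)
          then show ?thesis using C1 by (intro mult_left_mono) auto
        qed
        finally have "exp (- (pi / 2) * (s - r)\<^sup>2) * (s ^ (N - 1) * (C1 * (1 + s) powr (- \<alpha>))) \<le>
            exp (- (pi / 2) * (s - r)\<^sup>2) * (C1 * ((1 + r) powr p * (E * exp (pi / 4 * (s - r)\<^sup>2))))"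
          by (intro mult_left_mono) auto
        also have "\<dots> = C1 * E * (1 + r) powr p * (exp (- (pi / 2) * (s - r)\<^sup>2) * exp (pi / 4 * (s - r)\<^sup>2))"
          by (simp add: mult_ac)
        also have "exp (- (pi / 2) * (s - r)\<^sup>2) * exp (pi / 4 * (s - r)\<^sup>2) = exp (- (pi / 4) * (s - r)\<^sup>2)"
          by (simp flip: exp_add)
        finally have le: "exp (- (pi / 2) * (s - r)\<^sup>2) * (s ^ (N - 1) * (C1 * (1 + s) powr (- \<alpha>))) \<le> C1 * E * (1 + r) powr p * exp (- (pi / 4) * (s - r)\<^sup>2)" .
        have "?h s * ennreal (s ^ (N - 1)) * indicator {0<..} s * spherical_average \<mu> s \<le>
            ?h s * ennreal (s ^ (N - 1)) * ennreal (C1 * (1 + s) powr (- \<alpha>))"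
          using s av[OF s] by (simp add: mult_left_mono)
        also have "\<dots> = ennreal (exp (- (pi / 2) * (s - r)\<^sup>2) * (s ^ (N - 1) * (C1 * (1 + s) powr (- \<alpha>))))"
          using s C1 by (simp add: mult.assoc flip: ennreal_mult)
        also have "\<dots> \<le> ennreal (C1 * E * (1 + r) powr p * exp (- (pi / 4) * (s - r)\<^sup>2))"
          by (rule ennreal_leI[OF le])
        also have "\<dots> = ennreal (C1 * E * (1 + r) powr p) * ennreal (exp (- (pi / 4) * (s - r)\<^sup>2))"
          using C1 by (intro ennreal_mult) (auto simp: E_def)
        finally show ?thesis .
      qed simp
    qed
    also have "\<dots> = ennreal (C1 * E * (1 + r) powr p) * 2"
      by (subst nn_integral_cmult) (auto simp: gaussian_integral_quarter[simplified])
    also have "\<dots> = ennreal (C1 * E * (1 + r) powr p) * ennreal 2" by simp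
    also have "\<dots> = ennreal (2 * (C1 * E) * (1 + r) powr p)"
      using C1 by (subst ennreal_mult[symmetric]) (auto simp: E_def mult_ac)
    finally show "(\<integral>\<^sup>+x. ennreal (exp (- (pi / 2) * (norm x - r)\<^sup>2)) * ennreal ((norm (fourier_transform \<mu> x))\<^sup>2) \<partial>lborel)
      \<le> ennreal (2 * (C1 * E) * (1 + r) powr (real DIM('a) - 1 - \<alpha>))"
      by (simp only: p_def N_def)
  qed
qed

section \<open>Decay of the rotated measure\<close>

declare transpose_matrix_vector [simp del]

lemma ennreal_mult3:
  "0 \<le> a \<Longrightarrow> 0 \<le> b \<Longrightarrow> 0 \<le> c \<Longrightarrow> ennreal a * (ennreal b * ennreal c) = ennreal (a * (b * c))"
  by (simp add: ennreal_mult)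

text \<open>Used for the action of matrices on vectors and for sums of independent points. A pair
  that is mapped outside the image of A x B has a component outside \<open>A\<close> or outside
  \<open>B\<close>, and both events are null.\<close>

lemma distr_pair_support:
  fixes f :: "'a::euclidean_space \<times> 'b::euclidean_space \<Rightarrow> 'c::euclidean_space"
  assumes "prob_space M" "prob_space N" and sM [measurable_cong]: "sets M = sets borel"
    and sN [measurable_cong]: "sets N = sets borel"
    and A: "compact A" "emeasure M (- A) = 0" and B: "compact B" "emeasure N (- B) = 0"
    and f: "continuous_on UNIV f"
  shows "f \<in> borel_measurable (M \<Otimes>\<^sub>M N)" "prob_space (distr (M \<Otimes>\<^sub>M N) borel f)"
    "compact (f ` (A \<times> B))" "emeasure (distr (M \<Otimes>\<^sub>M N) borel f) (- (f ` (A \<times> B))) = 0"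
proof -
  interpret M: prob_space M by fact
  interpret N: prob_space N by fact
  interpret P: pair_prob_space M N ..
  have "sets (M \<Otimes>\<^sub>M N) = sets ((borel :: 'a measure) \<Otimes>\<^sub>M (borel :: 'b measure))" by (rule sets_pair_measure_cong) fact+
  then have sP: "sets (M \<Otimes>\<^sub>M N) = sets borel" unfolding borel_prod .
  show fm: "f \<in> borel_measurable (M \<Otimes>\<^sub>M N)"
    unfolding measurable_cong_sets[OF sP refl] by (rule borel_measurable_continuous_onI[OF f])
  show "prob_space (distr (M \<Otimes>\<^sub>M N) borel f)" by (rule P.prob_space_distr[OF fm])
  show K: "compact (f ` (A \<times> B))"
    using A(1) B(1) by (intro compact_continuous_image compact_Times continuous_on_subset[OF f]) auto
  have cl: "- A \<in> sets M" "- B \<in> sets N" using A(1) B(1) by (auto simp: sM sN compact_imp_closed)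
  have U: "UNIV \<in> sets M" "UNIV \<in> sets N" by (auto simp: sM sN)
  have "emeasure (distr (M \<Otimes>\<^sub>M N) borel f) (- (f ` (A \<times> B))) = emeasure (M \<Otimes>\<^sub>M N) (f -` (- (f ` (A \<times> B))) \<inter> space (M \<Otimes>\<^sub>M N))"
    using K by (intro emeasure_distr[OF fm]) (auto simp: compact_imp_closed)
  also have "\<dots> \<le> emeasure (M \<Otimes>\<^sub>M N) ((- A) \<times> UNIV \<union> UNIV \<times> (- B))"
    using cl U by (intro emeasure_mono) auto
  also have "\<dots> \<le> emeasure (M \<Otimes>\<^sub>M N) ((- A) \<times> UNIV) + emeasure (M \<Otimes>\<^sub>M N) (UNIV \<times> (- B))"
    using cl U by (intro emeasure_subadditive) auto
  also have "\<dots> = 0"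
    using cl U A B by (simp add: N.emeasure_pair_measure_Times)
  finally show "emeasure (distr (M \<Otimes>\<^sub>M N) borel f) (- (f ` (A \<times> B))) = 0" by simp
qed

lemma measurable_transpose_mult: "(\<lambda>g :: real^'n^'n. transpose g *v \<xi>) \<in> borel_measurable borel"
proof (rule borel_measurable_continuous_onI)
  have "(\<lambda>g :: real^'n^'n. transpose g *v \<xi>) = (\<lambda>g. \<chi> i. \<Sum>j\<in>UNIV. g $ j $ i * \<xi> $ j)"
    by (simp add: fun_eq_iff vec_eq_iff matrix_vector_mult_def transpose_def)
  then show "continuous_on UNIV (\<lambda>g :: real^'n^'n. transpose g *v \<xi>)"
    by (simp only:) (intro continuous_intros)
qed

lemma continuous_on_matrix_mult_pair: "continuous_on UNIV (\<lambda>p :: (real^'n^'n) \<times> (real^'n). fst p *v snd p)"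
  unfolding matrix_vector_mult_def by (intro continuous_intros)

lemma inner_matrix_vector_transpose: "\<xi> \<bullet> (g *v x) = (transpose g *v \<xi>) \<bullet> (x :: real^'n)"
  by (simp add: transpose_matrix_vector dot_lmul_matrix)

text \<open>Rotating a vector \<open>\<xi>\<close> by \<open>\<theta>\<close>-random orthogonal matrices yields a measure on the sphere of
  radius \<open>norm \<xi>\<close> of dimension \<open>t - (d - 1) * (d - 2) / 2\<close>; this bounds its convolution with a Gaussian.\<close>

lemma rotation_kernel_bound:
  fixes \<theta> :: "(real^'n^'n) measure"
  assumes "prob_space \<theta>" and s [measurable_cong]: "sets \<theta> = sets borel"
    and K: "compact K" "K \<subseteq> {g. orthogonal_matrix g}" "emeasure \<theta> (- K) = 0"
    and t: "t \<ge> 0" and B: "B > 0" and ball: "\<And>x r. r > 0 \<Longrightarrow> emeasure \<theta> (cball x r) \<le> ennreal (B * r powr t)"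
    and \<beta>: "\<beta> = t - (real CARD('n) - 1) * (real CARD('n) - 2) / 2" "\<beta> \<ge> 0"
  obtains A where "A > 0" "\<And>\<xi> x. norm \<xi> \<ge> 1 \<Longrightarrow>
    (\<integral>\<^sup>+g. ennreal (exp (- pi * (norm (x - transpose g *v \<xi>))\<^sup>2)) \<partial>\<theta>)
      \<le> ennreal (A * norm \<xi> powr (- \<beta>)) * ennreal (exp (- (pi / 2) * (norm x - norm \<xi>)\<^sup>2))"
proof -
  interpret prob_space \<theta> by fact
  note measurable_transpose_mult [measurable]
  have sp: "space \<theta> = UNIV" by (rule space_eq_UNIV_borel[OF s])
  have cK: "- K \<in> sets \<theta>" using K(1) by (auto simp: s compact_imp_closed)
  have K': "K \<in> sets \<theta>" using K(1) by (auto simp: s compact_imp_closed)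
  have AEK: "AE g in \<theta>. g \<in> K"
    by (rule AE_I'[of "- K"]) (use cK K(3) in \<open>auto simp: null_sets_def\<close>)
  obtain C where C: "C > 0" and orbit: "\<And>S \<xi> w \<rho>. norm \<xi> = 1 \<Longrightarrow> 0 < \<rho> \<Longrightarrow> \<rho> \<le> 1 \<Longrightarrow>
    S \<subseteq> {g. orthogonal_matrix g \<and> norm (transpose g *v \<xi> - w) \<le> \<rho>} \<Longrightarrow>
    emeasure \<theta> S \<le> ennreal (C * \<rho> powr (t - (real CARD('n) - 1) * (real CARD('n) - 2) / 2))"
  proof (rule orthogonal_orbit_measure[OF s t B ball])
    fix C assume "C > 0" "\<And>S \<xi> w \<rho>. norm \<xi> = 1 \<Longrightarrow> 0 < \<rho> \<Longrightarrow> \<rho> \<le> 1 \<Longrightarrow>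
    S \<subseteq> {g. orthogonal_matrix g \<and> norm (transpose g *v \<xi> - w) \<le> \<rho>} \<Longrightarrow>
    emeasure \<theta> S \<le> ennreal (C * \<rho> powr (t - (real CARD('n) - 1) * (real CARD('n) - 2) / 2))"
    then show thesis by (rule that)
  qed
  define C0 where "C0 = max C 1"
  show thesis
  proof (rule that)
    show "C0 * gauss_series \<beta> + 1 > 0" using gauss_series_nonneg[of \<beta>] by (simp add: C0_def add_nonneg_pos)
    fix \<xi> x :: "real^'n" assume \<xi>: "norm \<xi> \<ge> 1"
    define r where "r = norm \<xi>"
    have r: "r \<ge> 1" using \<xi> by (simp add: r_def)
    define u where "u g = norm (x - transpose g *v \<xi>)" for g
    have um [measurable]: "u \<in> borel_measurable \<theta>" unfolding u_def by measurable
    have lay: "emeasure \<theta> {g \<in> space \<theta>. u g \<le> real k + 1} \<le> ennreal (C0 * r powr (- \<beta>) * (real k + 1) powr \<beta>)" for k :: nat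
    proof -
      define S where "S = {g \<in> K. u g \<le> real k + 1}"
      \<comment> \<open>Rescaling \<xi> to a unit vector turns the distance k + 1 into
        \<rho>.\<close>
      define \<rho> where "\<rho> = (real k + 1) / r"
      have \<rho>: "\<rho> > 0" using r by (simp add: \<rho>_def)
      have "S = K \<inter> {g \<in> space \<theta>. u g \<le> real k + 1}" by (auto simp: S_def sp)
      then have Sm: "S \<in> sets \<theta>" using K' by simp
      have "emeasure \<theta> {g \<in> space \<theta>. u g \<le> real k + 1} \<le> emeasure \<theta> (S \<union> - K)"
        using Sm cK by (intro emeasure_mono) (auto simp: S_def)
      also have "\<dots> \<le> emeasure \<theta> S + emeasure \<theta> (- K)" by (rule emeasure_subadditive[OF Sm cK])
      also have "\<dots> = emeasure \<theta> S" using K(3) by simp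
      also have "\<dots> \<le> ennreal (C0 * \<rho> powr \<beta>)"
      proof (cases "\<rho> \<le> 1")
        case True
        have "S \<subseteq> {g. orthogonal_matrix g \<and> norm (transpose g *v ((1 / r) *\<^sub>R \<xi>) - (1 / r) *\<^sub>R x) \<le> \<rho>}"
        proof safe
          fix g assume g: "g \<in> S"
          then show "orthogonal_matrix g" using K(2) by (auto simp: S_def)
          have "transpose g *v ((1 / r) *\<^sub>R \<xi>) - (1 / r) *\<^sub>R x = - ((1 / r) *\<^sub>R (x - transpose g *v \<xi>))"
            by (simp add: matrix_vector_mult_scaleR scaleR_diff_right)
          then have "norm (transpose g *v ((1 / r) *\<^sub>R \<xi>) - (1 / r) *\<^sub>R x) = u g / r"
            using r by (simp add: u_def del: scaleR_diff_right)
          also have "\<dots> \<le> \<rho>" using g r by (simp add: S_def \<rho>_def divide_right_mono)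
          finally show "norm (transpose g *v ((1 / r) *\<^sub>R \<xi>) - (1 / r) *\<^sub>R x) \<le> \<rho>" .
        qed
        then have "emeasure \<theta> S \<le> ennreal (C * \<rho> powr \<beta>)"
          unfolding \<beta>(1) using r by (intro orbit[OF _ \<rho> True]) (auto simp: r_def)
        also have "\<dots> \<le> ennreal (C0 * \<rho> powr \<beta>)" by (intro ennreal_leI mult_right_mono) (auto simp: C0_def)
        finally show ?thesis .
      next
        case False
        \<comment> \<open>For \<rho> > 1 only the total mass is known; \<beta> >= 0 and
          \<open>C0 \<ge> 1\<close> make the same formula hold there.\<close>
        have "emeasure \<theta> S \<le> ennreal 1" using emeasure_le_1 by simp
        also have "\<dots> \<le> ennreal (C0 * \<rho> powr \<beta>)"
          using False \<beta>(2) mult_mono[of 1 C0 1 "\<rho> powr \<beta>"] ge_one_powr_ge_zero[of \<rho> \<beta>]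
          by (intro ennreal_leI) (auto simp: C0_def)
        finally show ?thesis .
      qed
      also have "C0 * \<rho> powr \<beta> = C0 * r powr (- \<beta>) * (real k + 1) powr \<beta>"
        using r by (simp add: \<rho>_def powr_divide powr_minus_divide)
      finally show ?thesis .
    qed
    have "(\<integral>\<^sup>+g. ennreal (exp (- pi * (u g)\<^sup>2)) \<partial>\<theta>) \<le>
      (\<integral>\<^sup>+g. ennreal (exp (- (pi / 2) * (norm x - r)\<^sup>2)) * ennreal (exp (- (pi / 2) * (u g)\<^sup>2)) \<partial>\<theta>)"
    proof (rule nn_integral_mono_AE)
      from AEK show "AE g in \<theta>. ennreal (exp (- pi * (u g)\<^sup>2)) \<le>
          ennreal (exp (- (pi / 2) * (norm x - r)\<^sup>2)) * ennreal (exp (- (pi / 2) * (u g)\<^sup>2))"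
      proof eventually_elim
        case (elim g)
        then have "orthogonal_matrix (transpose g)" using K(2) by auto
        then have "norm (transpose g *v \<xi>) = r" unfolding r_def by (rule norm_orthogonal_matrix_mult)
        \<comment> \<open>Orthogonal matrices keep \<xi> on the sphere of radius r, so
          \<open>u g\<close> is at least the distance of \<open>x\<close> from that sphere. Half of
          the exponent records this, and the other half is summed over layers.\<close>
        then have "\<bar>norm x - r\<bar> \<le> u g" using norm_triangle_ineq3[of x "transpose g *v \<xi>"] by (simp add: u_def)
        then have "(norm x - r)\<^sup>2 \<le> (u g)\<^sup>2" by (rule abs_le_square_iff[THEN iffD1, OF order_trans]) simp
        then have le: "pi * (norm x - r)\<^sup>2 \<le> pi * (u g)\<^sup>2" by (rule mult_left_mono) simp
        define X Y where "X = pi * (norm x - r)\<^sup>2" and "Y = pi * (u g)\<^sup>2"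
        have "- Y \<le> - (X / 2) + - (Y / 2)" using le unfolding X_def[symmetric] Y_def[symmetric] by linarith
        then have "exp (- Y) \<le> exp (- (X / 2)) * exp (- (Y / 2))" unfolding exp_add[symmetric] exp_le_cancel_iff .
        then have "exp (- pi * (u g)\<^sup>2) \<le> exp (- (pi / 2) * (norm x - r)\<^sup>2) * exp (- (pi / 2) * (u g)\<^sup>2)"
          by (simp add: X_def Y_def)
        then show ?case unfolding ennreal_mult[OF exp_ge_zero exp_ge_zero, symmetric] by (rule ennreal_leI)
      qed
    qed
    also have "\<dots> = ennreal (exp (- (pi / 2) * (norm x - r)\<^sup>2)) * (\<integral>\<^sup>+g. ennreal (exp (- (pi / 2) * (u g)\<^sup>2)) \<partial>\<theta>)"
      by (rule nn_integral_cmult) measurable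
    also have "\<dots> \<le> ennreal (exp (- (pi / 2) * (norm x - r)\<^sup>2)) * ennreal (C0 * r powr (- \<beta>) * gauss_series \<beta>)"
      by (intro mult_left_mono gauss_layer_bound lay) (auto simp: u_def C0_def)
    also have "\<dots> \<le> ennreal (exp (- (pi / 2) * (norm x - r)\<^sup>2)) * ennreal ((C0 * gauss_series \<beta> + 1) * r powr (- \<beta>))"
      by (intro mult_left_mono ennreal_leI) (auto simp: algebra_simps)
    finally show "(\<integral>\<^sup>+g. ennreal (exp (- pi * (norm (x - transpose g *v \<xi>))\<^sup>2)) \<partial>\<theta>)
      \<le> ennreal ((C0 * gauss_series \<beta> + 1) * norm \<xi> powr (- \<beta>)) * ennreal (exp (- (pi / 2) * (norm x - norm \<xi>)\<^sup>2))"
      by (simp only: u_def r_def mult.commute)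
  qed
qed

text \<open>The kernel contributes the exponent -\<beta> with \<beta> = t - (d - 1)(d - 2)/2, and
  the shell contributes d - 1 - \<alpha>. As (d - 1)(d - 2)/2 + (d - 1) = (d^2 - d)/2, these add up
  to the stated exponent. The assumption \<open>td\<close> says \<beta> >= 0.\<close>

theorem rotated_measure_decay:
  fixes \<mu> :: "(real^'n) measure" and \<theta> :: "(real^'n^'n) measure"
  assumes \<mu>: "\<mu> \<in> radon_measures_on E" and \<alpha>: "\<alpha> \<ge> 0" and C: "C > 0"
    and sph: "\<And>r. r > 0 \<Longrightarrow> spherical_average \<mu> r \<le> ennreal (C * r powr (- \<alpha>))"
    and p\<theta>: "prob_space \<theta>" and s\<theta> [measurable_cong]: "sets \<theta> = sets borel"
    and K: "compact K" "K \<subseteq> G" "emeasure \<theta> (- K) = 0" and G: "G \<subseteq> {g. orthogonal_matrix g}"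
    and t: "t \<ge> 0" and B: "B > 0" and ball: "\<And>x r. r > 0 \<Longrightarrow> emeasure \<theta> (cball x r) \<le> ennreal (B * r powr t)"
    and d: "d = real CARD('n)" and td: "t \<ge> (d - 1) * (d - 2) / 2"
  obtains \<nu> L D where "prob_space \<nu>" "sets \<nu> = sets borel" "compact L" "L \<subseteq> group_image G E" "emeasure \<nu> (- L) = 0"
    "D > 0" "\<And>\<xi>. (norm (fourier_transform \<nu> \<xi>))\<^sup>2 \<le> D * (1 + norm \<xi>) powr (- (\<alpha> + t - (d\<^sup>2 - d) / 2))"
proof -
  obtain KE where s\<mu> [measurable_cong]: "sets \<mu> = sets borel" and fin: "finite_measure \<mu>"
    and KE: "compact KE" "KE \<subseteq> E" "emeasure \<mu> (- KE) = 0" and nz: "emeasure \<mu> UNIV \<noteq> 0"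
    using radon_measures_onE[OF \<mu>] .
  interpret \<mu>: finite_measure \<mu> by fact
  interpret \<theta>: prob_space \<theta> by fact
  note measF = borel_measurable_fourier_transform[OF \<mu>.sigma_finite_measure_axioms s\<mu>, measurable]
  note measurable_transpose_mult [measurable]
  define \<gamma> where "\<gamma> x = exp (- pi * (norm x)\<^sup>2)" for x :: "real^'n"
  have \<gamma>m [measurable]: "\<gamma> \<in> borel_measurable borel" unfolding \<gamma>_def by measurable
  have sp\<mu>: "space \<mu> = UNIV" by (rule space_eq_UNIV_borel[OF s\<mu>])
  \<comment> \<open>The Gaussian is positive and at most 1, so \<open>c\<close> is positive and
    finite; the normalised weighted measure still gives no mass to the complement of
    \<open>KE\<close>.\<close>
  define c where "c = enn2real (\<integral>\<^sup>+x. ennreal (\<gamma> x) \<partial>\<mu>)"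
  have cfin: "(\<integral>\<^sup>+x. ennreal (\<gamma> x) \<partial>\<mu>) < \<infinity>"
  proof -
    have "(\<integral>\<^sup>+x. ennreal (\<gamma> x) \<partial>\<mu>) \<le> (\<integral>\<^sup>+x. 1 \<partial>\<mu>)"
      by (intro nn_integral_mono) (simp add: \<gamma>_def)
    also have "\<dots> < \<infinity>" using \<mu>.emeasure_finite by (simp add: less_top[symmetric])
    finally show ?thesis .
  qed
  have cnz: "(\<integral>\<^sup>+x. ennreal (\<gamma> x) \<partial>\<mu>) \<noteq> 0"
  proof
    assume "(\<integral>\<^sup>+x. ennreal (\<gamma> x) \<partial>\<mu>) = 0"
    then have "AE x in \<mu>. ennreal (\<gamma> x) = 0" by (subst (asm) nn_integral_0_iff_AE) auto
    then have "AE x in \<mu>. False" by (simp add: \<gamma>_def)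
    then have "emeasure \<mu> (space \<mu>) = 0" by (subst (asm) AE_iff_measurable[of "space \<mu>"]) auto
    then show False using nz sp\<mu> by simp
  qed
  have c: "(\<integral>\<^sup>+x. ennreal (\<gamma> x) \<partial>\<mu>) = ennreal c" "c > 0"
    using cfin cnz by (auto simp: c_def less_top enn2real_positive_iff zero_less_iff_neq_zero)
  define \<mu>1 where "\<mu>1 = density \<mu> (\<lambda>x. ennreal (\<gamma> x / c))"
  have s\<mu>1 [measurable_cong]: "sets \<mu>1 = sets borel" by (simp add: \<mu>1_def s\<mu>)
  have p\<mu>1: "prob_space \<mu>1"
  proof (rule prob_spaceI)
    have "emeasure \<mu>1 (space \<mu>1) = (\<integral>\<^sup>+x. ennreal (\<gamma> x / c) \<partial>\<mu>)"
      by (simp add: \<mu>1_def emeasure_density sp\<mu> cong: nn_integral_cong)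
    also have "\<dots> = (\<integral>\<^sup>+x. ennreal (1 / c) * ennreal (\<gamma> x) \<partial>\<mu>)"
      using c(2) by (intro nn_integral_cong) (simp add: \<gamma>_def flip: ennreal_mult)
    also have "\<dots> = ennreal (1 / c) * ennreal c" unfolding c(1)[symmetric] by (rule nn_integral_cmult) measurable
    also have "\<dots> = 1" using c(2) by (simp flip: ennreal_mult)
    finally show "emeasure \<mu>1 (space \<mu>1) = 1" .
  qed
  interpret \<mu>1: prob_space \<mu>1 by fact
  note measF1 = borel_measurable_fourier_transform[OF \<mu>1.sigma_finite_measure_axioms s\<mu>1, measurable]
  have KE1: "emeasure \<mu>1 (- KE) = 0"
  proof -
    have "- KE \<in> sets \<mu>" using KE(1) by (auto simp: s\<mu> compact_imp_closed)
    then have "- KE \<in> null_sets \<mu>" using KE(3) by (simp add: null_sets_def)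
    then have "- KE \<in> null_sets \<mu>1"
      unfolding \<mu>1_def by (subst null_sets_density_iff) (auto simp: null_sets_def AE_iff_null intro: AE_not_in[THEN AE_mp])
    then show ?thesis by (simp add: null_sets_def)
  qed
  have FT1: "ennreal ((norm (fourier_transform \<mu>1 \<xi>))\<^sup>2) \<le> ennreal (1 / c\<^sup>2) *
      (\<integral>\<^sup>+x. ennreal ((norm (fourier_transform \<mu> x))\<^sup>2) * ennreal (exp (- pi * (norm (x - \<xi>))\<^sup>2)) \<partial>lborel)" for \<xi>
  proof -
    have "fourier_transform \<mu>1 \<xi> = (LINT x|\<mu>. (\<gamma> x / c) *\<^sub>R cis (- (2 * pi * (\<xi> \<bullet> x))))"
      unfolding fourier_transform_cis \<mu>1_def using c(2) by (intro integral_density) (auto simp: \<gamma>_def)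
    also have "\<dots> = (LINT x|\<mu>. (1 / c) *\<^sub>R (\<gamma> x *\<^sub>R cis (- (2 * pi * (\<xi> \<bullet> x)))))" by simp
    also have "\<dots> = (1 / c) *\<^sub>R (LINT x|\<mu>. \<gamma> x *\<^sub>R cis (- (2 * pi * (\<xi> \<bullet> x))))" by (rule integral_scaleR_right)
    also have "(LINT x|\<mu>. \<gamma> x *\<^sub>R cis (- (2 * pi * (\<xi> \<bullet> x)))) = fourier_transform (density \<mu> (\<lambda>x. ennreal (\<gamma> x))) \<xi>"
      unfolding fourier_transform_cis by (intro integral_density[symmetric]) (auto simp: \<gamma>_def)
    finally have eq: "(norm (fourier_transform \<mu>1 \<xi>))\<^sup>2 = 1 / c\<^sup>2 * (norm (fourier_transform (density \<mu> (\<lambda>x. ennreal (\<gamma> x))) \<xi>))\<^sup>2"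
      using c(2) by (simp add: power_mult_distrib power_divide)
    have "ennreal ((norm (fourier_transform \<mu>1 \<xi>))\<^sup>2) = ennreal (1 / c\<^sup>2) * ennreal ((norm (fourier_transform (density \<mu> (\<lambda>x. ennreal (\<gamma> x))) \<xi>))\<^sup>2)"
      unfolding eq by (rule ennreal_mult) auto
    then show ?thesis
      using fourier_gaussian_smoothing[OF fin s\<mu>, of \<xi>] unfolding \<gamma>_def by (simp add: mult_left_mono)
  qed
  define f where "f p = fst p *v snd p" for p :: "(real^'n^'n) \<times> (real^'n)"
  define \<nu> where "\<nu> = distr (\<theta> \<Otimes>\<^sub>M \<mu>1) borel f"
  have fc: "continuous_on UNIV f" unfolding f_def by (rule continuous_on_matrix_mult_pair)
  note supp = distr_pair_support[OF p\<theta> p\<mu>1 s\<theta> s\<mu>1 K(1,3) KE(1) KE1 fc]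
  note fm [measurable] = supp(1)
  have sN: "sets \<nu> = sets borel" by (simp add: \<nu>_def)
  have pN: "prob_space \<nu>" using supp(2) by (simp add: \<nu>_def)
  have FT: "fourier_transform \<nu> \<xi> = (LINT g|\<theta>. fourier_transform \<mu>1 (transpose g *v \<xi>))" for \<xi>
  proof -
    interpret P: pair_prob_space \<theta> \<mu>1 ..
    have "fourier_transform \<nu> \<xi> = (LINT p|(\<theta> \<Otimes>\<^sub>M \<mu>1). cis (- (2 * pi * (\<xi> \<bullet> f p))))"
      unfolding fourier_transform_cis \<nu>_def by (rule integral_distr[OF fm]) measurable
    also have "\<dots> = (LINT g|\<theta>. LINT x|\<mu>1. cis (- (2 * pi * (\<xi> \<bullet> f (g, x)))))"
      by (rule P.integral_fst'[symmetric], rule P.integrable_const_bound[of _ 1]) auto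
    also have "\<dots> = (LINT g|\<theta>. fourier_transform \<mu>1 (transpose g *v \<xi>))"
      unfolding fourier_transform_cis f_def by (simp add: inner_matrix_vector_transpose)
    finally show ?thesis .
  qed
  define \<beta> where "\<beta> = t - (d - 1) * (d - 2) / 2"
  have \<beta>: "\<beta> \<ge> 0" using td by (simp add: \<beta>_def)
  define a where "a = \<alpha> + t - (d\<^sup>2 - d) / 2"
  have a_eq: "a = \<alpha> + \<beta> - (d - 1)" by (simp add: a_def \<beta>_def power2_eq_square field_simps)
  obtain A where A: "A > 0" and kernel: "\<And>\<xi> x. norm \<xi> \<ge> 1 \<Longrightarrow>
    (\<integral>\<^sup>+g. ennreal (exp (- pi * (norm (x - transpose g *v \<xi>))\<^sup>2)) \<partial>\<theta>)
      \<le> ennreal (A * norm \<xi> powr (- \<beta>)) * ennreal (exp (- (pi / 2) * (norm x - norm \<xi>)\<^sup>2))"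
  proof (rule rotation_kernel_bound[OF p\<theta> s\<theta> K(1) order_trans[OF K(2) G] K(3) t B ball \<beta>_def[unfolded d] \<beta>])
    fix A assume "A > 0" "\<And>\<xi> x. norm \<xi> \<ge> 1 \<Longrightarrow>
    (\<integral>\<^sup>+g. ennreal (exp (- pi * (norm (x - transpose g *v \<xi>))\<^sup>2)) \<partial>\<theta>)
      \<le> ennreal (A * norm \<xi> powr (- \<beta>)) * ennreal (exp (- (pi / 2) * (norm x - norm \<xi>)\<^sup>2))"
    then show thesis by (rule that)
  qed
  obtain D0 where D0: "D0 > 0" and shell: "\<And>r. r \<ge> 0 \<Longrightarrow>
    (\<integral>\<^sup>+x. ennreal (exp (- (pi / 2) * (norm x - r)\<^sup>2)) * ennreal ((norm (fourier_transform \<mu> x))\<^sup>2) \<partial>lborel)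
      \<le> ennreal (D0 * (1 + r) powr (real DIM(real^'n) - 1 - \<alpha>))"
  proof (rule spherical_shell_bound[OF fin s\<mu> \<alpha> C sph])
    fix D0 assume "D0 > 0" "\<And>r. r \<ge> 0 \<Longrightarrow>
    (\<integral>\<^sup>+x. ennreal (exp (- (pi / 2) * (norm x - r)\<^sup>2)) * ennreal ((norm (fourier_transform \<mu> x))\<^sup>2) \<partial>lborel)
      \<le> ennreal (D0 * (1 + r) powr (real DIM(real^'n) - 1 - \<alpha>))"
    then show thesis by (rule that)
  qed
  have dim: "real DIM(real^'n) = d" by (simp add: d)
  define D1 where "D1 = 1 / c\<^sup>2 * (A * (2 powr \<beta> * D0))"
  have D1: "D1 > 0" using A D0 c(2) by (simp add: D1_def)
  \<comment> \<open>The second entry covers norm \<xi> < 1, where the transform is bounded by 1 and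
    the weight is at least \<open>2 powr (- \<bar>a\<bar>)\<close>.\<close>
  define D where "D = max D1 (2 powr \<bar>a\<bar>)"
  have decay: "(norm (fourier_transform \<nu> \<xi>))\<^sup>2 \<le> D * (1 + norm \<xi>) powr (- a)" for \<xi>
  proof (cases "norm \<xi> \<ge> 1")
    case True
    define r where "r = norm \<xi>"
    have r: "r \<ge> 1" using True by (simp add: r_def)
    have n1: "norm (fourier_transform \<mu>1 \<eta>) \<le> 1" for \<eta>
      using norm_fourier_transform_le[OF \<mu>1.finite_measure_axioms s\<mu>1, of \<eta>] \<mu>1.measure_le_1 order_trans by blast
    have "ennreal ((norm (fourier_transform \<nu> \<xi>))\<^sup>2) \<le> (\<integral>\<^sup>+g. ennreal ((norm (fourier_transform \<mu>1 (transpose g *v \<xi>)))\<^sup>2) \<partial>\<theta>)"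
      unfolding FT by (rule \<theta>.norm_integral_sq_le[where B = 1]) (use n1 in auto)
    also have "\<dots> \<le> (\<integral>\<^sup>+g. ennreal (1 / c\<^sup>2) * (\<integral>\<^sup>+x. ennreal ((norm (fourier_transform \<mu> x))\<^sup>2) * ennreal (exp (- pi * (norm (x - transpose g *v \<xi>))\<^sup>2)) \<partial>lborel) \<partial>\<theta>)"
      by (intro nn_integral_mono FT1)
    also have "\<dots> = ennreal (1 / c\<^sup>2) * (\<integral>\<^sup>+g. (\<integral>\<^sup>+x. ennreal ((norm (fourier_transform \<mu> x))\<^sup>2) * ennreal (exp (- pi * (norm (x - transpose g *v \<xi>))\<^sup>2)) \<partial>lborel) \<partial>\<theta>)"
      by (rule nn_integral_cmult) measurable
    also have "(\<integral>\<^sup>+g. (\<integral>\<^sup>+x. ennreal ((norm (fourier_transform \<mu> x))\<^sup>2) * ennreal (exp (- pi * (norm (x - transpose g *v \<xi>))\<^sup>2)) \<partial>lborel) \<partial>\<theta>) =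
        (\<integral>\<^sup>+x. (\<integral>\<^sup>+g. ennreal ((norm (fourier_transform \<mu> x))\<^sup>2) * ennreal (exp (- pi * (norm (x - transpose g *v \<xi>))\<^sup>2)) \<partial>\<theta>) \<partial>lborel)"
    proof -
      have "pair_sigma_finite (lborel :: (real^'n) measure) \<theta>" ..
      then show ?thesis by (rule pair_sigma_finite.Fubini') measurable
    qed
    also have "\<dots> = (\<integral>\<^sup>+x. ennreal ((norm (fourier_transform \<mu> x))\<^sup>2) * (\<integral>\<^sup>+g. ennreal (exp (- pi * (norm (x - transpose g *v \<xi>))\<^sup>2)) \<partial>\<theta>) \<partial>lborel)"
      by (intro nn_integral_cong nn_integral_cmult) measurable
    also have "\<dots> \<le> (\<integral>\<^sup>+x. ennreal ((norm (fourier_transform \<mu> x))\<^sup>2) * (ennreal (A * r powr (- \<beta>)) * ennreal (exp (- (pi / 2) * (norm x - r)\<^sup>2))) \<partial>lborel)"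
      unfolding r_def by (intro nn_integral_mono mult_left_mono kernel True) simp
    also have "\<dots> = (\<integral>\<^sup>+x. ennreal (A * r powr (- \<beta>)) * (ennreal (exp (- (pi / 2) * (norm x - r)\<^sup>2)) * ennreal ((norm (fourier_transform \<mu> x))\<^sup>2)) \<partial>lborel)"
      by (simp only: mult_ac)
    also have "\<dots> = ennreal (A * r powr (- \<beta>)) * (\<integral>\<^sup>+x. ennreal (exp (- (pi / 2) * (norm x - r)\<^sup>2)) * ennreal ((norm (fourier_transform \<mu> x))\<^sup>2) \<partial>lborel)"
      by (rule nn_integral_cmult) measurable
    also have "\<dots> \<le> ennreal (A * r powr (- \<beta>)) * ennreal (D0 * (1 + r) powr (d - 1 - \<alpha>))"
      using shell[of r, unfolded dim] r by (intro mult_left_mono) auto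
    also have "\<dots> \<le> ennreal (A * (2 powr \<beta> * (1 + r) powr (- \<beta>))) * ennreal (D0 * (1 + r) powr (d - 1 - \<alpha>))"
    proof (intro mult_right_mono ennreal_leI mult_left_mono)
      \<comment> \<open>For r >= 1 one has (1 + r)/2 <= r; this is the origin of
        \<open>2 powr \<beta>\<close> in \<open>D1\<close>.\<close>
      have "r powr (- \<beta>) \<le> ((1 + r) / 2) powr (- \<beta>)" using r \<beta> by (intro powr_mono2') auto
      also have "\<dots> = 2 powr \<beta> * (1 + r) powr (- \<beta>)" using r by (simp add: powr_divide powr_minus_divide)
      finally show "r powr (- \<beta>) \<le> 2 powr \<beta> * (1 + r) powr (- \<beta>)" .
    qed (use A in auto)
    finally have "ennreal ((norm (fourier_transform \<nu> \<xi>))\<^sup>2) \<le>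
        ennreal (1 / c\<^sup>2) * (ennreal (A * (2 powr \<beta> * (1 + r) powr (- \<beta>))) * ennreal (D0 * (1 + r) powr (d - 1 - \<alpha>)))"
      by (simp add: mult_left_mono)
    also have "\<dots> = ennreal (1 / c\<^sup>2 * (A * (2 powr \<beta> * (1 + r) powr (- \<beta>)) * (D0 * (1 + r) powr (d - 1 - \<alpha>))))"
      by (rule ennreal_mult3) (use A D0 in auto)
    also have "1 / c\<^sup>2 * (A * (2 powr \<beta> * (1 + r) powr (- \<beta>)) * (D0 * (1 + r) powr (d - 1 - \<alpha>))) =
        D1 * ((1 + r) powr (- \<beta>) * (1 + r) powr (d - 1 - \<alpha>))" by (simp add: D1_def mult_ac)
    also have "(1 + r) powr (- \<beta>) * (1 + r) powr (d - 1 - \<alpha>) = (1 + r) powr (- a)"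
      by (simp add: a_eq flip: powr_add) (simp add: algebra_simps)
    finally have "(norm (fourier_transform \<nu> \<xi>))\<^sup>2 \<le> D1 * (1 + r) powr (- a)"
      using D1 by (subst (asm) ennreal_le_iff) auto
    also have "\<dots> \<le> D * (1 + r) powr (- a)" by (intro mult_right_mono) (auto simp: D_def)
    finally show ?thesis by (simp add: r_def)
  next
    case False
    define r where "r = norm \<xi>"
    have r: "0 \<le> r" "r \<le> 1" using False by (auto simp: r_def)
    interpret L: prob_space \<nu> by (rule pN)
    have "norm (fourier_transform \<nu> \<xi>) \<le> 1"
      using norm_fourier_transform_le[OF L.finite_measure_axioms sN, of \<xi>] L.measure_le_1 order_trans by blast
    then have "(norm (fourier_transform \<nu> \<xi>))\<^sup>2 \<le> 1" by (simp add: power_le_one)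
    also have "1 = 2 powr \<bar>a\<bar> * 2 powr (- \<bar>a\<bar>)" by (simp flip: powr_add)
    also have "\<dots> \<le> 2 powr \<bar>a\<bar> * (1 + r) powr (- \<bar>a\<bar>)" using r by (intro mult_left_mono powr_mono2') auto
    also have "\<dots> \<le> 2 powr \<bar>a\<bar> * (1 + r) powr (- a)" using r by (intro mult_left_mono powr_mono) auto
    also have "\<dots> \<le> D * (1 + r) powr (- a)" by (intro mult_right_mono) (auto simp: D_def)
    finally show ?thesis by (simp add: r_def)
  qed
  show thesis
  proof (rule that[OF pN sN supp(3) _ _ _ decay[unfolded a_def]])
    show "f ` (K \<times> KE) \<subseteq> group_image G E" using K(2) KE(2) unfolding f_def group_image_def by force
    show "emeasure \<nu> (- (f ` (K \<times> KE))) = 0" using supp(4) by (simp add: \<nu>_def)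
    show "D > 0" using D1 by (simp add: D_def)
  qed
qed

section \<open>Energy estimates\<close>

lemma fourier_transform_sum:
  fixes M N :: "'a::euclidean_space measure"
  assumes pM: "prob_space M" and pN: "prob_space N" and sM [measurable_cong]: "sets M = sets borel"
    and sN [measurable_cong]: "sets N = sets borel"
  shows "fourier_transform (distr (M \<Otimes>\<^sub>M N) borel (\<lambda>p. fst p + snd p)) \<xi> = fourier_transform M \<xi> * fourier_transform N \<xi>"
proof -
  interpret M: prob_space M by fact
  interpret N: prob_space N by fact
  interpret P: pair_prob_space M N ..
  have "fourier_transform (distr (M \<Otimes>\<^sub>M N) borel (\<lambda>p. fst p + snd p)) \<xi> =
      (LINT p|(M \<Otimes>\<^sub>M N). cis (- (2 * pi * (\<xi> \<bullet> (fst p + snd p)))))"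
    unfolding fourier_transform_cis by (rule integral_distr) measurable
  also have "\<dots> = (LINT x|M. LINT y|N. cis (- (2 * pi * (\<xi> \<bullet> (fst (x, y) + snd (x, y))))))"
    by (rule P.integral_fst'[symmetric], rule P.integrable_const_bound[of _ 1]) auto
  also have "\<dots> = (LINT x|M. LINT y|N. cis (- (2 * pi * (\<xi> \<bullet> x))) * cis (- (2 * pi * (\<xi> \<bullet> y))))"
    by (simp add: cis_mult inner_add_right algebra_simps)
  also have "\<dots> = fourier_transform M \<xi> * fourier_transform N \<xi>"
    unfolding fourier_transform_cis by simp
  finally show ?thesis .
qed

lemma dyadic_floor:
  fixes x :: real
  assumes "x \<ge> 1"
  obtains k :: nat where "2 ^ k \<le> x" "x < 2 ^ Suc k"
proof -
  have "0 < 1 / x" "1 / x \<le> 1" using assms by auto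
  then obtain k :: nat where k: "1 / x \<le> 1 / 2 ^ k" "1 / 2 ^ k < 2 * (1 / x)" by (rule dyadic_scale)
  have "2 ^ k \<le> x" using k(1) assms by (simp add: field_simps)
  moreover have "x < 2 ^ Suc k" using k(2) assms by (simp add: field_simps)
  ultimately show thesis by (rule that)
qed

text \<open>By \<open>gaussian_energy\<close> the transform up to frequency R has energy at most of
  order R^(d - t). Summation over dyadic frequency ranges with weights 2^((u - d) k) gives a
  geometric series of ratio 2^(u - t) < 1.\<close>

lemma frostman_sobolev:
  fixes \<nu> :: "'a::euclidean_space measure"
  assumes "prob_space \<nu>" and s [measurable_cong]: "sets \<nu> = sets borel"
    and t: "t \<ge> 0" and B: "B > 0" and ball: "\<And>x r. r > 0 \<Longrightarrow> emeasure \<nu> (cball x r) \<le> ennreal (B * r powr t)"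
    and u: "u < t"
  shows "(\<integral>\<^sup>+x. ennreal ((norm (fourier_transform \<nu> x))\<^sup>2 * (1 + norm x) powr (u - real DIM('a))) \<partial>lborel) < \<infinity>"
proof -
  interpret prob_space \<nu> by fact
  have sp: "space \<nu> = UNIV" by (rule space_eq_UNIV_borel[OF s])
  note measF = borel_measurable_fourier_transform[OF sigma_finite_measure_axioms s, measurable]
  define d where "d = DIM('a)"
  define A where "A = B * gauss_series t"
  have A: "A \<ge> 0" using B gauss_series_nonneg[of t] by (simp add: A_def)
  define \<Phi> where "\<Phi> R = (\<integral>\<^sup>+\<xi>. ennreal ((norm (fourier_transform \<nu> \<xi>))\<^sup>2) * ennreal (exp (- pi * (norm \<xi> / R)\<^sup>2)) \<partial>lborel)" for R
  have \<Phi>: "\<Phi> R \<le> ennreal (R ^ d * (A * R powr (- t)))" if R: "R > 0" for R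
  proof -
    have "(\<integral>\<^sup>+y. ennreal (R ^ d * exp (- pi * (R * dist x y)\<^sup>2)) \<partial>\<nu>) \<le> ennreal (R ^ d * (A * R powr (- t)))" for x
    proof -
      have "(\<integral>\<^sup>+y. ennreal (R ^ d * exp (- pi * (R * dist x y)\<^sup>2)) \<partial>\<nu>) \<le>
          (\<integral>\<^sup>+y. ennreal (R ^ d) * ennreal (exp (- (pi / 2) * (R * dist x y)\<^sup>2)) \<partial>\<nu>)"
        using R by (intro nn_integral_mono) (auto simp flip: ennreal_mult intro!: ennreal_leI mult_left_mono)
      also have "\<dots> = ennreal (R ^ d) * (\<integral>\<^sup>+y. ennreal (exp (- (pi / 2) * (R * dist x y)\<^sup>2)) \<partial>\<nu>)"
        by (rule nn_integral_cmult) measurable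
      also have "\<dots> \<le> ennreal (R ^ d) * ennreal (B * R powr (- t) * gauss_series t)"
      proof (intro mult_left_mono gauss_layer_bound)
        fix k :: nat
        have "{y \<in> space \<nu>. R * dist x y \<le> real k + 1} = cball x ((real k + 1) / R)"
          using R by (auto simp: sp field_simps)
        then have "emeasure \<nu> {y \<in> space \<nu>. R * dist x y \<le> real k + 1} \<le> ennreal (B * ((real k + 1) / R) powr t)"
          using ball[of "(real k + 1) / R" x] R by simp
        also have "B * ((real k + 1) / R) powr t = B * R powr (- t) * (real k + 1) powr t"
          using R by (simp add: powr_divide powr_minus_divide)
        finally show "emeasure \<nu> {y \<in> space \<nu>. R * dist x y \<le> real k + 1} \<le> ennreal (B * R powr (- t) * (real k + 1) powr t)" .
      qed (use R B in auto)
      also have "\<dots> = ennreal (R ^ d * (A * R powr (- t)))"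
        using R B gauss_series_nonneg[of t] by (simp add: A_def mult_ac flip: ennreal_mult)
      finally show ?thesis .
    qed
    then have "\<Phi> R \<le> (\<integral>\<^sup>+x. ennreal (R ^ d * (A * R powr (- t))) \<partial>\<nu>)"
      unfolding \<Phi>_def gaussian_energy[OF prob_space_axioms s R] d_def by (intro nn_integral_mono) auto
    then show ?thesis using emeasure_space_1 by simp
  qed
  define q where "q = u - real d"
  \<comment> \<open>The first factor compares (1 + norm x)^q with 2^(q k) when 2^k <= 1 + norm x <
    2^(k + 1). The second compares the Gaussian at scale 2^k with 1 there, as norm x / 2^k <=
    2.\<close>
  define C where "C = 2 powr \<bar>q\<bar> * exp (4 * pi)"
  have C: "C > 0" by (simp add: C_def)
  let ?w = "\<lambda>x. ennreal ((norm (fourier_transform \<nu> x))\<^sup>2)"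
  let ?g = "\<lambda>k x. ennreal (2 powr (q * real k)) * (?w x * ennreal (exp (- pi * (norm x / 2 ^ k)\<^sup>2)))"
  have pt: "ennreal ((norm (fourier_transform \<nu> x))\<^sup>2 * (1 + norm x) powr q) \<le> ennreal C * (\<Sum>k. ?g k x)" for x
  proof -
    obtain k :: nat where k: "2 ^ k \<le> 1 + norm x" "1 + norm x < 2 ^ Suc k"
      by (rule dyadic_floor[of "1 + norm x"]) auto
    have "(1 + norm x) powr q \<le> 2 powr \<bar>q\<bar> * 2 powr (q * real k)"
    proof (cases "q \<ge> 0")
      case True
      have "(1 + norm x) powr q \<le> (2 ^ Suc k) powr q" using True k(2) by (intro powr_mono2) auto
      also have "\<dots> = 2 powr \<bar>q\<bar> * 2 powr (q * real k)"
        using True by (simp add: powr_realpow[symmetric] powr_powr powr_add[symmetric] algebra_simps del: power_Suc)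
      finally show ?thesis .
    next
      case False
      have "(1 + norm x) powr q \<le> (2 ^ k) powr q" using False k(1) by (intro powr_mono2') auto
      also have "\<dots> = 2 powr (q * real k)" by (simp add: powr_realpow[symmetric] powr_powr mult.commute)
      also have "\<dots> \<le> 2 powr \<bar>q\<bar> * 2 powr (q * real k)"
        using ge_one_powr_ge_zero[of 2 "\<bar>q\<bar>"] mult_right_mono[of 1 "2 powr \<bar>q\<bar>" "2 powr (q * real k)"] by simp
      finally show ?thesis .
    qed
    moreover have "1 \<le> exp (4 * pi) * exp (- pi * (norm x / 2 ^ k)\<^sup>2)"
    proof -
      have "norm x / 2 ^ k \<le> 2" using k(2) by (simp add: field_simps)
      then have "(norm x / 2 ^ k)\<^sup>2 \<le> 2\<^sup>2" by (intro power_mono) auto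
      then have "pi * (norm x / 2 ^ k)\<^sup>2 \<le> pi * 4" by (intro mult_left_mono) auto
      then have "0 \<le> 4 * pi + - pi * (norm x / 2 ^ k)\<^sup>2" by simp
      then show ?thesis unfolding exp_add[symmetric] by simp
    qed
    ultimately have "(1 + norm x) powr q * 1 \<le> (2 powr \<bar>q\<bar> * 2 powr (q * real k)) * (exp (4 * pi) * exp (- pi * (norm x / 2 ^ k)\<^sup>2))"
      by (intro mult_mono) auto
    then have "(norm (fourier_transform \<nu> x))\<^sup>2 * (1 + norm x) powr q \<le>
        (norm (fourier_transform \<nu> x))\<^sup>2 * ((2 powr \<bar>q\<bar> * 2 powr (q * real k)) * (exp (4 * pi) * exp (- pi * (norm x / 2 ^ k)\<^sup>2)))"
      by (intro mult_left_mono) auto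
    also have "\<dots> = C * (2 powr (q * real k) * ((norm (fourier_transform \<nu> x))\<^sup>2 * exp (- pi * (norm x / 2 ^ k)\<^sup>2)))"
      by (simp add: C_def mult_ac)
    finally have "ennreal ((norm (fourier_transform \<nu> x))\<^sup>2 * (1 + norm x) powr q) \<le>
        ennreal (C * (2 powr (q * real k) * ((norm (fourier_transform \<nu> x))\<^sup>2 * exp (- pi * (norm x / 2 ^ k)\<^sup>2))))"
      by (rule ennreal_leI)
    also have "\<dots> = ennreal C * ?g k x" using C by (simp add: ennreal_mult)
    also have "\<dots> \<le> ennreal C * (\<Sum>k. ?g k x)"
    proof (rule mult_left_mono)
      have "f k \<le> (\<Sum>k. f k)" for f :: "nat \<Rightarrow> ennreal" using sum_le_suminf[of f "{k}"] by simp
      from this[of "\<lambda>k. ?g k x"] show "?g k x \<le> (\<Sum>k. ?g k x)" .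
    qed simp
    finally show ?thesis .
  qed
  have "(\<integral>\<^sup>+x. ennreal ((norm (fourier_transform \<nu> x))\<^sup>2 * (1 + norm x) powr q) \<partial>lborel) \<le>
      (\<integral>\<^sup>+x. ennreal C * (\<Sum>k. ?g k x) \<partial>lborel)" by (intro nn_integral_mono pt)
  also have "\<dots> = ennreal C * (\<integral>\<^sup>+x. (\<Sum>k. ?g k x) \<partial>lborel)" by (rule nn_integral_cmult) measurable
  also have "(\<integral>\<^sup>+x. (\<Sum>k. ?g k x) \<partial>lborel) = (\<Sum>k. (\<integral>\<^sup>+x. ?g k x \<partial>lborel))" by (rule nn_integral_suminf) measurable
  also have "\<dots> = (\<Sum>k. ennreal (2 powr (q * real k)) * \<Phi> (2 ^ k))"
    unfolding \<Phi>_def by (intro suminf_cong nn_integral_cmult) measurable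
  also have "\<dots> \<le> (\<Sum>k. ennreal (A * (2 powr (u - t)) ^ k))"
  proof (intro suminf_le allI summableI)
    fix k :: nat
    have "ennreal (2 powr (q * real k)) * \<Phi> (2 ^ k) \<le> ennreal (2 powr (q * real k)) * ennreal ((2 ^ k) ^ d * (A * (2 ^ k) powr (- t)))"
      by (intro mult_left_mono \<Phi>) auto
    also have "\<dots> = ennreal (A * (2 powr (q * real k) * ((2 ^ k) ^ d * (2 ^ k) powr (- t))))"
      using A by (simp add: mult_ac flip: ennreal_mult)
    also have "2 powr (q * real k) * ((2 ^ k) ^ d * (2 ^ k) powr (- t)) = (2 powr (u - t)) ^ k"
    proof -
      have "(2 ^ k) ^ d = 2 powr (real d * real k)" by (simp add: powr_realpow[symmetric] powr_powr power_mult[symmetric] mult.commute)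
      moreover have "(2 ^ k) powr (- t) = 2 powr (- t * real k)" by (simp add: powr_realpow[symmetric] powr_powr mult.commute)
      moreover have "(2 powr (u - t)) ^ k = 2 powr ((u - t) * real k)" by (simp add: powr_realpow[symmetric] powr_powr)
      ultimately show ?thesis by (simp add: q_def powr_add[symmetric] algebra_simps)
    qed
    finally show "ennreal (2 powr (q * real k)) * \<Phi> (2 ^ k) \<le> ennreal (A * (2 powr (u - t)) ^ k)" .
  qed
  also have "\<dots> = ennreal (\<Sum>k. A * (2 powr (u - t)) ^ k)"
  proof (rule suminf_ennreal2)
    have "2 powr (u - t) < 2 powr 0" using u by (intro powr_less_mono) auto
    then show "summable (\<lambda>k. A * (2 powr (u - t)) ^ k)" by (intro summable_mult summable_geometric) simp
  qed (use A in simp)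
  finally have "(\<integral>\<^sup>+x. ennreal ((norm (fourier_transform \<nu> x))\<^sup>2 * (1 + norm x) powr q) \<partial>lborel) \<le>
      ennreal C * ennreal (\<Sum>k. A * (2 powr (u - t)) ^ k)" by (simp add: mult_left_mono)
  also have "\<dots> < \<infinity>" by (simp add: ennreal_mult_less_top)
  finally show ?thesis by (simp only: q_def d_def)
qed

section \<open>From Fourier energy to average ball masses\<close>

lemma emeasure_cball_nn_integral:
  fixes m :: "'a::euclidean_space measure"
  assumes s [measurable_cong]: "sets m = sets borel"
  shows "emeasure m (cball x r) = (\<integral>\<^sup>+y. (if dist x y \<le> r then 1 else 0) \<partial>m)"
proof -
  have "emeasure m (cball x r) = (\<integral>\<^sup>+y. indicator (cball x r) y \<partial>m)"
    by (rule nn_integral_indicator[symmetric]) (simp add: s)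
  also have "\<dots> = (\<integral>\<^sup>+y. (if dist x y \<le> r then 1 else 0) \<partial>m)" by (intro nn_integral_cong) (auto simp: indicator_def)
  finally show ?thesis .
qed

lemma borel_measurable_emeasure_cball:
  fixes m :: "'a::euclidean_space measure"
  assumes "prob_space m" and s [measurable_cong]: "sets m = sets borel"
  shows "(\<lambda>x. emeasure m (cball x r)) \<in> borel_measurable borel"
proof -
  interpret prob_space m by fact
  show ?thesis unfolding emeasure_cball_nn_integral[OF s] by measurable
qed

text \<open>The indicator of a ball of radius \<rho> is at most exp pi times a Gaussian of width
  \<rho>, whose double integral becomes, by \<open>gaussian_energy\<close>, a Fourier integral cut
  off at R = 1/\<rho>. Because \<open>u\<close> is at most d, the cut-off is dominated by a multiple
  of R^(d - u) times the Sobolev weight.\<close>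

lemma sobolev_ball_average:
  fixes m :: "'a::euclidean_space measure"
  assumes "prob_space m" and s [measurable_cong]: "sets m = sets borel"
    and u: "u \<le> real DIM('a)"
    and fin: "(\<integral>\<^sup>+x. ennreal ((norm (fourier_transform m x))\<^sup>2 * (1 + norm x) powr (u - real DIM('a))) \<partial>lborel) < \<infinity>"
  obtains C where "C > 0" "\<And>\<rho>. 0 < \<rho> \<Longrightarrow> \<rho> \<le> 1 \<Longrightarrow> (\<integral>\<^sup>+x. emeasure m (cball x \<rho>) \<partial>m) \<le> ennreal (C * \<rho> powr u)"
proof -
  interpret prob_space m by fact
  note measF = borel_measurable_fourier_transform[OF sigma_finite_measure_axioms s, measurable]
  define d where "d = DIM('a)"
  define q where "q = real d - u"
  have q: "q \<ge> 0" using u by (simp add: q_def d_def)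
  define I where "I = enn2real (\<integral>\<^sup>+x. ennreal ((norm (fourier_transform m x))\<^sup>2 * (1 + norm x) powr (- q)) \<partial>lborel)"
  have I: "(\<integral>\<^sup>+x. ennreal ((norm (fourier_transform m x))\<^sup>2 * (1 + norm x) powr (- q)) \<partial>lborel) = ennreal I"
    unfolding I_def using fin by (simp add: q_def d_def less_top)
  have I0: "I \<ge> 0" by (simp add: I_def)
  define E where "E = exp (q\<^sup>2 / pi)"
  have E: "E > 0" by (simp add: E_def)
  show thesis
  proof (rule that)
    show "exp pi * E * I + 1 > 0" using E I0 by (intro add_nonneg_pos) auto
    fix \<rho> :: real assume \<rho>: "0 < \<rho>" "\<rho> \<le> 1"
    define R where "R = 1 / \<rho>"
    have R: "R \<ge> 1" "R > 0" using \<rho> by (auto simp: R_def)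
    have "(\<integral>\<^sup>+x. emeasure m (cball x \<rho>) \<partial>m) \<le> (\<integral>\<^sup>+x. ennreal (exp pi * \<rho> ^ d) * (\<integral>\<^sup>+y. ennreal (R ^ d * exp (- pi * (R * dist x y)\<^sup>2)) \<partial>m) \<partial>m)"
    proof (rule nn_integral_mono)
      fix x
      have "(\<integral>\<^sup>+y. (if dist x y \<le> \<rho> then 1 else 0) \<partial>m) \<le> (\<integral>\<^sup>+y. ennreal (exp pi * \<rho> ^ d) * ennreal (R ^ d * exp (- pi * (R * dist x y)\<^sup>2)) \<partial>m)"
      proof (rule nn_integral_mono)
        fix y
        show "(if dist x y \<le> \<rho> then 1 else 0) \<le> ennreal (exp pi * \<rho> ^ d) * ennreal (R ^ d * exp (- pi * (R * dist x y)\<^sup>2))"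
        proof (cases "dist x y \<le> \<rho>")
          case True
          then have "R * dist x y \<le> 1" using \<rho> by (simp add: R_def)
          then have "(R * dist x y)\<^sup>2 \<le> 1" using R by (simp add: power_le_one)
          then have "pi * (R * dist x y)\<^sup>2 \<le> pi * 1" by (intro mult_left_mono) auto
          then have "0 \<le> pi + - pi * (R * dist x y)\<^sup>2" by simp
          then have "1 \<le> exp pi * exp (- pi * (R * dist x y)\<^sup>2)" unfolding exp_add[symmetric] by simp
          also have "\<dots> = (exp pi * \<rho> ^ d) * (R ^ d * exp (- pi * (R * dist x y)\<^sup>2))"
            using \<rho> by (simp add: R_def power_one_over)
          finally have "ennreal 1 \<le> ennreal ((exp pi * \<rho> ^ d) * (R ^ d * exp (- pi * (R * dist x y)\<^sup>2)))" by (rule ennreal_leI)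
          then show ?thesis using True R \<rho> by (simp only: ennreal_mult[symmetric] mult_nonneg_nonneg exp_ge_zero zero_le_power less_imp_le) (simp add: ennreal_mult)
        qed simp
      qed
      also have "\<dots> = ennreal (exp pi * \<rho> ^ d) * (\<integral>\<^sup>+y. ennreal (R ^ d * exp (- pi * (R * dist x y)\<^sup>2)) \<partial>m)"
        by (rule nn_integral_cmult) measurable
      finally show "emeasure m (cball x \<rho>) \<le> ennreal (exp pi * \<rho> ^ d) * (\<integral>\<^sup>+y. ennreal (R ^ d * exp (- pi * (R * dist x y)\<^sup>2)) \<partial>m)"
        unfolding emeasure_cball_nn_integral[OF s] .
    qed
    also have "\<dots> = ennreal (exp pi * \<rho> ^ d) * (\<integral>\<^sup>+x. (\<integral>\<^sup>+y. ennreal (R ^ d * exp (- pi * (R * dist x y)\<^sup>2)) \<partial>m) \<partial>m)"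
      by (rule nn_integral_cmult) measurable
    also have "(\<integral>\<^sup>+x. (\<integral>\<^sup>+y. ennreal (R ^ d * exp (- pi * (R * dist x y)\<^sup>2)) \<partial>m) \<partial>m) =
        (\<integral>\<^sup>+\<xi>. ennreal ((norm (fourier_transform m \<xi>))\<^sup>2) * ennreal (exp (- pi * (norm \<xi> / R)\<^sup>2)) \<partial>lborel)"
      unfolding d_def by (rule gaussian_energy[OF prob_space_axioms s R(2), symmetric])
    also have "\<dots> \<le> (\<integral>\<^sup>+\<xi>. ennreal (E * R powr q) * ennreal ((norm (fourier_transform m \<xi>))\<^sup>2 * (1 + norm \<xi>) powr (- q)) \<partial>lborel)"
    proof (rule nn_integral_mono)
      fix \<xi> :: 'a
      define v where "v = norm \<xi> / R"
      have v: "v \<ge> 0" using R by (simp add: v_def)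
      \<comment> \<open>This is where R >= 1, that is \<rho> <= 1, enters.\<close>
      have "1 + norm \<xi> \<le> R * (1 + v)" using R by (simp add: v_def algebra_simps)
      then have "(1 + norm \<xi>) powr q \<le> (R * (1 + v)) powr q" using q by (intro powr_mono2) auto
      also have "\<dots> = R powr q * (1 + v) powr q" using R v by (simp add: powr_mult)
      also have "\<dots> \<le> R powr q * (E * exp (pi / 4 * v\<^sup>2))"
        unfolding E_def by (intro mult_left_mono one_plus_powr_le_exp q v) simp
      also have "\<dots> \<le> R powr q * (E * exp (pi * v\<^sup>2))"
        using E by (intro mult_left_mono) auto
      finally have 1: "(1 + norm \<xi>) powr q \<le> E * R powr q * exp (pi * v\<^sup>2)" by (simp add: mult_ac)
      have "1 + norm \<xi> > 0" by (simp add: add_pos_nonneg)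
      then have p: "(1 + norm \<xi>) powr q > 0" by simp
      have "exp (- pi * v\<^sup>2) * (1 + norm \<xi>) powr q \<le> exp (- pi * v\<^sup>2) * (E * R powr q * exp (pi * v\<^sup>2))"
        using 1 by (intro mult_left_mono) auto
      also have "\<dots> = E * R powr q * (exp (- pi * v\<^sup>2) * exp (pi * v\<^sup>2))" by (simp only: mult_ac)
      also have "exp (- pi * v\<^sup>2) * exp (pi * v\<^sup>2) = 1" by (simp flip: exp_add)
      finally have "exp (- pi * v\<^sup>2) \<le> E * R powr q / (1 + norm \<xi>) powr q"
        using p by (simp add: pos_le_divide_eq)
      then have 2: "exp (- pi * v\<^sup>2) \<le> E * R powr q * (1 + norm \<xi>) powr (- q)" by (simp add: powr_minus_divide)
      have "(norm (fourier_transform m \<xi>))\<^sup>2 * exp (- pi * v\<^sup>2) \<le> (norm (fourier_transform m \<xi>))\<^sup>2 * (E * R powr q * (1 + norm \<xi>) powr (- q))"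
        using 2 by (intro mult_left_mono) auto
      also have "\<dots> = (E * R powr q) * ((norm (fourier_transform m \<xi>))\<^sup>2 * (1 + norm \<xi>) powr (- q))" by (simp only: mult_ac)
      finally have "ennreal ((norm (fourier_transform m \<xi>))\<^sup>2 * exp (- pi * v\<^sup>2)) \<le> ennreal ((E * R powr q) * ((norm (fourier_transform m \<xi>))\<^sup>2 * (1 + norm \<xi>) powr (- q)))"
        by (rule ennreal_leI)
      then show "ennreal ((norm (fourier_transform m \<xi>))\<^sup>2) * ennreal (exp (- pi * (norm \<xi> / R)\<^sup>2)) \<le> ennreal (E * R powr q) * ennreal ((norm (fourier_transform m \<xi>))\<^sup>2 * (1 + norm \<xi>) powr (- q))"
        using E unfolding v_def by (subst (1 2) ennreal_mult[symmetric]) auto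
    qed
    also have "\<dots> = ennreal (E * R powr q) * ennreal I" unfolding I[symmetric] by (rule nn_integral_cmult) measurable
    finally have "(\<integral>\<^sup>+x. emeasure m (cball x \<rho>) \<partial>m) \<le> ennreal (exp pi * \<rho> ^ d) * (ennreal (E * R powr q) * ennreal I)"
      by (simp add: mult_left_mono)
    also have "\<dots> = ennreal (exp pi * E * I * (\<rho> ^ d * R powr q))"
      using E I0 \<rho> R by (simp add: mult_ac flip: ennreal_mult)
    also have "\<rho> ^ d * R powr q = \<rho> powr u"
    proof -
      have "R powr q = \<rho> powr (- q)" using \<rho> by (simp add: R_def powr_divide powr_minus_divide)
      moreover have "\<rho> ^ d = \<rho> powr real d" using \<rho> by (simp add: powr_realpow)
      ultimately show ?thesis by (simp add: q_def flip: powr_add)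
    qed
    also have "ennreal (exp pi * E * I * \<rho> powr u) \<le> ennreal ((exp pi * E * I + 1) * \<rho> powr u)"
      by (intro ennreal_leI mult_right_mono) auto
    finally show "(\<integral>\<^sup>+x. emeasure m (cball x \<rho>) \<partial>m) \<le> ennreal ((exp pi * E * I + 1) * \<rho> powr u)" .
  qed
qed

section \<open>Hausdorff and Lebesgue measure of supports\<close>

text \<open>Mass distribution principle with the ball bound at centres in \<open>S\<close> only: a
  covering set that meets \<open>S\<close> lies in a ball about a point of \<open>S\<close> with its
  own diameter as radius. For v < u, diameters \<delta> <= 1 satisfy \<delta>^u <= \<delta>^v, so a
  small sum for \<open>v\<close> contradicts the positive mass of \<open>S\<close>.\<close>

lemma hausdorff_dim_ge_mass:
  fixes m :: "'a::euclidean_space measure"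
  assumes "prob_space m" and s: "sets m = sets borel" and S: "S \<in> sets m" "emeasure m S \<noteq> 0" "S \<subseteq> A"
    and u: "u > 0" and B: "B > 0"
    and ball: "\<And>x r. x \<in> S \<Longrightarrow> 0 < r \<Longrightarrow> r \<le> 1 \<Longrightarrow> emeasure m (cball x r) \<le> ennreal (B * r powr u)"
  shows "ereal u \<le> hausdorff_dim A"
  unfolding hausdorff_dim_def
proof (rule INF_greatest, rule ccontr)
  interpret prob_space m by fact
  fix v assume v: "v \<in> {s. 0 \<le> s \<and> hausdorff_measure s A = 0}" and "\<not> ereal u \<le> ereal v"
  then have vu: "0 \<le> v" "v < u" by auto
  define a where "a = measure m S"
  have a: "emeasure m S = ennreal a" "a > 0"
    using S(2) by (auto simp: a_def emeasure_eq_measure zero_less_measure_iff)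
  have "hausdorff_pre_measure v 1 A \<le> hausdorff_measure v A"
    unfolding hausdorff_measure_def by (rule SUP_upper) simp
  then have "hausdorff_pre_measure v 1 A < ennreal (a / B)" using v a B by simp
  then obtain U where cov: "A \<subseteq> (\<Union>i. U i)" and U: "\<And>i. bounded (U i)" "\<And>i. diameter (U i) \<le> 1"
    and sum: "(\<Sum>i::nat. diam_pow v (U i)) < ennreal (a / B)"
    unfolding hausdorff_pre_measure_def Inf_less_iff by auto
  have "\<exists>W. W \<in> sets m \<and> S \<inter> U i \<subseteq> W \<and> emeasure m W \<le> ennreal B * diam_pow v (U i)" for i
  proof (cases "S \<inter> U i = {}")
    case True
    then show ?thesis by (intro exI[of _ "{}"]) simp
  next
    case False
    then obtain x where x: "x \<in> S" "x \<in> U i" by blast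
    define \<delta> where "\<delta> = diameter (U i)"
    have \<delta>: "0 \<le> \<delta>" "\<delta> \<le> 1" using U diameter_ge_0[of "U i"] by (auto simp: \<delta>_def)
    have sub: "U i \<subseteq> cball x \<delta>"
      using diameter_bounded_bound[OF U(1)] x by (auto simp: \<delta>_def)
    show ?thesis
    proof (cases "\<delta> = 0")
      case False
      have "emeasure m (cball x \<delta>) \<le> ennreal (B * \<delta> powr u)" using ball[OF x(1)] \<delta> False by simp
      also have "\<dots> \<le> ennreal B * diam_pow v (U i)"
      proof (cases "v = 0")
        case True
        have "\<delta> powr u \<le> 1" using \<delta> u powr_le1[of u \<delta>] by simp
        then have "ennreal (B * \<delta> powr u) \<le> ennreal B" using B by (intro ennreal_leI) simp
        then show ?thesis using True x by (auto simp: diam_pow_def)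
      next
        case v0: False
        have "\<delta> powr u \<le> \<delta> powr v" using \<delta> vu False by (intro powr_mono') auto
        then have "ennreal (B * \<delta> powr u) \<le> ennreal (B * \<delta> powr v)" using B by (intro ennreal_leI) simp
        also have "\<dots> = ennreal B * ennreal (\<delta> powr v)" using B by (simp add: ennreal_mult)
        finally show ?thesis using v0 x by (auto simp: diam_pow_def \<delta>_def)
      qed
      finally show ?thesis using sub by (intro exI[of _ "cball x \<delta>"]) (auto simp: s)
    next
      case True
      \<comment> \<open>Sets of diameter 0 are treated apart, since the ball bound concerns positive
        radii: points of \<open>S\<close> have mass 0 because \<open>u > 0\<close>.\<close>
      have "emeasure m {x} \<le> 0 + ennreal e" if "e > 0" for e
      proof -
        define r where "r = min 1 ((e / B) powr (1 / u))"
        have r: "0 < r" "r \<le> 1" using that B by (auto simp: r_def)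
        have "r powr u \<le> ((e / B) powr (1 / u)) powr u" using u r by (intro powr_mono2) (auto simp: r_def)
        also have "\<dots> = e / B" using u that B by (simp add: powr_powr)
        finally have "B * r powr u \<le> e" using B by (simp add: field_simps)
        have "emeasure m {x} \<le> emeasure m (cball x r)" using r by (intro emeasure_mono) (auto simp: s)
        also have "\<dots> \<le> ennreal (B * r powr u)" by (rule ball[OF x(1) r])
        also have "\<dots> \<le> ennreal e" by (rule ennreal_leI) fact
        finally show ?thesis by simp
      qed
      then have "emeasure m {x} \<le> 0" by (rule ennreal_le_epsilon)
      then show ?thesis using sub True by (intro exI[of _ "{x}"]) (auto simp: s)
    qed
  qed
  then have "\<exists>W. \<forall>i. W i \<in> sets m \<and> S \<inter> U i \<subseteq> W i \<and> emeasure m (W i) \<le> ennreal B * diam_pow v (U i)"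
    by (intro choice allI)
  then obtain W where W: "\<And>i. W i \<in> sets m" "\<And>i. S \<inter> U i \<subseteq> W i"
    "\<And>i. emeasure m (W i) \<le> ennreal B * diam_pow v (U i)" by auto
  have "S \<subseteq> (\<Union>i. W i)"
  proof
    fix x assume x: "x \<in> S"
    then obtain i where "x \<in> U i" using cov S(3) by auto
    then show "x \<in> (\<Union>i. W i)" using W(2)[of i] x by auto
  qed
  moreover have "(\<Union>i. W i) \<in> sets m" using W(1) by (intro sets.countable_UN) auto
  ultimately have "emeasure m S \<le> emeasure m (\<Union>i. W i)" by (rule emeasure_mono)
  also have "\<dots> \<le> (\<Sum>i. emeasure m (W i))" using W(1) by (intro emeasure_subadditive_countably) auto
  also have "\<dots> \<le> (\<Sum>i. ennreal B * diam_pow v (U i))" by (intro suminf_le allI summableI W(3))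
  also have "\<dots> = ennreal B * (\<Sum>i. diam_pow v (U i))" by (rule ennreal_suminf_cmult)
  also have "\<dots> < ennreal B * ennreal (a / B)" using sum B by (intro ennreal_mult_strict_left_mono) auto
  also have "\<dots> = emeasure m S" using a B by (simp flip: ennreal_mult)
  finally show False by simp
qed

text \<open>An averaged bound with exponent \<open>w\<close> becomes a pointwise one with the
  smaller exponent \<open>u\<close>: \<open>V\<close> dominates the ratios of ball mass to radius^u
  at all dyadic radii and has finite integral because u < w, so it is bounded on a set of positive
  mass.\<close>

lemma hausdorff_dim_ge_ball_average:
  fixes m :: "'a::euclidean_space measure"
  assumes pm: "prob_space m" and s [measurable_cong]: "sets m = sets borel"
    and K: "compact K" "emeasure m (- K) = 0" "K \<subseteq> A" and u: "u > 0" "u < w" and C: "C > 0"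
    and avg: "\<And>\<rho>. 0 < \<rho> \<Longrightarrow> \<rho> \<le> 1 \<Longrightarrow> (\<integral>\<^sup>+x. emeasure m (cball x \<rho>) \<partial>m) \<le> ennreal (C * \<rho> powr w)"
  shows "ereal u \<le> hausdorff_dim A"
proof -
  interpret prob_space m by fact
  note bm = borel_measurable_emeasure_cball[OF pm s, measurable]
  have sp: "space m = UNIV" by (rule space_eq_UNIV_borel[OF s])
  define V where "V x = (\<Sum>k. ennreal (2 powr (u * real k)) * emeasure m (cball x (1 / 2 ^ k)))" for x
  have Vm [measurable]: "V \<in> borel_measurable m" unfolding V_def by measurable
  have "(\<integral>\<^sup>+x. V x \<partial>m) = (\<Sum>k. (\<integral>\<^sup>+x. ennreal (2 powr (u * real k)) * emeasure m (cball x (1 / 2 ^ k)) \<partial>m))"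
    unfolding V_def by (rule nn_integral_suminf) measurable
  also have "\<dots> = (\<Sum>k. ennreal (2 powr (u * real k)) * (\<integral>\<^sup>+x. emeasure m (cball x (1 / 2 ^ k)) \<partial>m))"
    by (intro suminf_cong nn_integral_cmult) measurable
  also have "\<dots> \<le> (\<Sum>k. ennreal (C * (2 powr (u - w)) ^ k))"
  proof (intro suminf_le allI summableI)
    fix k :: nat
    have "ennreal (2 powr (u * real k)) * (\<integral>\<^sup>+x. emeasure m (cball x (1 / 2 ^ k)) \<partial>m) \<le> ennreal (2 powr (u * real k)) * ennreal (C * (1 / 2 ^ k) powr w)"
      by (intro mult_left_mono avg) auto
    also have "\<dots> = ennreal (C * (2 powr (u * real k) * (1 / 2 ^ k) powr w))"
      using C by (simp add: mult_ac flip: ennreal_mult)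
    also have "2 powr (u * real k) * (1 / 2 ^ k) powr w = (2 powr (u - w)) ^ k"
    proof -
      have "(1 / 2 ^ k) powr w = 2 powr (- w * real k)"
        by (simp add: powr_divide powr_realpow[symmetric] powr_powr powr_minus_divide mult.commute)
      moreover have "(2 powr (u - w)) ^ k = 2 powr ((u - w) * real k)" by (simp add: powr_realpow[symmetric] powr_powr)
      ultimately show ?thesis by (simp add: powr_add[symmetric] algebra_simps)
    qed
    finally show "ennreal (2 powr (u * real k)) * (\<integral>\<^sup>+x. emeasure m (cball x (1 / 2 ^ k)) \<partial>m) \<le> ennreal (C * (2 powr (u - w)) ^ k)" .
  qed
  also have "\<dots> = ennreal (\<Sum>k. C * (2 powr (u - w)) ^ k)"
  proof (rule suminf_ennreal2)
    have "2 powr (u - w) < 2 powr 0" using u by (intro powr_less_mono) auto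
    then show "summable (\<lambda>k. C * (2 powr (u - w)) ^ k)" by (intro summable_mult summable_geometric) simp
  qed (use C in simp)
  finally have "(\<integral>\<^sup>+x. V x \<partial>m) \<le> ennreal (\<Sum>k. C * (2 powr (u - w)) ^ k)" .
  then have "(\<integral>\<^sup>+x. V x \<partial>m) \<noteq> \<infinity>" by (auto simp: top_unique)
  then have fin: "AE x in m. V x \<noteq> \<infinity>" by (intro nn_integral_PInf_AE) auto
  have "\<exists>L::nat. emeasure m {x \<in> space m. V x \<le> of_nat L} \<noteq> 0"
  proof (rule ccontr)
    assume "\<not> ?thesis"
    then have "AE x in m. \<not> V x \<le> of_nat L" for L :: nat
      by (subst AE_iff_measurable[of "{x \<in> space m. V x \<le> of_nat L}"]) auto
    then have "AE x in m. \<forall>L::nat. \<not> V x \<le> of_nat L" by (simp add: AE_all_countable)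
    with fin have "AE x in m. False"
    proof eventually_elim
      case (elim x)
      then obtain L :: nat where "V x < of_nat L" using ennreal_Ex_less_of_nat[of "V x"] by (auto simp: less_top)
      then show False using elim(2) less_imp_le by blast
    qed
    then show False by simp
  qed
  then obtain L :: nat where L: "emeasure m {x \<in> space m. V x \<le> of_nat L} \<noteq> 0" by blast
  define S where "S = {x \<in> space m. V x \<le> of_nat L} \<inter> K"
  have Km: "K \<in> sets m" "- K \<in> sets m" using K(1) by (auto simp: s compact_imp_closed)
  have Sm: "S \<in> sets m" unfolding S_def using Km(1) by measurable
  have S0: "emeasure m S \<noteq> 0"
  proof
    assume z: "emeasure m S = 0"
    have "emeasure m {x \<in> space m. V x \<le> of_nat L} \<le> emeasure m (S \<union> - K)"
      using Sm Km by (intro emeasure_mono) (auto simp: S_def)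
    also have "\<dots> \<le> emeasure m S + emeasure m (- K)" using Sm Km by (intro emeasure_subadditive) auto
    finally show False using z K(2) L by simp
  qed
  show ?thesis
  proof (rule hausdorff_dim_ge_mass[OF pm s Sm S0 _ u(1)])
    show "S \<subseteq> A" using K(3) by (auto simp: S_def)
    \<comment> \<open>\<open>L\<close> bounds \<open>V\<close> on \<open>S\<close>,
      \<open>2 powr u\<close> pays for rounding the radius up to a dyadic one, and the 1 keeps the
      constant positive.\<close>
    show "(real L + 1) * 2 powr u > 0" by simp
    fix x r assume x: "x \<in> S" and r: "0 < (r::real)" "r \<le> 1"
    obtain k :: nat where k: "r \<le> 1 / 2 ^ k" "1 / 2 ^ k < 2 * r" by (rule dyadic_scale[OF r])
    have V: "V x \<le> ennreal (real L)" using x by (simp add: S_def ennreal_of_nat_eq_real_of_nat)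
    have "ennreal (2 powr (u * real k)) * emeasure m (cball x (1 / 2 ^ k)) \<le> V x"
    proof -
      have "f k \<le> (\<Sum>k. f k)" for f :: "nat \<Rightarrow> ennreal" using sum_le_suminf[of f "{k}"] by simp
      from this[of "\<lambda>k. ennreal (2 powr (u * real k)) * emeasure m (cball x (1 / 2 ^ k))"] show ?thesis unfolding V_def .
    qed
    also note V
    finally have "ennreal (2 powr (u * real k) * measure m (cball x (1 / 2 ^ k))) \<le> ennreal (real L)"
      by (simp add: emeasure_eq_measure ennreal_mult)
    then have "2 powr (u * real k) * measure m (cball x (1 / 2 ^ k)) \<le> real L" by simp
    then have "2 powr (- (u * real k)) * (2 powr (u * real k) * measure m (cball x (1 / 2 ^ k))) \<le> 2 powr (- (u * real k)) * real L"
      by (intro mult_left_mono) auto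
    then have 1: "measure m (cball x (1 / 2 ^ k)) \<le> real L * 2 powr (- (u * real k))"
      by (simp add: mult.assoc[symmetric] powr_add[symmetric] mult.commute)
    have "2 powr (- (u * real k)) = (1 / 2 ^ k) powr u"
      by (simp add: powr_divide powr_realpow[symmetric] powr_powr powr_minus_divide mult.commute)
    also have "\<dots> \<le> (2 * r) powr u" using k(2) u by (intro powr_mono2) auto
    also have "\<dots> = 2 powr u * r powr u" using r by (simp add: powr_mult)
    finally have "real L * 2 powr (- (u * real k)) \<le> (real L + 1) * (2 powr u * r powr u)" by (intro mult_mono) auto
    then have 2: "measure m (cball x (1 / 2 ^ k)) \<le> (real L + 1) * 2 powr u * r powr u" using 1 by (simp add: mult.assoc)
    have "emeasure m (cball x r) \<le> emeasure m (cball x (1 / 2 ^ k))"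
      using k(1) by (intro emeasure_mono subset_cball) (auto simp: s)
    also have "\<dots> \<le> ennreal ((real L + 1) * 2 powr u * r powr u)" using 2 by (simp add: emeasure_eq_measure ennreal_leI)
    finally show "emeasure m (cball x r) \<le> ennreal ((real L + 1) * 2 powr u * r powr u)" .
  qed
qed

text \<open>The functions \<open>x \<mapsto> m (cball x r) / r ^ d\<close> have constant integral and bounded \<open>L\<^sup>2\<close> norm, so they
  cannot concentrate on sets of small Lebesgue measure.\<close>

lemma lborel_pos_ball_average:
  fixes m :: "'a::euclidean_space measure"
  assumes pm: "prob_space m" and s [measurable_cong]: "sets m = sets borel"
    and K: "compact K" "emeasure m (- K) = 0" and C: "C > 0"
    and avg: "\<And>\<rho>. 0 < \<rho> \<Longrightarrow> \<rho> \<le> 1 \<Longrightarrow> (\<integral>\<^sup>+x. emeasure m (cball x \<rho>) \<partial>m) \<le> ennreal (C * \<rho> powr real DIM('a))"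
  shows "emeasure lborel K > 0"
proof (rule ccontr)
  assume "\<not> ?thesis"
  then have z: "emeasure lborel K = 0" by simp
  interpret prob_space m by fact
  note bm = borel_measurable_emeasure_cball[OF pm s, measurable]
  have sp: "space m = UNIV" by (rule space_eq_UNIV_borel[OF s])
  have F1: "pair_sigma_finite m (lborel :: 'a measure)" ..
  have F2: "pair_sigma_finite (lborel :: 'a measure) m" ..
  define d where "d = DIM('a)"
  define V where "V = unit_ball_vol (real d)"
  have V: "V > 0" by (simp add: V_def)
  have vol: "emeasure lborel (cball x r) = ennreal (V * r ^ d)" if "r \<ge> 0" for x :: 'a and r
    unfolding V_def d_def by (rule emeasure_cball[OF that])
  \<comment> \<open>Chosen such that \<tau> C 2^d = 1/2: the quadratic term below accounts for at
    most half of the integral V r^d of \<open>f\<close>, and the other half is more than a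
    neighbourhood of measure below 2 \<tau> V can carry.\<close>
  define \<tau> where "\<tau> = 1 / (2 * (C * 2 ^ d))"
  have \<tau>: "\<tau> > 0" using C by (simp add: \<tau>_def)
  have Kb: "K \<in> sets borel" using K(1) by (auto simp: compact_imp_closed)
  obtain U where U: "open U" "K \<subseteq> U" "emeasure lborel (U - K) < ennreal (2 * \<tau> * V)"
    using outer_regular_lborel[OF Kb, of "2 * \<tau> * V"] \<tau> V by auto
  have "emeasure lborel U \<le> emeasure lborel ((U - K) \<union> K)" using U Kb by (intro emeasure_mono) auto
  also have "\<dots> \<le> emeasure lborel (U - K) + emeasure lborel K" using U Kb by (intro emeasure_subadditive) auto
  finally have Uless: "emeasure lborel U < ennreal (2 * \<tau> * V)" using U(3) z by simp
  define b where "b = enn2real (emeasure lborel U)"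
  have bU: "emeasure lborel U = ennreal b" unfolding b_def using Uless by (simp add: less_top order.strict_trans)
  have b0: "0 \<le> b" by (simp add: b_def)
  have b: "0 \<le> b" "b < 2 * \<tau> * V" using Uless b0 unfolding bU by (simp_all add: ennreal_less_iff)
  obtain r0 where r0: "r0 > 0" "(\<Union>x\<in>K. cball x r0) \<subseteq> U"
    using compact_subset_open_imp_cball_epsilon_subset[OF K(1) U(1,2)] by blast
  define r where "r = min r0 (1 / 2)"
  have r: "0 < r" "2 * r \<le> 1" "r \<le> r0" using r0 by (auto simp: r_def)
  define f where "f x = emeasure m (cball x r)" for x
  have fm [measurable]: "f \<in> borel_measurable borel" unfolding f_def by measurable
  let ?i = "\<lambda>x y :: 'a. (if dist x y \<le> r then 1 else 0 :: ennreal)"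
  have f_eq: "f x = (\<integral>\<^sup>+y. ?i x y \<partial>m)" for x unfolding f_def by (rule emeasure_cball_nn_integral[OF s])
  have icball: "(\<integral>\<^sup>+x. ?i x y \<partial>lborel) = ennreal (V * r ^ d)" for y
  proof -
    have "(\<integral>\<^sup>+x. ?i x y \<partial>lborel) = (\<integral>\<^sup>+x. indicator (cball y r) x \<partial>lborel)"
      by (intro nn_integral_cong) (auto simp: indicator_def dist_commute)
    then show ?thesis using r by (simp add: vol)
  qed
  have int1: "(\<integral>\<^sup>+x. f x \<partial>lborel) = ennreal (V * r ^ d)"
  proof -
    have "(\<integral>\<^sup>+x. f x \<partial>lborel) = (\<integral>\<^sup>+x. (\<integral>\<^sup>+y. ?i x y \<partial>m) \<partial>lborel)" by (simp only: f_eq)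
    also have "\<dots> = (\<integral>\<^sup>+y. (\<integral>\<^sup>+x. ?i x y \<partial>lborel) \<partial>m)"
      by (rule pair_sigma_finite.Fubini'[OF F1]) measurable
    also have "\<dots> = ennreal (V * r ^ d)" using emeasure_space_1 by (simp add: icball)
    finally show ?thesis .
  qed
  have int2: "(\<integral>\<^sup>+x. f x * f x \<partial>lborel) \<le> ennreal (V * r ^ d) * ennreal (C * (2 * r) powr real d)"
  proof -
    have "(\<integral>\<^sup>+x. f x * f x \<partial>lborel) = (\<integral>\<^sup>+x. (\<integral>\<^sup>+y. ?i x y * f x \<partial>m) \<partial>lborel)"
      unfolding f_eq by (intro nn_integral_cong nn_integral_multc[symmetric]) measurable
    also have "\<dots> = (\<integral>\<^sup>+y. (\<integral>\<^sup>+x. ?i x y * f x \<partial>lborel) \<partial>m)"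
      by (rule pair_sigma_finite.Fubini'[OF F1]) measurable
    also have "\<dots> \<le> (\<integral>\<^sup>+y. ennreal (V * r ^ d) * emeasure m (cball y (2 * r)) \<partial>m)"
    proof (rule nn_integral_mono)
      fix y
      have "(\<integral>\<^sup>+x. ?i x y * f x \<partial>lborel) \<le> (\<integral>\<^sup>+x. ?i x y * emeasure m (cball y (2 * r)) \<partial>lborel)"
      proof (rule nn_integral_mono)
        fix x
        show "?i x y * f x \<le> ?i x y * emeasure m (cball y (2 * r))"
        proof (cases "dist x y \<le> r")
          case True
          have "cball x r \<subseteq> cball y (2 * r)"
          proof
            fix z assume "z \<in> cball x r"
            then show "z \<in> cball y (2 * r)" using True dist_triangle[of y z x] by (simp add: dist_commute)
          qed
          then have "f x \<le> emeasure m (cball y (2 * r))" unfolding f_def by (intro emeasure_mono) (auto simp: s)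
          then show ?thesis using True by simp
        qed simp
      qed
      also have "\<dots> = ennreal (V * r ^ d) * emeasure m (cball y (2 * r))"
        by (subst nn_integral_multc) (auto simp: icball)
      finally show "(\<integral>\<^sup>+x. ?i x y * f x \<partial>lborel) \<le> ennreal (V * r ^ d) * emeasure m (cball y (2 * r))" .
    qed
    also have "\<dots> = ennreal (V * r ^ d) * (\<integral>\<^sup>+y. emeasure m (cball y (2 * r)) \<partial>m)"
      by (rule nn_integral_cmult) measurable
    also have "\<dots> \<le> ennreal (V * r ^ d) * ennreal (C * (2 * r) powr real d)"
      unfolding d_def using r by (intro mult_left_mono avg) auto
    finally show ?thesis .
  qed
  define c where "c = \<tau> / r ^ d"
  have c: "c > 0" using \<tau> r by (simp add: c_def)
  \<comment> \<open>\<open>f\<close> vanishes off \<open>U\<close>, since balls of radius r about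
    outside points miss \<open>K\<close>. On \<open>U\<close> the inequality p <= c p^2 + 1/(4 c), a
    completed square, takes the place of Cauchy-Schwarz.\<close>
  have pt: "f x \<le> ennreal c * (f x * f x) + ennreal (1 / (4 * c)) * indicator U x" for x
  proof (cases "x \<in> U")
    case True
    define p where "p = measure m (cball x r)"
    have "0 \<le> (2 * c * p - 1)\<^sup>2 / (4 * c)" using c by simp
    also have "\<dots> = c * (p * p) + 1 / (4 * c) - p" using c by (simp add: power2_eq_square field_simps)
    finally have "p \<le> c * (p * p) + 1 / (4 * c)" by simp
    then have "ennreal p \<le> ennreal (c * (p * p) + 1 / (4 * c))" by (rule ennreal_leI)
    also have "\<dots> = ennreal c * (ennreal p * ennreal p) + ennreal (1 / (4 * c))"
      using c by (simp add: p_def ennreal_mult)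
    finally show ?thesis using True by (simp add: f_def p_def emeasure_eq_measure)
  next
    case False
    have "cball x r \<subseteq> - K"
    proof
      fix y assume y: "y \<in> cball x r"
      show "y \<in> - K"
      proof
        assume "y \<in> K"
        moreover have "x \<in> cball y r0" using y r by (simp add: dist_commute)
        ultimately show False using r0 False by blast
      qed
    qed
    then have "f x \<le> emeasure m (- K)" unfolding f_def using Kb by (intro emeasure_mono) (auto simp: s)
    then show ?thesis using K(2) by simp
  qed
  have "ennreal (V * r ^ d) \<le> (\<integral>\<^sup>+x. ennreal c * (f x * f x) + ennreal (1 / (4 * c)) * indicator U x \<partial>lborel)"
    unfolding int1[symmetric] by (intro nn_integral_mono pt)
  also have "\<dots> = (\<integral>\<^sup>+x. ennreal c * (f x * f x) \<partial>lborel) + (\<integral>\<^sup>+x. ennreal (1 / (4 * c)) * indicator U x \<partial>lborel)"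
    using U(1) by (intro nn_integral_add) auto
  also have "(\<integral>\<^sup>+x. ennreal c * (f x * f x) \<partial>lborel) = ennreal c * (\<integral>\<^sup>+x. f x * f x \<partial>lborel)"
    by (rule nn_integral_cmult) measurable
  also have "(\<integral>\<^sup>+x. ennreal (1 / (4 * c)) * indicator U x \<partial>lborel) = ennreal (1 / (4 * c)) * emeasure lborel U"
    using U(1) by (intro nn_integral_cmult_indicator) auto
  also have "ennreal c * (\<integral>\<^sup>+x. f x * f x \<partial>lborel) + ennreal (1 / (4 * c)) * emeasure lborel U \<le>
      ennreal c * (ennreal (V * r ^ d) * ennreal (C * (2 * r) powr real d)) + ennreal (1 / (4 * c)) * ennreal b"
    unfolding bU by (intro add_mono mult_left_mono int2) auto
  also have "\<dots> = ennreal (c * ((V * r ^ d) * (C * (2 * r) powr real d)) + 1 / (4 * c) * b)"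
  proof -
    have "ennreal c * (ennreal (V * r ^ d) * ennreal (C * (2 * r) powr real d)) = ennreal (c * ((V * r ^ d) * (C * (2 * r) powr real d)))"
      by (rule ennreal_mult3) (use c V r C in auto)
    moreover have "ennreal (1 / (4 * c)) * ennreal b = ennreal (1 / (4 * c) * b)"
      by (rule ennreal_mult[symmetric]) (use c b in auto)
    ultimately show ?thesis using c V r C b by (simp only: ennreal_plus[symmetric] mult_nonneg_nonneg)
      (intro ennreal_plus[symmetric], auto)
  qed
  finally have le: "V * r ^ d \<le> c * ((V * r ^ d) * (C * (2 * r) powr real d)) + 1 / (4 * c) * b"
    using c V r C b by (subst (asm) ennreal_le_iff) auto
  define R where "R = r ^ d"
  have R: "R > 0" using r by (simp add: R_def)
  have pw: "(2 * r) powr real d = 2 ^ d * R" using r by (simp add: powr_realpow R_def power_mult_distrib)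
  have "V * R \<le> \<tau> / R * ((V * R) * (C * (2 ^ d * R))) + R / (4 * \<tau>) * b"
    using le unfolding pw c_def R_def[symmetric] by simp
  also have "\<tau> / R * ((V * R) * (C * (2 ^ d * R))) = (\<tau> * (C * 2 ^ d)) * (V * R)" using R by simp
  also have "\<tau> * (C * 2 ^ d) = 1 / 2" using C by (simp add: \<tau>_def)
  finally have "V * R / 2 \<le> R / (4 * \<tau>) * b" by simp
  also have "\<dots> < R / (4 * \<tau>) * (2 * \<tau> * V)" using b R \<tau> by (intro mult_strict_left_mono) auto
  also have "\<dots> = V * R / 2" using \<tau> by simp
  finally show False by simp
qed

text \<open>Capacitability is applied to the outer measure of \<open>f ` S\<close> as a function of \<open>S\<close>.\<close>

lemma lebesgue_continuous_image:
  fixes f :: "'a::euclidean_space \<Rightarrow> 'b::euclidean_space"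
  assumes f: "continuous_on UNIV f" and B: "B \<in> sets borel"
  shows "f ` B \<in> sets lebesgue"
proof -
  \<comment> \<open>Bounded images come first, because the outer measure must be finite for measures
    to be subtracted; \<open>E\<close> is a measurable hull of the image.\<close>
  have bdd: "f ` B \<in> sets lebesgue" if B: "B \<in> sets borel" and bB: "f ` B \<subseteq> cball 0 R" for B :: "'a set" and R
  proof -
    define c where "c S = outer_measure_of lborel (f ` S)" for S
    obtain E where E: "E \<in> sets lborel" "f ` B \<subseteq> E" "c B = emeasure lborel E"
      using outer_measure_of_attain[of "f ` B" lborel] by (auto simp: c_def)
    have "c B \<le> outer_measure_of lborel (cball 0 R :: 'b set)" unfolding c_def by (intro outer_measure_of_mono bB)
    also have "\<dots> = emeasure lborel (cball 0 R :: 'b set)" by (rule outer_measure_of_eq) simp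
    also have "\<dots> < \<infinity>" by (rule emeasure_lborel_cball_finite)
    finally have cfin: "c B < \<infinity>" .
    then obtain b where b: "c B = ennreal b" "b \<ge> 0" by (cases "c B") auto
    have mono: "c S \<le> c T" if "S \<subseteq> T" for S T unfolding c_def using that by (intro outer_measure_of_mono) auto
    have up: "c (\<Union>i. S i) \<le> (SUP i. c (S i))" if "incseq S" for S :: "nat \<Rightarrow> 'a set"
    proof -
      have "(SUP i. outer_measure_of lborel (f ` S i)) = outer_measure_of lborel (\<Union>i. f ` S i)"
        using that by (intro SUP_outer_measure_of_incseq) (auto simp: incseq_def)
      then show ?thesis by (simp add: c_def image_UN)
    qed
    have ex: "\<exists>D\<in>sets lborel. D \<subseteq> f ` B \<and> ennreal b \<le> emeasure lborel D + ennreal e" if e: "e > 0" for e :: real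
    proof (cases "b \<le> e")
      case True
      then show ?thesis by (intro bexI[of _ "{}"]) (auto intro: ennreal_leI)
    next
      case False
      have a: "ennreal (b - e) < c B" using e b False by (simp add: ennreal_less_iff)
      obtain K where K: "compact K" "K \<subseteq> B" and KU: "\<And>U. open U \<Longrightarrow> K \<subseteq> U \<Longrightarrow> ennreal (b - e) < c U"
      proof (rule capacitability[OF mono up B a])
        fix K assume "compact K" "K \<subseteq> B" "\<And>U. open U \<Longrightarrow> K \<subseteq> U \<Longrightarrow> ennreal (b - e) < c U"
        then show thesis by (rule that)
      qed
      have fK: "compact (f ` K)" using K(1) by (intro compact_continuous_image continuous_on_subset[OF f]) auto
      then have fKb: "f ` K \<in> sets borel" by (auto simp: compact_imp_closed)
      have "ennreal (b - e) \<le> emeasure lborel (f ` K)"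
      proof (rule ennreal_le_epsilon)
        fix e' :: real assume "e' > 0"
        then obtain V where V: "open V" "f ` K \<subseteq> V" "emeasure lborel (V - f ` K) < ennreal e'"
          using outer_regular_lborel[OF fKb] by blast
        \<comment> \<open>Capacitability controls open neighbourhoods of \<open>K\<close> in the
          source. The preimage of an open set around the image of \<open>K\<close> is such a
          neighbourhood, which bounds the measure of that image from below.\<close>
        have oV: "open (f -` V)" using f V(1) by (simp add: continuous_on_open_vimage)
        have "ennreal (b - e) \<le> c (f -` V)" using KU[OF oV] V(2) by (auto intro: less_imp_le)
        also have "\<dots> \<le> outer_measure_of lborel V" unfolding c_def by (intro outer_measure_of_mono) auto
        also have "\<dots> = emeasure lborel V" using V(1) by (intro outer_measure_of_eq) auto
        also have "\<dots> \<le> emeasure lborel (f ` K \<union> (V - f ` K))" using V(1) fKb by (intro emeasure_mono) auto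
        also have "\<dots> \<le> emeasure lborel (f ` K) + emeasure lborel (V - f ` K)"
          using V(1) fKb by (intro emeasure_subadditive) auto
        also have "\<dots> \<le> emeasure lborel (f ` K) + ennreal e'" using V(3) by (intro add_left_mono) simp
        finally show "ennreal (b - e) \<le> emeasure lborel (f ` K) + ennreal e'" .
      qed
      then have "ennreal (b - e) + ennreal e \<le> emeasure lborel (f ` K) + ennreal e" by (rule add_right_mono)
      moreover have "ennreal (b - e) + ennreal e = ennreal b" using e False by (simp flip: ennreal_plus)
      ultimately show ?thesis using fKb K(2) by (intro bexI[of _ "f ` K"]) auto
    qed
    have "\<forall>n. \<exists>D. D \<in> sets lborel \<and> D \<subseteq> f ` B \<and> ennreal b \<le> emeasure lborel D + ennreal (1 / real (Suc n))"
      using ex[of "1 / real (Suc _)"] by auto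
    from choice[OF this] obtain D where D: "\<And>n. D n \<in> sets lborel" "\<And>n. D n \<subseteq> f ` B"
      "\<And>n. ennreal b \<le> emeasure lborel (D n) + ennreal (1 / real (Suc n))" by blast
    define D' where "D' = (\<Union>n. D n)"
    have D': "D' \<in> sets lborel" "D' \<subseteq> f ` B" using D by (auto simp: D'_def)
    have "ennreal b \<le> emeasure lborel D'"
    proof (rule ennreal_le_epsilon)
      fix e :: real assume "e > 0"
      then obtain n where n: "1 / real (Suc n) < e" using nat_approx_posE by blast
      have "ennreal b \<le> emeasure lborel (D n) + ennreal (1 / real (Suc n))" by (rule D(3))
      also have "\<dots> \<le> emeasure lborel D' + ennreal e"
        using n D' by (intro add_mono emeasure_mono ennreal_leI) (auto simp: D'_def)
      finally show "ennreal b \<le> emeasure lborel D' + ennreal e" .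
    qed
    then have "emeasure lborel (E - D') = 0"
    proof -
      assume le: "ennreal b \<le> emeasure lborel D'"
      have sub: "D' \<subseteq> E" using D'(2) E(2) by blast
      have "emeasure lborel D' \<le> emeasure lborel E" using sub E by (intro emeasure_mono) auto
      then have eq: "emeasure lborel D' = emeasure lborel E" using le b E(3) by simp
      have "emeasure lborel (E - D') = emeasure lborel E - emeasure lborel D'"
        using D' E b by (intro emeasure_Diff sub) (auto simp: eq)
      then show ?thesis unfolding eq unfolding E(3)[symmetric] b(1) using b(2) by (simp add: ennreal_minus)
    qed
    \<comment> \<open>The image lies between the Borel sets \<open>D'\<close> and \<open>E\<close>
      of equal finite measure, so completeness makes it measurable.\<close>
    then have "E - D' \<in> null_sets lborel" using E(1) D'(1) by (auto simp: null_sets_def)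
    then have "E - D' \<in> null_sets lebesgue" by (rule null_sets_completionI)
    then have "f ` B - D' \<in> null_sets lebesgue"
      by (rule null_sets_completion_subset[rotated]) (use E(2) in blast)
    then have "D' \<union> (f ` B - D') \<in> sets lebesgue" using D'(1) by (intro sets.Un) (auto intro: null_setsD2)
    then show ?thesis using D'(2) by (simp add: Un_absorb1)
  qed
  have eq: "f ` B = (\<Union>j::nat. f ` (B \<inter> f -` cball 0 (real j)))"
  proof (intro set_eqI iffI)
    fix y assume "y \<in> f ` B"
    then obtain x where x: "x \<in> B" "y = f x" by blast
    obtain j :: nat where "norm (f x) \<le> real j" using real_arch_simple by blast
    then have "x \<in> B \<inter> f -` cball 0 (real j)" using x(1) by simp
    then show "y \<in> (\<Union>j::nat. f ` (B \<inter> f -` cball 0 (real j)))" using x(2) by blast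
  qed blast
  have "f ` (B \<inter> f -` cball 0 (real j)) \<in> sets lebesgue" for j :: nat
  proof (rule bdd)
    have "closed (f -` cball 0 (real j))" using f by (simp add: continuous_on_closed_vimage)
    then show "B \<inter> f -` cball 0 (real j) \<in> sets borel" using B by auto
  qed auto
  then have "(\<Union>j::nat. f ` (B \<inter> f -` cball 0 (real j))) \<in> sets lebesgue" by (intro sets.countable_UN) blast
  then show ?thesis by (simp only: eq)
qed

section \<open>Choice of exponents\<close>

lemma spherical_average_return:
  fixes e :: "'a::euclidean_space"
  obtains C where "C > 0" "\<And>r. spherical_average (return borel e) r \<le> ennreal C"
proof -
  interpret prob_space "return borel e" by (rule prob_space_return) simp
  define T where "T = enn2real (emeasure (sphere_measure :: 'a measure) UNIV)"
  have T: "emeasure (sphere_measure :: 'a measure) UNIV = ennreal T"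
    unfolding T_def using emeasure_sphere_measure_finite[where 'a = 'a] by (simp add: ennreal_enn2real_if less_top)
  show thesis
  proof (rule that)
    show "T + 1 > 0" by (simp add: T_def add_nonneg_pos)
    fix r
    have "norm (fourier_transform (return borel e) \<xi>) \<le> 1" for \<xi>
      by (rule order_trans[OF norm_fourier_transform_le[OF finite_measure_axioms sets_return] prob_le_1])
    then have "spherical_average (return borel e) r \<le> (\<integral>\<^sup>+v. 1 \<partial>(sphere_measure :: 'a measure))"
      unfolding spherical_average_def by (intro nn_integral_mono) (simp add: power_le_one)
    also have "\<dots> = ennreal T" by (simp add: T)
    also have "\<dots> \<le> ennreal (T + 1)" by (intro ennreal_leI) simp
    finally show "spherical_average (return borel e) r \<le> ennreal (T + 1)" .
  qed
qed

text \<open>For \<open>x \<le> 0\<close> a Dirac mass with \<alpha> = 0 serves, its spherical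
  averages being bounded. Thus \<alpha> >= 0 in all cases, as \<open>spherical_shell_bound\<close>
  demands.\<close>

lemma spherical_fourier_dim_witness:
  fixes E :: "'a::euclidean_space set"
  assumes "E \<noteq> {}" and x: "x \<le> 0 \<or> ereal x < spherical_fourier_dim E"
  obtains \<alpha> \<mu> C where "x \<le> \<alpha>" "0 \<le> \<alpha>" "\<alpha> \<le> real DIM('a)" "\<mu> \<in> radon_measures_on E" "C > 0"
    "\<And>r. r > 0 \<Longrightarrow> spherical_average \<mu> r \<le> ennreal (C * r powr (- \<alpha>))"
proof (cases "x \<le> 0")
  case True
  obtain e where e: "e \<in> E" using assms by blast
  have M: "return borel e \<in> radon_measures_on E"
    by (rule radon_measures_onI(1)[where K = "{e}"]) (use e in \<open>auto simp: prob_space_return emeasure_return\<close>)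
  obtain C where C: "C > 0" "\<And>r. spherical_average (return borel e) r \<le> ennreal C"
    using spherical_average_return[of e] by metis
  show thesis by (rule that[of 0 "return borel e" C]) (use True M C in auto)
next
  case False
  then have "ereal x < spherical_fourier_dim E" using x by simp
  then obtain \<alpha> where \<alpha>: "x < \<alpha>" "\<alpha> \<le> real DIM('a)" "\<exists>\<mu>\<in>radon_measures_on E. \<exists>C>0. \<forall>r>0. spherical_average \<mu> r \<le> ennreal (C * r powr (- \<alpha>))"
    unfolding spherical_fourier_dim_def less_Sup_iff by auto
  then obtain \<mu> C where "\<mu> \<in> radon_measures_on E" "C > 0" "\<forall>r>0. spherical_average \<mu> r \<le> ennreal (C * r powr (- \<alpha>))"
    by blast
  then show thesis using False \<alpha> by (intro that[of \<alpha> \<mu> C]) auto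
qed

lemma spherical_fourier_dim_nonneg:
  fixes E :: "'a::euclidean_space set"
  assumes "E \<noteq> {}" shows "0 \<le> spherical_fourier_dim E"
proof -
  obtain e where e: "e \<in> E" using assms by blast
  have M: "return borel e \<in> radon_measures_on E"
    by (rule radon_measures_onI(1)[where K = "{e}"]) (use e in \<open>auto simp: prob_space_return emeasure_return\<close>)
  obtain C where C: "C > 0" "\<And>r. spherical_average (return borel e) r \<le> ennreal C"
    using spherical_average_return[of e] by metis
  have "ereal 0 \<le> spherical_fourier_dim E"
    unfolding spherical_fourier_dim_def
    by (rule Sup_upper, rule imageI) (use M C in \<open>auto intro!: bexI[of _ "return borel e"] exI[of _ C]\<close>)
  then show ?thesis by (simp add: zero_ereal_def)
qed

lemma hausdorff_dim_nonneg: "0 \<le> hausdorff_dim A"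
  unfolding hausdorff_dim_def by (rule Inf_greatest) auto

text \<open>The dimensions are extended reals whose finiteness is not established, hence the
  separate treatment of infinite summands.\<close>

lemma ereal_less_add_split:
  fixes a b :: ereal
  assumes "ereal y < a + b" "a \<noteq> -\<infinity>" "b \<noteq> -\<infinity>"
  obtains a' b' where "ereal a' < a" "ereal b' < b" "y < a' + b'"
proof -
  consider (rr) p q where "a = ereal p" "b = ereal q" | (ra) p where "a = ereal p" "b = \<infinity>"
    | (ar) q where "a = \<infinity>" "b = ereal q" | (aa) "a = \<infinity>" "b = \<infinity>"
    using assms(2,3) by (cases a; cases b) auto
  then show thesis
  proof cases
    case rr
    then have "y < p + q" using assms by simp
    then show thesis using rr by (intro that[of "p - (p + q - y) / 3" "q - (p + q - y) / 3"]) (auto simp: field_simps)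
  next
    case ra
    then show thesis by (intro that[of "p - 1" "y - p + 2"]) auto
  next
    case ar
    then show thesis by (intro that[of "y - q + 2" "q - 1"]) auto
  next
    case aa
    then show thesis by (intro that[of y 1]) auto
  qed
qed

lemma ereal_le_by_reals:
  fixes A B :: ereal
  assumes "\<And>y. ereal y < A \<Longrightarrow> ereal y \<le> B"
  shows "A \<le> B"
proof (rule dense_le)
  fix x assume "x < A"
  then show "x \<le> B" using assms by (cases x) auto
qed

text \<open>Raising \<open>t\<close> above \<open>p\<close> and \<open>s\<close> to at least 0 only
  enlarges the sum. \<open>x\<close> is left alone, for \<open>spherical_fourier_dim_witness\<close>
  accepts negative values.\<close>

lemma pick_exponents:
  assumes F: "0 \<le> F" and G: "ereal p < G" "0 \<le> p" and Z: "0 \<le> Z" and y: "ereal y < F + G + Z"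
  obtains x t s where "x \<le> 0 \<or> ereal x < F" "p \<le> t" "0 < t" "ereal t < G"
    "s = 0 \<or> 0 < s \<and> ereal s < Z" "y < x + t + s"
proof -
  have ninf: "F \<noteq> -\<infinity>" "G \<noteq> -\<infinity>" "Z \<noteq> -\<infinity>" using F G Z by auto
  then obtain w s' where w: "ereal w < F + G" and s': "ereal s' < Z" "y < w + s'"
    using ereal_less_add_split[OF y] by auto
  obtain x t' where x: "ereal x < F" and t': "ereal t' < G" "w < x + t'"
    using ereal_less_add_split[OF w] ninf by auto
  obtain t0 where t0: "ereal p < ereal t0" "ereal t0 < G"
    using ereal_dense2[OF G(1)] by blast
  define t where "t = max t' t0"
  define s where "s = max s' 0"
  show thesis
  proof (rule that[of x t s])
    show "p \<le> t" "0 < t" using t0 G(2) by (auto simp: t_def)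
    show "ereal t < G" using t' t0 by (auto simp: t_def max_def)
    show "s = 0 \<or> 0 < s \<and> ereal s < Z" using s' by (auto simp: s_def max_def)
    show "y < x + t + s" using s' t' by (auto simp: t_def s_def)
  qed (use x in simp)
qed

text \<open>The last conclusion meets the cap on exponents in \<open>fourier_dim\<close>: it
  combines \<alpha> <= d with t <= (d^2 - d)/2, the dimension of the group.\<close>

lemma fourier_decay_witness:
  fixes E :: "(real^'n) set" and G :: "(real^'n^'n) set"
  assumes d: "d = real CARD('n)" and E: "E \<noteq> {}" and G: "G \<noteq> {}" "G \<in> sets borel" "G \<subseteq> {g. orthogonal_matrix g}"
    and x: "x \<le> 0 \<or> ereal x < spherical_fourier_dim E"
    and t: "(d - 1) * (d - 2) / 2 \<le> t" "0 < t" "ereal t < hausdorff_dim G"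
  obtains \<nu> L D where "prob_space \<nu>" "sets \<nu> = sets borel" "compact L" "L \<subseteq> group_image G E" "emeasure \<nu> (- L) = 0"
    "D > 0" "\<And>\<xi>. (norm (fourier_transform \<nu> \<xi>))\<^sup>2 \<le> D * (1 + norm \<xi>) powr (- (x + t - (d\<^sup>2 - d) / 2))"
    "x + t - (d\<^sup>2 - d) / 2 \<le> d"
proof (rule spherical_fourier_dim_witness[OF E x])
  fix \<alpha> \<mu> C
  assume \<alpha>: "x \<le> \<alpha>" "0 \<le> \<alpha>" "\<alpha> \<le> real DIM(real^'n)" and \<mu>: "\<mu> \<in> radon_measures_on E" and C: "C > 0"
    and sph: "\<And>r. r > 0 \<Longrightarrow> spherical_average \<mu> r \<le> ennreal (C * r powr (- \<alpha>))"
  have t': "t = 0 \<or> t > 0 \<and> ereal t < hausdorff_dim G" using t by simp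
  show thesis
  proof (rule frostman[OF G(2,1) t'])
    fix \<theta> K B
    assume p\<theta>: "prob_space \<theta>" and s\<theta>: "sets \<theta> = sets borel" and K: "compact K" "K \<subseteq> G" "emeasure \<theta> (- K) = 0"
      and B: "B > 0" and ball: "\<And>x r. r > 0 \<Longrightarrow> emeasure \<theta> (cball x r) \<le> ennreal (B * r powr t)"
    interpret \<theta>: prob_space \<theta> by fact
    have t0: "t \<ge> 0" using t by simp
    have "emeasure \<theta> K \<noteq> 0"
    proof
      assume z: "emeasure \<theta> K = 0"
      have "emeasure \<theta> (space \<theta>) \<le> emeasure \<theta> (K \<union> - K)"
        using K(1) by (intro emeasure_mono) (auto simp: s\<theta> compact_imp_closed)
      also have "\<dots> \<le> emeasure \<theta> K + emeasure \<theta> (- K)"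
        using K(1) by (intro emeasure_subadditive) (auto simp: s\<theta> compact_imp_closed)
      finally show False using z K(3) \<theta>.emeasure_space_1 by simp
    qed
    from orthogonal_group_exponent_le[OF s\<theta> t0 B ball this order_trans[OF K(2) G(3)]]
    have td: "t \<le> (d\<^sup>2 - d) / 2" by (simp add: d)
    show thesis
    proof (rule rotated_measure_decay[OF \<mu> \<alpha>(2) C sph p\<theta> s\<theta> K G(3) t0 B ball d t(1)])
      fix \<nu> L D
      assume \<nu>: "prob_space \<nu>" "sets \<nu> = sets borel" "compact L" "L \<subseteq> group_image G E" "emeasure \<nu> (- L) = 0" "0 < D"
        and dec: "\<And>\<xi>. (norm (fourier_transform \<nu> \<xi>))\<^sup>2 \<le> D * (1 + norm \<xi>) powr (- (\<alpha> + t - (d\<^sup>2 - d) / 2))"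
      show thesis
      proof (rule that[OF \<nu>])
        fix \<xi> :: "real^'n"
        have "D * (1 + norm \<xi>) powr (- (\<alpha> + t - (d\<^sup>2 - d) / 2)) \<le> D * (1 + norm \<xi>) powr (- (x + t - (d\<^sup>2 - d) / 2))"
          using \<nu>(6) \<alpha>(1) by (intro mult_left_mono powr_mono) auto
        then show "(norm (fourier_transform \<nu> \<xi>))\<^sup>2 \<le> D * (1 + norm \<xi>) powr (- (x + t - (d\<^sup>2 - d) / 2))"
          using dec[of \<xi>] by linarith
        have "\<alpha> \<le> d" using \<alpha>(3) by (simp add: d)
        then show "x + t - (d\<^sup>2 - d) / 2 \<le> d" using td \<alpha>(1) by linarith
      qed
    qed
  qed
qed

lemma fourier_dim_ge:
  fixes E :: "(real^'n) set" and G :: "(real^'n^'n) set"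
  assumes d: "d = real CARD('n)" and E: "E \<noteq> {}" and G: "G \<noteq> {}" "G \<in> sets borel" "G \<subseteq> {g. orthogonal_matrix g}"
    and x: "x \<le> 0 \<or> ereal x < spherical_fourier_dim E"
    and t: "(d - 1) * (d - 2) / 2 \<le> t" "0 < t" "ereal t < hausdorff_dim G"
  shows "ereal (x + t - (d\<^sup>2 - d) / 2) \<le> fourier_dim (group_image G E)"
proof (rule fourier_decay_witness[OF d E G x t])
  fix \<nu> L D
  assume \<nu>: "prob_space \<nu>" "sets \<nu> = sets borel" and L: "compact L" "L \<subseteq> group_image G E" "emeasure \<nu> (- L) = 0" and D: "0 < D"
    and dec: "\<And>\<xi>. (norm (fourier_transform \<nu> \<xi>))\<^sup>2 \<le> D * (1 + norm \<xi>) powr (- (x + t - (d\<^sup>2 - d) / 2))"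
    and le: "x + t - (d\<^sup>2 - d) / 2 \<le> d"
  define a where "a = x + t - (d\<^sup>2 - d) / 2"
  have "norm (fourier_transform \<nu> \<xi>) \<le> sqrt D * (1 + norm \<xi>) powr (- a / 2)" for \<xi>
  proof (rule power2_le_imp_le)
    have "((1 + norm \<xi>) powr (- a / 2))\<^sup>2 = (1 + norm \<xi>) powr (- a)"
      by (simp add: power2_eq_square flip: powr_add)
    then show "(norm (fourier_transform \<nu> \<xi>))\<^sup>2 \<le> (sqrt D * (1 + norm \<xi>) powr (- a / 2))\<^sup>2"
      using dec[of \<xi>] D by (simp add: power_mult_distrib a_def)
  qed (use D in simp)
  moreover have "\<nu> \<in> radon_measures_on (group_image G E)" by (rule radon_measures_onI(1)[OF \<nu> L])
  moreover have "a \<le> real DIM(real^'n)" using le by (simp add: a_def d)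
  ultimately have "a \<in> {s. s \<le> real DIM(real^'n) \<and> (\<exists>\<mu>\<in>radon_measures_on (group_image G E). \<exists>C>0. \<forall>x.
        norm (fourier_transform \<mu> x) \<le> C * (1 + norm x) powr (- s / 2))}"
    using D by (intro CollectI conjI bexI[of _ \<nu>] exI[of _ "sqrt D"]) auto
  then show ?thesis unfolding fourier_dim_def a_def[symmetric] by (intro Sup_upper imageI)
qed

text \<open>Transforms multiply under convolution, so the decay exponent \<open>a\<close> of the
  rotated measure lowers the Sobolev exponent required on \<open>Z\<close> from \<open>u\<close> to
  \<open>u - a\<close>, which is below the Frostman exponent \<open>s\<close>.\<close>

lemma sobolev_witness:
  fixes E Z :: "(real^'n) set" and G :: "(real^'n^'n) set"
  assumes d: "d = real CARD('n)" and E: "E \<noteq> {}" and Z: "Z \<noteq> {}" "Z \<in> sets borel"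
    and G: "G \<noteq> {}" "G \<in> sets borel" "G \<subseteq> {g. orthogonal_matrix g}"
    and x: "x \<le> 0 \<or> ereal x < spherical_fourier_dim E"
    and t: "(d - 1) * (d - 2) / 2 \<le> t" "0 < t" "ereal t < hausdorff_dim G"
    and s: "s = 0 \<or> 0 < s \<and> ereal s < hausdorff_dim Z" and u: "u < x + t - (d\<^sup>2 - d) / 2 + s"
  obtains m L where "prob_space m" "sets m = sets borel" "compact L" "L \<subseteq> sumset (group_image G E) Z" "emeasure m (- L) = 0"
    "(\<integral>\<^sup>+x. ennreal ((norm (fourier_transform m x))\<^sup>2 * (1 + norm x) powr (u - real DIM(real^'n))) \<partial>lborel) < \<infinity>"
proof (rule fourier_decay_witness[OF d E G x t])
  fix \<nu> L D
  assume \<nu>: "prob_space \<nu>" "sets \<nu> = sets borel" and L: "compact L" "L \<subseteq> group_image G E" "emeasure \<nu> (- L) = 0" and D: "0 < D"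
    and dec: "\<And>\<xi>. (norm (fourier_transform \<nu> \<xi>))\<^sup>2 \<le> D * (1 + norm \<xi>) powr (- (x + t - (d\<^sup>2 - d) / 2))"
  define a where "a = x + t - (d\<^sup>2 - d) / 2"
  show thesis
  proof (rule frostman[OF Z(2,1) s])
    fix \<zeta> K B
    assume \<zeta>: "prob_space \<zeta>" "sets \<zeta> = sets borel" and K: "compact K" "K \<subseteq> Z" "emeasure \<zeta> (- K) = 0"
      and B: "B > 0" and ball: "\<And>x r. r > 0 \<Longrightarrow> emeasure \<zeta> (cball x r) \<le> ennreal (B * r powr s)"
    interpret \<zeta>: prob_space \<zeta> by fact
    note measF = borel_measurable_fourier_transform[OF \<zeta>.sigma_finite_measure_axioms \<zeta>(2), measurable]
    define f where "f p = fst p + snd p" for p :: "(real^'n) \<times> (real^'n)"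
    define m where "m = distr (\<nu> \<Otimes>\<^sub>M \<zeta>) borel f"
    have "continuous_on UNIV f" unfolding f_def by (intro continuous_intros)
    note supp = distr_pair_support[OF \<nu>(1) \<zeta>(1) \<nu>(2) \<zeta>(2) L(1,3) K(1,3) this]
    have s0: "s \<ge> 0" using s by auto
    have "u - a < s" using u by (simp add: a_def)
    from frostman_sobolev[OF \<zeta> s0 B ball this]
    have fin: "(\<integral>\<^sup>+x. ennreal ((norm (fourier_transform \<zeta> x))\<^sup>2 * (1 + norm x) powr (u - a - real DIM(real^'n))) \<partial>lborel) < \<infinity>" .
    have FT: "fourier_transform m \<xi> = fourier_transform \<nu> \<xi> * fourier_transform \<zeta> \<xi>" for \<xi>
      unfolding m_def f_def by (rule fourier_transform_sum[OF \<nu>(1) \<zeta>(1) \<nu>(2) \<zeta>(2)])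
    have pt: "ennreal ((norm (fourier_transform m \<xi>))\<^sup>2 * (1 + norm \<xi>) powr (u - real DIM(real^'n))) \<le>
        ennreal D * ennreal ((norm (fourier_transform \<zeta> \<xi>))\<^sup>2 * (1 + norm \<xi>) powr (u - a - real DIM(real^'n)))" for \<xi>
    proof -
      have "(norm (fourier_transform m \<xi>))\<^sup>2 * (1 + norm \<xi>) powr (u - real DIM(real^'n)) =
          (norm (fourier_transform \<nu> \<xi>))\<^sup>2 * ((norm (fourier_transform \<zeta> \<xi>))\<^sup>2 * (1 + norm \<xi>) powr (u - real DIM(real^'n)))"
        by (simp add: FT norm_mult power_mult_distrib)
      also have "\<dots> \<le> (D * (1 + norm \<xi>) powr (- a)) * ((norm (fourier_transform \<zeta> \<xi>))\<^sup>2 * (1 + norm \<xi>) powr (u - real DIM(real^'n)))"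
        using dec[of \<xi>] by (intro mult_right_mono) (auto simp: a_def)
      also have "\<dots> = D * ((norm (fourier_transform \<zeta> \<xi>))\<^sup>2 * ((1 + norm \<xi>) powr (- a) * (1 + norm \<xi>) powr (u - real DIM(real^'n))))"
        by (simp only: mult_ac)
      also have "(1 + norm \<xi>) powr (- a) * (1 + norm \<xi>) powr (u - real DIM(real^'n)) = (1 + norm \<xi>) powr (u - a - real DIM(real^'n))"
        by (subst powr_add[symmetric]) (simp add: algebra_simps)
      finally have "ennreal ((norm (fourier_transform m \<xi>))\<^sup>2 * (1 + norm \<xi>) powr (u - real DIM(real^'n))) \<le>
          ennreal (D * ((norm (fourier_transform \<zeta> \<xi>))\<^sup>2 * (1 + norm \<xi>) powr (u - a - real DIM(real^'n))))" by (rule ennreal_leI)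
      also have "\<dots> = ennreal D * ennreal ((norm (fourier_transform \<zeta> \<xi>))\<^sup>2 * (1 + norm \<xi>) powr (u - a - real DIM(real^'n)))"
        using D by (intro ennreal_mult) auto
      finally show ?thesis .
    qed
    show thesis
    proof (rule that)
      show "prob_space m" "sets m = sets borel" using supp(2) by (auto simp: m_def)
      show "compact (f ` (L \<times> K))" by (rule supp(3))
      show "emeasure m (- (f ` (L \<times> K))) = 0" using supp(4) by (simp add: m_def)
      show "f ` (L \<times> K) \<subseteq> sumset (group_image G E) Z" using L(2) K(2) unfolding f_def sumset_def by force
      have "(\<integral>\<^sup>+\<xi>. ennreal ((norm (fourier_transform m \<xi>))\<^sup>2 * (1 + norm \<xi>) powr (u - real DIM(real^'n))) \<partial>lborel) \<le>
          (\<integral>\<^sup>+\<xi>. ennreal D * ennreal ((norm (fourier_transform \<zeta> \<xi>))\<^sup>2 * (1 + norm \<xi>) powr (u - a - real DIM(real^'n))) \<partial>lborel)"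
        by (intro nn_integral_mono pt)
      also have "\<dots> = ennreal D * (\<integral>\<^sup>+\<xi>. ennreal ((norm (fourier_transform \<zeta> \<xi>))\<^sup>2 * (1 + norm \<xi>) powr (u - a - real DIM(real^'n))) \<partial>lborel)"
        by (rule nn_integral_cmult) measurable
      also have "\<dots> < \<infinity>" using fin by (simp add: ennreal_mult_less_top)
      finally show "(\<integral>\<^sup>+\<xi>. ennreal ((norm (fourier_transform m \<xi>))\<^sup>2 * (1 + norm \<xi>) powr (u - real DIM(real^'n))) \<partial>lborel) < \<infinity>" .
    qed
  qed
qed

text \<open>The map (g, x, z) to g x + z is polynomial, hence continuous, and a product of Borel
  sets is Borel.\<close>

lemma sumset_group_image_lebesgue:
  fixes E Z :: "(real^'n) set" and G :: "(real^'n^'n) set"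
  assumes "E \<in> sets borel" "Z \<in> sets borel" "G \<in> sets borel"
  shows "sumset (group_image G E) Z \<in> sets lebesgue"
proof -
  define f where "f p = fst p *v fst (snd p) + snd (snd p)" for p :: "(real^'n^'n) \<times> (real^'n) \<times> (real^'n)"
  have "continuous_on UNIV f"
    unfolding f_def matrix_vector_mult_def by (intro continuous_intros)
  moreover have "G \<times> E \<times> Z \<in> sets borel" using assms by (intro borel_Times)
  ultimately have "f ` (G \<times> E \<times> Z) \<in> sets lebesgue" by (rule lebesgue_continuous_image)
  moreover have "sumset (group_image G E) Z = f ` (G \<times> E \<times> Z)"
  proof (intro set_eqI iffI)
    fix y assume "y \<in> sumset (group_image G E) Z"
    then obtain g x z where "g \<in> G" "x \<in> E" "z \<in> Z" "y = g *v x + z"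
      by (auto simp: sumset_def group_image_def)
    then show "y \<in> f ` (G \<times> E \<times> Z)" by (intro image_eqI[of _ _ "(g, x, z)"]) (auto simp: f_def)
  next
    fix y assume "y \<in> f ` (G \<times> E \<times> Z)"
    then obtain g x z where "g \<in> G" "x \<in> E" "z \<in> Z" "y = g *v x + z"
      by (auto simp: f_def)
    then show "y \<in> sumset (group_image G E) Z" unfolding sumset_def group_image_def by blast
  qed
  ultimately show ?thesis by simp
qed

theorem theorem1p4:
  fixes E Z :: "(real^'n) set" and G :: "(real^'n^'n) set" and d :: real
  defines "d \<equiv> real CARD('n)"
  assumes "CARD('n) \<ge> 2"
    and "E \<noteq> {}" "E \<in> sets borel"
    and "Z \<noteq> {}" "Z \<in> sets borel"
    and "G \<noteq> {}" "G \<in> sets borel" "G \<subseteq> {g. orthogonal_matrix g}"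
    and "hausdorff_dim G > ereal ((d - 1) * (d - 2) / 2)"
  shows
    "fourier_dim (group_image G E)
       \<ge> spherical_fourier_dim E + hausdorff_dim G - ereal ((d^2 - d) / 2)
     \<and> sobolev_dim (sumset (group_image G E) Z)
       \<ge> spherical_fourier_dim E + hausdorff_dim G + hausdorff_dim Z - ereal ((d^2 - d) / 2)
     \<and> (spherical_fourier_dim E + hausdorff_dim G + hausdorff_dim Z > ereal ((d^2 + d) / 2)
          \<longrightarrow> emeasure lebesgue (sumset (group_image G E) Z) > 0)
     \<and> (\<forall>u. 0 < u \<and> u < d
            \<and> spherical_fourier_dim E + hausdorff_dim G + hausdorff_dim Z
                > ereal ((d^2 - d) / 2 + u)
          \<longrightarrow> hausdorff_dim (sumset (group_image G E) Z) \<ge> ereal u)"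
proof -
  have d: "d = real CARD('n)" by (simp add: d_def)
  have d2: "d \<ge> 2" using assms(2) by (simp add: d)
  define c where "c = (d^2 - d) / 2"
  define p where "p = (d - 1) * (d - 2) / 2"
  have p0: "p \<ge> 0" using d2 by (simp add: p_def)
  let ?F = "spherical_fourier_dim E" and ?G = "hausdorff_dim G" and ?Z = "hausdorff_dim Z"
  have F0: "0 \<le> ?F" by (rule spherical_fourier_dim_nonneg[OF assms(3)])
  have Gp: "ereal p < ?G" using assms(10) by (simp add: p_def)
  have shift: "ereal (y + c) < X" if "ereal y < X - ereal c" for y X
    using that by (cases X) auto
  have i1: "?F + ?G - ereal c \<le> fourier_dim (group_image G E)"
  proof (rule ereal_le_by_reals)
    fix y assume "ereal y < ?F + ?G - ereal c"
    \<comment> \<open>Adding 0 in place of the dimension of \<open>Z\<close> lets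
      \<open>pick_exponents\<close> serve here too; it forces \<open>s = 0\<close>.\<close>
    from shift[OF this] have "ereal (y + c) < ?F + ?G + 0" by simp
    then show "ereal y \<le> fourier_dim (group_image G E)"
    proof (rule pick_exponents[OF F0 Gp p0 order_refl])
      fix x t s assume h: "x \<le> 0 \<or> ereal x < ?F" "p \<le> t" "0 < t" "ereal t < ?G" "s = 0 \<or> 0 < s \<and> ereal s < 0" "y + c < x + t + s"
      then have "s = 0" by auto
      then have "ereal y \<le> ereal (x + t - (d\<^sup>2 - d) / 2)" using h(6) by (simp add: c_def)
      also have "\<dots> \<le> fourier_dim (group_image G E)"
        using fourier_dim_ge[OF d assms(3,7-9) h(1) h(2)[unfolded p_def] h(3,4)] .
      finally show ?thesis .
    qed
  qed
  have i2: "?F + ?G + ?Z - ereal c \<le> sobolev_dim (sumset (group_image G E) Z)"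
  proof (rule ereal_le_by_reals)
    fix y assume "ereal y < ?F + ?G + ?Z - ereal c"
    from shift[OF this] show "ereal y \<le> sobolev_dim (sumset (group_image G E) Z)"
    proof (rule pick_exponents[OF F0 Gp p0 hausdorff_dim_nonneg])
      fix x t s assume h: "x \<le> 0 \<or> ereal x < ?F" "p \<le> t" "0 < t" "ereal t < ?G" "s = 0 \<or> 0 < s \<and> ereal s < ?Z" "y + c < x + t + s"
      then have "y < x + t - (d\<^sup>2 - d) / 2 + s" by (simp add: c_def)
      then show ?thesis
      proof (rule sobolev_witness[OF d assms(3,5-9) h(1) h(2)[unfolded p_def] h(3-5)])
        fix m L
        assume m: "prob_space m" "sets m = sets borel" "compact L" "L \<subseteq> sumset (group_image G E) Z" "emeasure m (- L) = 0"
          and fin: "(\<integral>\<^sup>+x. ennreal ((norm (fourier_transform m x))\<^sup>2 * (1 + norm x) powr (y - real DIM(real^'n))) \<partial>lborel) < \<infinity>"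
        have "ereal y \<le> sobolev_dim_measure m"
          unfolding sobolev_dim_measure_def using fin by (intro Sup_upper imageI) simp
        also have "\<dots> \<le> sobolev_dim (sumset (group_image G E) Z)"
          unfolding sobolev_dim_def using radon_measures_onI[OF m] by (intro SUP_upper) simp
        finally show ?thesis .
      qed
    qed
  qed
  have ii: "emeasure lebesgue (sumset (group_image G E) Z) > 0" if "?F + ?G + ?Z > ereal ((d^2 + d) / 2)"
    using that
  proof (rule pick_exponents[OF F0 Gp p0 hausdorff_dim_nonneg])
    fix x t s assume h: "x \<le> 0 \<or> ereal x < ?F" "p \<le> t" "0 < t" "ereal t < ?G" "s = 0 \<or> 0 < s \<and> ereal s < ?Z" "(d\<^sup>2 + d) / 2 < x + t + s"
    \<comment> \<open>The threshold exceeds (d^2 - d)/2 by exactly d, so the Sobolev exponent d is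
      reached: the weight is constant and the transform of \<open>m\<close> is square
      integrable.\<close>
    then have "d < x + t - (d\<^sup>2 - d) / 2 + s" by (simp add: field_simps)
    then show ?thesis
    proof (rule sobolev_witness[OF d assms(3,5-9) h(1) h(2)[unfolded p_def] h(3-5)])
      fix m L
      assume m: "prob_space m" "sets m = sets borel" "compact L" "L \<subseteq> sumset (group_image G E) Z" "emeasure m (- L) = 0"
        and fin: "(\<integral>\<^sup>+x. ennreal ((norm (fourier_transform m x))\<^sup>2 * (1 + norm x) powr (d - real DIM(real^'n))) \<partial>lborel) < \<infinity>"
      have dD: "d = real DIM(real^'n)" by (simp add: d)
      have "d \<le> real DIM(real^'n)" by (simp add: d)
      then have "emeasure lborel L > 0"
      proof (rule sobolev_ball_average[OF m(1,2) _ fin])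
        fix C assume "C > 0" and "\<And>\<rho>. 0 < \<rho> \<Longrightarrow> \<rho> \<le> 1 \<Longrightarrow> (\<integral>\<^sup>+x. emeasure m (cball x \<rho>) \<partial>m) \<le> ennreal (C * \<rho> powr d)"
        then show ?thesis unfolding dD by (rule lborel_pos_ball_average[OF m(1-3,5)])
      qed
      also have "emeasure lborel L = emeasure lebesgue L" using m(3) by (simp add: compact_imp_closed)
      also have "\<dots> \<le> emeasure lebesgue (sumset (group_image G E) Z)"
        using m(4) sumset_group_image_lebesgue[OF assms(4,6,8)] by (rule emeasure_mono)
      finally show ?thesis .
    qed
  qed
  have iii: "hausdorff_dim (sumset (group_image G E) Z) \<ge> ereal u"
    if u: "0 < u" "u < d" and big: "?F + ?G + ?Z > ereal ((d^2 - d) / 2 + u)" for u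
    using big
  proof (rule pick_exponents[OF F0 Gp p0 hausdorff_dim_nonneg])
    fix x t s assume h: "x \<le> 0 \<or> ereal x < ?F" "p \<le> t" "0 < t" "ereal t < ?G" "s = 0 \<or> 0 < s \<and> ereal s < ?Z" "(d\<^sup>2 - d) / 2 + u < x + t + s"
    define b where "b = x + t - (d\<^sup>2 - d) / 2 + s"
    \<comment> \<open>\<open>w\<close> has to exceed \<open>u\<close>, to stay below the available
      exponent \<open>b\<close>, and not to exceed \<open>d\<close>, the limit in
      \<open>sobolev_ball_average\<close>; \<open>u < d\<close> leaves room for it.\<close>
    define w where "w = min d ((u + b) / 2)"
    have ub: "u < b" using h(6) by (simp add: b_def)
    then have w: "u < w" "w < b" "w \<le> d" using u by (auto simp: w_def min_def)
    then have "w < x + t - (d\<^sup>2 - d) / 2 + s" by (simp add: b_def)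
    then show ?thesis
    proof (rule sobolev_witness[OF d assms(3,5-9) h(1) h(2)[unfolded p_def] h(3-5)])
      fix m L
      assume m: "prob_space m" "sets m = sets borel" "compact L" "L \<subseteq> sumset (group_image G E) Z" "emeasure m (- L) = 0"
        and fin: "(\<integral>\<^sup>+x. ennreal ((norm (fourier_transform m x))\<^sup>2 * (1 + norm x) powr (w - real DIM(real^'n))) \<partial>lborel) < \<infinity>"
      have "w \<le> real DIM(real^'n)" using w by (simp add: d)
      then show ?thesis
      proof (rule sobolev_ball_average[OF m(1,2) _ fin])
        fix C assume "C > 0" and "\<And>\<rho>. 0 < \<rho> \<Longrightarrow> \<rho> \<le> 1 \<Longrightarrow> (\<integral>\<^sup>+x. emeasure m (cball x \<rho>) \<partial>m) \<le> ennreal (C * \<rho> powr w)"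
        then show ?thesis by (rule hausdorff_dim_ge_ball_average[OF m(1-3,5,4) u(1) w(1)])
      qed
    qed
  qed
  show ?thesis using i1 i2 ii iii unfolding c_def by blast
qed

end
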